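(* Let $\lambda\in\mathcal I$ be $k$-regular. Then the eigenvalue polynomial $f_\lambda$ of the Capelli operator $D_\lambda$ is $$f_\lambda=\frac{1}{H_\lambda(k)}P_\lambda^k .$$
   Context: Setting. Let $V=V_{\bar 0}\oplus V_{\bar 1}$ be a complex vector superspace with $\dim V_{\bar 0}=2m$, $\dim V_{\bar 1}=2n$, where $m,n$ are positive integers and $k:=n-m\ge 0$, equipped with a non-degenerate even supersymmetric bilinear form $\omega$. Let $\mathfrak g:=\mathfrak{gosp}(V,\omega):=\mathfrak{osp}(V,\omega)\oplus\mathbb C z$, with $z$ central and acting on $V$ by $-\mathrm{id}_V$. Let $\mathcal P(V)=\bigoplus_{d\ge0}\mathcal P^d(V)\cong \mathcal S(V^* )$ be the superalgebra of superpolynomials on $V$ graded by degree, $\mathcal D(V)=\bigoplus_{d\ge 0}\mathcal D^d(V)\cong\mathcal S(V)$ the superalgebra of constant-coefficient superdifferential operators graded by order, and $\mathcal{PD}(V)\cong\mathcal P(V)\otimes\mathcal D(V)$ the superalgebra of superdifferential operators with superpolynomial coefficients, with $\mathfrak g$ acting by supercommutator; $\mathcal{PD}(V)^{\mathfrak g}$ is the algebra of $\mathfrak g$-invariants. Partitions. $\mathcal I:=\{(\lambda_1,\lambda_2)\in\mathbb Z^2:\lambda_1\ge\lambda_2\ge0\}$, $|\lambda|:=\lambda_1+\lambda_2$. An element $\lambda\in\mathcal I$ is $k$-regular if $\lambda_1\le k$ or $\lambda_1-\lambda_2=k+1$ or $\lambda_1-\lambda_2\ge 2k+3$; it is $k$-quasiregular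 if $\lambda_1\ge k+1$ and $\lambda_1-\lambda_2\le k$; it is $k$-singular if $k+2\le\lambda_1-\lambda_2\le 2k+2$. $\mathcal I'_k$ is the set of all $k$-regular and $k$-quasiregular elements. Modules $V_\lambda$. Let $C$ be the Casimir operator of $\mathfrak g$ acting on $\mathcal P(V)$, normalized so that it acts on the irreducible $\mathfrak{osp}(V,\omega)$-module of highest weight $a\varepsilon_1$ by $a(a-2k-2)$ (here the Borel subalgebra has simple roots $\varepsilon_1-\varepsilon_2,\dots,\varepsilon_{m-1}-\varepsilon_m,\varepsilon_m-\delta_1,\dots,\delta_{n-1}-\delta_n,2\delta_n$). For $\lambda\in\mathcal I'_k$ put $c_\lambda:=(\lambda_1-\lambda_2)(\lambda_1-\lambda_2-2k-2)$ and let $V_\lambda$ be the generalized $c_\lambda$-eigenspace of $C$ on $\mathcal P^{|\lambda|}(V)$. Each $V_\lambda$ is an indecomposable $\mathfrak g$-module, $\mathcal P^d(V)=\bigoplus_{\lambda\in\mathcal I'_k,|\lambda|=d}V_\lambda$, and distinct $V_\lambda$ share no composition factors. The pairing $\mathcal D^d(V)\otimes\mathcal P^d(V)\to\mathbb C$, $(D,p)\mapsto Dp$, identifies $\mathcal D^d(V)\cong\mathcal P^d(V)^*$ and hence $\mathcal{PD}(V)^{\mathfrak g}\cong\bigoplus_{\lambda\in\mathcal I'_k}\mathrm{Hom}_{\mathfrak g}(V_\lambda,V_\lambda)$. Capelli operators. For $\lambda\in\mathcal I'_k$, $D_\lambda\in\mathcal{PD}(V)^{\mathfrak g}$ is the element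 corresponding to $\mathrm{id}_{V_\lambda}$ under this isomorphism. Every $D\in\mathcal{PD}(V)^{\mathfrak g}$ preserves each $V_\mu$ and has a single eigenvalue there; the eigenvalue polynomial of $D$ is the unique symmetric polynomial $f_D\in\mathbb C[x,y]$ such that the eigenvalue of $D$ on $V_\mu$ is $f_D(\mu_1-k-1,\mu_2)$ for all $\mu\in\mathcal I'_k$. Write $f_\lambda:=f_{D_\lambda}$. Knop–Sahi polynomials. With $a^{\underline r}:=a(a-1)\cdots(a-r+1)$, for $\lambda\in\mathcal I$ let $P_\lambda^\kappa\in\mathbb Q(\kappa)[x,y]$ be $$P_\lambda^\kappa(x,y):=\sum_{i+j\le\lambda_1-\lambda_2}\frac{(\lambda_1-\lambda_2)!\,(\kappa+1)^{\underline{\lambda_1-\lambda_2-i}}(\kappa+1)^{\underline{\lambda_1-\lambda_2-j}}}{i!\,j!\,(\lambda_1-\lambda_2-i-j)!\,(\kappa+1)^{\underline{\lambda_1-\lambda_2}}}\,x^{\underline{\lambda_2+i}}y^{\underline{\lambda_2+j}}$$ (sum over $i,j\ge0$), and $H_\lambda(\kappa):=(\lambda_1-\lambda_2)!\,\lambda_2!\,(\lambda_1-1-\kappa)^{\underline{\lambda_2}}$. The coefficients of $P^\kappa_\lambda$ have no pole at $\kappa=k$ when $\lambda$ is not $k$-singular; $P_\lambda^k$ denotes the specialization at $\kappa=k$. *)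

theory Defs
  imports
    Complex_Main
    "HOL-Library.Cardinality"
    "HOL-Library.Poly_Mapping"
    "HOL-Computational_Algebra.Polynomial"
    "HOL-Computational_Algebra.Fraction_Field"
begin

section \<open>Superpolynomials on a superspace\<close>

text \<open>
  The superspace \<open>V\<close> is given in a homogeneous basis \<open>e\<^sub>v\<close> indexed by \<open>v :: 'i + 'j\<close>:
  \<open>Inl\<close> indexes a basis of the even part, \<open>Inr\<close> one of the odd part.  The dual
  coordinates \<open>x\<^sub>i\<close> (even) and \<open>\<xi>\<^sub>j\<close> (odd) generate \<open>P(V) = S(V\<^sup>*)\<close>, which has the basis of
  all \<open>x\<^sup>\<alpha> \<xi>\<^sub>S\<close>, where \<open>\<xi>\<^sub>S\<close> is the product of the \<open>\<xi>\<^sub>s\<close> with \<open>s \<in> S\<close>, in increasing order.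
  The pair \<open>(\<alpha>, S)\<close> stands for \<open>x\<^sup>\<alpha> \<xi>\<^sub>S\<close>.  The multiplication is \<open>spmult\<close> below; the
  \<open>times\<close> instance for \<open>\<Rightarrow>\<^sub>0\<close> from the library is not used.
\<close>

type_synonym ('i, 'j) smonom = "('i \<Rightarrow> nat) \<times> 'j set"
type_synonym ('i, 'j) spoly = "('i, 'j) smonom \<Rightarrow>\<^sub>0 complex"
type_synonym ('i, 'j) sop = "('i, 'j) spoly \<Rightarrow> ('i, 'j) spoly"

definition spscale :: "complex \<Rightarrow> ('i, 'j) spoly \<Rightarrow> ('i, 'j) spoly" where
  "spscale c p = Poly_Mapping.map ((*) c) p"

text \<open>If \<open>S\<close> and \<open>T\<close> are disjoint then \<open>\<xi>\<^sub>S \<xi>\<^sub>T\<close> is \<open>\<xi>\<close> of the union, up to the sign of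
  the sorting permutation.\<close>

definition smonom_mult ::
    "('i, 'j::linorder) smonom \<Rightarrow> ('i, 'j) smonom \<Rightarrow> ('i, 'j) spoly" where
  "smonom_mult a b =
     (if snd a \<inter> snd b = {}
      then Poly_Mapping.single (\<lambda>i. fst a i + fst b i, snd a \<union> snd b)
             ((-1) ^ card {(s, t). s \<in> snd a \<and> t \<in> snd b \<and> t < s})
      else 0)"

definition spmult ::
    "('i, 'j::linorder) spoly \<Rightarrow> ('i, 'j) spoly \<Rightarrow> ('i, 'j) spoly" where
  "spmult p q =
     (\<Sum>a\<in>Poly_Mapping.keys p. \<Sum>b\<in>Poly_Mapping.keys q.
        spscale (Poly_Mapping.lookup p a * Poly_Mapping.lookup q b) (smonom_mult a b))"

definition smonom_deg :: "('i::finite, 'j) smonom \<Rightarrow> nat" where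
  "smonom_deg a = (\<Sum>i\<in>UNIV. fst a i) + card (snd a)"

definition homog :: "nat \<Rightarrow> ('i::finite, 'j) spoly set" where
  "homog d = {p. \<forall>a\<in>Poly_Mapping.keys p. smonom_deg a = d}"

fun is_odd :: "'i + 'j \<Rightarrow> bool" where
  "is_odd (Inl i) = False"
| "is_odd (Inr j) = True"

fun coord :: "'i + 'j \<Rightarrow> ('i, 'j) spoly" where
  "coord (Inl i) = Poly_Mapping.single ((\<lambda>_. 0)(i := 1), {}) 1"
| "coord (Inr j) = Poly_Mapping.single (\<lambda>_. 0, {j}) 1"


section \<open>Superdifferential operators\<close>

text \<open>The partial derivatives are left superderivations.\<close>

fun smonom_partial :: "'i + 'j::linorder \<Rightarrow> ('i, 'j) smonom \<Rightarrow> ('i, 'j) spoly" where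
  "smonom_partial (Inl i) (\<alpha>, S) = Poly_Mapping.single (\<alpha>(i := \<alpha> i - 1), S) (of_nat (\<alpha> i))"
| "smonom_partial (Inr j) (\<alpha>, S) =
     (if j \<in> S then Poly_Mapping.single (\<alpha>, S - {j}) ((-1) ^ card {s \<in> S. s < j}) else 0)"

definition spartial :: "'i + 'j::linorder \<Rightarrow> ('i, 'j) sop" where
  "spartial v p =
     (\<Sum>a\<in>Poly_Mapping.keys p. spscale (Poly_Mapping.lookup p a) (smonom_partial v a))"

text \<open>\<open>D\<^sup>d(V)\<close>: all linear combinations of \<open>d\<close>-fold composites of partial derivatives.\<close>

definition const_diff_ops :: "nat \<Rightarrow> ('i::finite, 'j::{finite,linorder}) sop set" where
  "const_diff_ops d =
     {D. \<exists>c. D = (\<lambda>q. \<Sum>vs | length vs = d. spscale (c vs) (foldr spartial vs q))}"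

text \<open>
  Elements of \<open>P(V) \<otimes> D(V)\<close> are represented (non-uniquely) by lists of pairs, the list of the
  \<open>(p, D)\<close> standing for the sum of the \<open>p \<otimes> D\<close>.  Two linear maps are defined on them: \<open>tens_op\<close>
  is the isomorphism \<open>p \<otimes> D \<mapsto> p D\<close> onto \<open>PD(V)\<close>, and \<open>tens_hom\<close> is \<open>p \<otimes> D \<mapsto> (q \<mapsto> \<langle>D, q\<rangle> p)\<close>.
  The pairing \<open>\<langle>D, q\<rangle>\<close> is the constant term of \<open>D q\<close>: for \<open>D \<in> D\<^sup>e(V)\<close> and \<open>q \<in> P\<^sup>d(V)\<close> this
  is \<open>D q\<close> if \<open>e = d\<close>, and \<open>0\<close> if \<open>e \<noteq> d\<close>.
\<close>

definition spairing :: "('i, 'j) sop \<Rightarrow> ('i, 'j) spoly \<Rightarrow> complex" where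
  "spairing D q = Poly_Mapping.lookup (D q) (\<lambda>_. 0, {})"

definition tensors :: "(('i::finite, 'j::{finite,linorder}) spoly \<times> ('i, 'j) sop) list set" where
  "tensors = {ts. \<forall>(p, D) \<in> set ts. \<exists>d. D \<in> const_diff_ops d}"

definition tens_op ::
    "(('i::finite, 'j::{finite,linorder}) spoly \<times> ('i, 'j) sop) list \<Rightarrow> ('i, 'j) sop" where
  "tens_op ts = (\<lambda>q. \<Sum>(p, D)\<leftarrow>ts. spmult p (D q))"

definition tens_hom ::
    "(('i::finite, 'j::{finite,linorder}) spoly \<times> ('i, 'j) sop) list \<Rightarrow> ('i, 'j) sop" where
  "tens_hom ts = (\<lambda>q. \<Sum>(p, D)\<leftarrow>ts. spscale (spairing D q) p)"

definition PD :: "('i::finite, 'j::{finite,linorder}) sop set" where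
  "PD = tens_op ` tensors"

text \<open>\<open>op_part False\<close> and \<open>op_part True\<close> are the even and the odd component of a linear
  operator.\<close>

definition parity_op :: "('i, 'j) sop" where
  "parity_op p =
     (\<Sum>a\<in>Poly_Mapping.keys p.
        Poly_Mapping.single a ((-1) ^ card (snd a) * Poly_Mapping.lookup p a))"

definition op_part :: "bool \<Rightarrow> ('i, 'j) sop \<Rightarrow> ('i, 'j) sop" where
  "op_part b A = (\<lambda>q. spscale (1/2)
     (A q + spscale (if b then -1 else 1) (parity_op (A (parity_op q)))))"

definition supercomm :: "('i, 'j) sop \<Rightarrow> ('i, 'j) sop \<Rightarrow> ('i, 'j) sop" where
  "supercomm A B = (\<lambda>q. \<Sum>a\<in>UNIV. \<Sum>b\<in>UNIV.
     op_part a A (op_part b B q)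
       - spscale (if a \<and> b then -1 else 1) (op_part b B (op_part a A q)))"


section \<open>The Lie superalgebras and the Casimir operator\<close>

text \<open>An element \<open>X\<close> of \<open>gl(V)\<close> is a matrix, \<open>X e\<^sub>v\<close> being the sum of the \<open>X u v e\<^sub>u\<close>, and a bilinear
  form on \<open>V\<close> is its Gram matrix \<open>\<omega> u v = \<omega>(e\<^sub>u, e\<^sub>v)\<close>.\<close>

type_synonym ('i, 'j) smat = "'i + 'j \<Rightarrow> 'i + 'j \<Rightarrow> complex"

definition even_supersym_nondeg :: "('i::finite, 'j::finite) smat \<Rightarrow> bool" where
  "even_supersym_nondeg \<omega> \<longleftrightarrow>
     (\<forall>u v. is_odd u \<noteq> is_odd v \<longrightarrow> \<omega> u v = 0) \<and>
     (\<forall>u v. \<omega> u v = (if is_odd u \<and> is_odd v then -1 else 1) * \<omega> v u) \<and>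
     (\<forall>x. (\<forall>v. (\<Sum>u\<in>UNIV. x u * \<omega> u v) = 0) \<longrightarrow> (\<forall>u. x u = 0))"

text \<open>The component of parity \<open>b\<close> of \<open>osp(V, \<omega>)\<close>: all \<open>X\<close> of parity \<open>b\<close> with
  \<open>\<omega>(X e\<^sub>v, e\<^sub>w) + (-1)\<^bsup>|X||v|\<^esup> \<omega>(e\<^sub>v, X e\<^sub>w) = 0\<close>.\<close>

definition osp_part :: "('i::finite, 'j::finite) smat \<Rightarrow> bool \<Rightarrow> ('i, 'j) smat set" where
  "osp_part \<omega> b =
     {X. (\<forall>u v. X u v \<noteq> 0 \<longrightarrow> (is_odd u \<noteq> is_odd v) = b) \<and>
         (\<forall>v w. (\<Sum>u\<in>UNIV. X u v * \<omega> u w)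
                + (if b \<and> is_odd v then -1 else 1) * (\<Sum>u\<in>UNIV. X u w * \<omega> v u) = 0)}"

definition osp :: "('i::finite, 'j::finite) smat \<Rightarrow> ('i, 'j) smat set" where
  "osp \<omega> = {\<lambda>u v. A u v + B u v | A B. A \<in> osp_part \<omega> False \<and> B \<in> osp_part \<omega> True}"

text \<open>Since \<open>id\<^sub>V\<close> is not in \<open>osp(V, \<omega>)\<close>, the action of \<open>gosp(V, \<omega>)\<close> on \<open>V\<close> is faithful, and
  we may take \<open>z = - id\<^sub>V\<close>.\<close>

definition gosp :: "('i::finite, 'j::finite) smat \<Rightarrow> ('i, 'j) smat set" where
  "gosp \<omega> = {\<lambda>u v. X u v + c * (if u = v then -1 else 0) | X c. X \<in> osp \<omega>}"

text \<open>The action on \<open>P(V)\<close> by superderivations.  For homogeneous \<open>X\<close> the contragredient action on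
  \<open>V\<^sup>*\<close> sends \<open>e\<^sub>u\<^sup>*\<close> to \<open>-(-1)\<^bsup>|X||u|\<^esup>\<close> times the sum of the \<open>X u v e\<^sub>v\<^sup>*\<close>, and \<open>|X| = |u| + |v|\<close>
  whenever \<open>X u v \<noteq> 0\<close>.\<close>

definition gl_act :: "('i::finite, 'j::{finite,linorder}) smat \<Rightarrow> ('i, 'j) sop" where
  "gl_act X = (\<lambda>q. - (\<Sum>u\<in>UNIV. \<Sum>v\<in>UNIV.
     spscale ((if is_odd u \<and> \<not> is_odd v then -1 else 1) * X u v)
       (spmult (coord v) (spartial u q))))"

definition PD_inv :: "('i::finite, 'j::{finite,linorder}) smat \<Rightarrow> ('i, 'j) sop set" where
  "PD_inv \<omega> = {D \<in> PD. \<forall>X\<in>gosp \<omega>. supercomm (gl_act X) D = (\<lambda>_. 0)}"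

text \<open>
  The invariant form \<open>(X, Y) \<mapsto> str(X Y) / 2\<close>, where the supertrace is over \<open>V\<close>.  On the dual of a
  Cartan subalgebra it makes the \<open>\<epsilon>\<^sub>i\<close> and the \<open>\<delta>\<^sub>j\<close> orthogonal, with \<open>(\<epsilon>\<^sub>i, \<epsilon>\<^sub>i) = 1\<close> and
  \<open>(\<delta>\<^sub>j, \<delta>\<^sub>j) = -1\<close>.  For the Borel subalgebra with simple roots \<open>\<epsilon>\<^sub>1 - \<epsilon>\<^sub>2, \<dots>, \<epsilon>\<^sub>m - \<delta>\<^sub>1, \<dots>, 2\<delta>\<^sub>n\<close>
  the coefficient of \<open>\<epsilon>\<^sub>1\<close> in \<open>2\<rho>\<close> is \<open>2m - 2n - 2 = -2k - 2\<close>, and so the Casimir operator of this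
  form acts on the irreducible module of highest weight \<open>a \<epsilon>\<^sub>1\<close> by
  \<open>(a \<epsilon>\<^sub>1, a \<epsilon>\<^sub>1 + 2\<rho>) = a (a - 2k - 2)\<close>.
\<close>

definition inv_form :: "('i::finite, 'j::finite) smat \<Rightarrow> ('i, 'j) smat \<Rightarrow> complex" where
  "inv_form X Y =
     (\<Sum>u\<in>UNIV. (if is_odd u then -1 else 1) * (\<Sum>w\<in>UNIV. X u w * Y w u)) / 2"

text \<open>\<open>X\<^sub>0, \<dots>, X\<^bsub>N-1\<^esub>\<close> is a homogeneous basis of \<open>osp(V, \<omega>)\<close> and \<open>Y\<^sub>0, \<dots>, Y\<^bsub>N-1\<^esub>\<close> is its left dual
  basis.  The form is symmetric on the even and skew on the odd part, so the side matters.\<close>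

definition dual_bases ::
    "('i::finite, 'j::finite) smat \<Rightarrow> nat \<Rightarrow> (nat \<Rightarrow> ('i, 'j) smat) \<Rightarrow> (nat \<Rightarrow> ('i, 'j) smat) \<Rightarrow> bool"
  where
  "dual_bases \<omega> N X Y \<longleftrightarrow>
     (\<forall>i<N. \<exists>b. X i \<in> osp_part \<omega> b \<and> Y i \<in> osp_part \<omega> b) \<and>
     (\<forall>i<N. \<forall>j<N. inv_form (Y i) (X j) = (if i = j then 1 else 0)) \<and>
     (\<forall>Z\<in>osp \<omega>. \<exists>c. Z = (\<lambda>u v. \<Sum>i<N. c i * X i u v))"

definition casimir :: "('i::finite, 'j::{finite,linorder}) smat \<Rightarrow> ('i, 'j) sop" where
  "casimir \<omega> = (THE C. \<exists>N X Y. dual_bases \<omega> N X Y \<and>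
     C = (\<lambda>q. \<Sum>i<N. gl_act (X i) (gl_act (Y i) q)))"


section \<open>Partitions and the modules \<open>V\<^sub>\<lambda>\<close>\<close>

definition partitions2 :: "(nat \<times> nat) set" where
  "partitions2 = {(l1, l2). l2 \<le> l1}"

definition k_regular :: "nat \<Rightarrow> nat \<times> nat \<Rightarrow> bool" where
  "k_regular k = (\<lambda>(l1, l2). l1 \<le> k \<or> l1 - l2 = k + 1 \<or> l1 - l2 \<ge> 2 * k + 3)"

definition k_quasiregular :: "nat \<Rightarrow> nat \<times> nat \<Rightarrow> bool" where
  "k_quasiregular k = (\<lambda>(l1, l2). l1 \<ge> k + 1 \<and> l1 - l2 \<le> k)"

definition nonsingular2 :: "nat \<Rightarrow> (nat \<times> nat) set" where
  "nonsingular2 k = {\<mu> \<in> partitions2. k_regular k \<mu> \<or> k_quasiregular k \<mu>}"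

definition casimir_eigenvalue :: "nat \<Rightarrow> nat \<times> nat \<Rightarrow> complex" where
  "casimir_eigenvalue k = (\<lambda>(l1, l2).
     (of_nat l1 - of_nat l2) * (of_nat l1 - of_nat l2 - 2 * of_nat k - 2))"

definition Vmod ::
    "('i::finite, 'j::{finite,linorder}) smat \<Rightarrow> nat \<Rightarrow> nat \<times> nat \<Rightarrow> ('i, 'j) spoly set" where
  "Vmod \<omega> k \<mu> =
     {p \<in> homog (fst \<mu> + snd \<mu>).
        \<exists>N. ((\<lambda>q. casimir \<omega> q - spscale (casimir_eigenvalue k \<mu>) q) ^^ N) p = 0}"


section \<open>Capelli operators and eigenvalue polynomials\<close>

text \<open>The operator corresponding to the identity of \<open>V\<^sub>\<lambda>\<close> under the isomorphism between
  \<open>PD(V)\<^sup>g\<close> and the direct sum of the \<open>Hom\<^sub>g(V\<^sub>\<mu>, V\<^sub>\<mu>)\<close>.\<close>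

definition capelli ::
    "('i::finite, 'j::{finite,linorder}) smat \<Rightarrow> nat \<Rightarrow> nat \<times> nat \<Rightarrow> ('i, 'j) sop" where
  "capelli \<omega> k l = (THE D. D \<in> PD_inv \<omega> \<and>
     (\<exists>ts\<in>tensors. D = tens_op ts \<and>
        (\<forall>\<mu>\<in>nonsingular2 k. \<forall>q\<in>Vmod \<omega> k \<mu>. tens_hom ts q = (if \<mu> = l then q else 0))))"

text \<open>\<open>'a poly poly\<close> represents \<open>'a[x, y]\<close>: the coefficient of \<open>x\<^sup>i y\<^sup>j\<close> is
  \<open>poly.coeff (poly.coeff f j) i\<close>.\<close>

definition poly_eval2 :: "'a::comm_ring_1 poly poly \<Rightarrow> 'a \<Rightarrow> 'a \<Rightarrow> 'a" where
  "poly_eval2 f x y = poly (poly f [:y:]) x"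

definition symmetric2 :: "'a::zero poly poly \<Rightarrow> bool" where
  "symmetric2 f \<longleftrightarrow> (\<forall>i j. poly.coeff (poly.coeff f j) i = poly.coeff (poly.coeff f i) j)"

definition eigenvalue_poly ::
    "('i::finite, 'j::{finite,linorder}) smat \<Rightarrow> nat \<Rightarrow> ('i, 'j) sop \<Rightarrow> complex poly poly" where
  "eigenvalue_poly \<omega> k D = (THE f. symmetric2 f \<and>
     (\<forall>\<mu>\<in>nonsingular2 k.
        {c. \<exists>q\<in>Vmod \<omega> k \<mu>. q \<noteq> 0 \<and> D q = spscale c q} =
        {poly_eval2 f (of_nat (fst \<mu>) - of_nat k - 1) (of_nat (snd \<mu>))}))"


section \<open>Knop--Sahi polynomials\<close>

definition falling :: "'a::comm_ring_1 \<Rightarrow> nat \<Rightarrow> 'a" where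
  "falling a r = (\<Prod>i<r. a - of_nat i)"

text \<open>\<open>rat poly fract\<close> is the field of rational functions in \<open>\<kappa>\<close>.\<close>

definition kappa :: "rat poly fract" where
  "kappa = Fract [:0, 1:] 1"

definition knop_sahi :: "nat \<times> nat \<Rightarrow> rat poly fract poly poly" where
  "knop_sahi = (\<lambda>(l1, l2). \<Sum>(i, j) | i + j \<le> l1 - l2.
     [:[: fact (l1 - l2) * falling (kappa + 1) (l1 - l2 - i) * falling (kappa + 1) (l1 - l2 - j)
          / (fact i * fact j * fact (l1 - l2 - i - j) * falling (kappa + 1) (l1 - l2)) :]:]
     * falling [:[:0, 1:]:] (l2 + i) * falling [:0, 1:] (l2 + j))"

text \<open>The value at \<open>t\<close> of a rational function that has no pole at \<open>t\<close>; common factors of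
  numerator and denominator have to be cancelled first.\<close>

definition fract_eval :: "rat \<Rightarrow> rat poly fract \<Rightarrow> rat" where
  "fract_eval t r = (THE c. \<exists>a b. poly b t \<noteq> 0 \<and> r = Fract a b \<and> c = poly a t / poly b t)"

definition knop_sahi_at :: "nat \<Rightarrow> nat \<times> nat \<Rightarrow> complex poly poly" where
  "knop_sahi_at k l = map_poly (map_poly (\<lambda>r. of_rat (fract_eval (of_nat k) r))) (knop_sahi l)"

definition knop_sahi_H :: "nat \<times> nat \<Rightarrow> complex \<Rightarrow> complex" where
  "knop_sahi_H = (\<lambda>(l1, l2) \<kappa>. fact (l1 - l2) * fact l2 * falling (of_nat l1 - 1 - \<kappa>) l2)"

end

theory Submission
  imports Defs "HOL-Analysis.Cartesian_Space"
begin

text \<open>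
  Let \<open>R\<close> be multiplication by the invariant quadratic superpolynomial, \<open>\<Delta>\<close> the dual Laplacian and
  \<open>E\<close> the Euler operator.  They satisfy \<open>[\<Delta>, R] = 4E - 4k\<close>, and the Casimir operator is
  \<open>E (E - 2k - 2) - R\<Delta>\<close>.  On superpolynomials of degree \<open>d\<close> this makes \<open>R\<^sup>i \<Delta>\<^sup>i\<close> the product of the
  \<open>R\<Delta> - e\<^sub>j\<close> with \<open>j < i\<close>, where \<open>e\<^sub>j = 4j (d - j - k - 1)\<close>; it vanishes for \<open>2i > d\<close>, so
  the spectrum of \<open>R\<Delta>\<close> is contained in \<open>{e\<^sub>j | 2j \<le> d}\<close>.  If \<open>l = (l\<^sub>1, l\<^sub>2)\<close> is regular, then \<open>e\<^sub>j\<close> with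
  \<open>j = l\<^sub>2\<close> differs from all the others, and by Newton interpolation the projection onto
  \<open>V\<^sub>l\<close> is a linear combination of the \<open>R\<^sup>i \<Delta>\<^sup>i\<close> with \<open>i \<ge> l\<^sub>2\<close>.  The corresponding Capelli operator is the
  same combination of the \<open>R\<^sup>i E (E - 1) \<cdots> (E - d + 2i + 1) \<Delta>\<^sup>i / (d - 2i)!\<close>, whose eigenvalue
  is explicit.  Vandermonde's identity identifies it with the Knop--Sahi polynomial.
\<close>

section \<open>Linear operators on superpolynomials\<close>

text \<open>The objects \<open>casimir\<close>, \<open>capelli\<close>,
  \<open>eigenvalue_poly\<close> and \<open>fract_eval\<close> are definite descriptions, so each
  needs uniqueness besides existence. The Casimir sum sees the dual bases only through the tensor of
  the \<open>X i\<close> and \<open>Y i\<close>. A Capelli tensor is fixed by its action on the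
  modules because they span every degree although singular partitions are omitted: e_j is invariant
  under j -> d - k - 1 - j, and this reflection turns a singular partition into a quasiregular one.
  The same coincidence is the main obstacle: roots of the annihilating polynomial may repeat, R
  Delta need not be diagonalizable, and the arguments run with generalized eigenvectors. Regularity
  says exactly that the one root in question is simple. The set of eigenvalues on a module must be a
  singleton, which calls for an actual eigenvector; a power of R times a power of an isotropic
  linear form is one. The number k enters as minus half the superdimension of V. On the Knop-Sahi
  side the obstacle is that (kappa + 1) falling l1 - l2 vanishes at kappa = k as soon as l1 - l2 >=
  k + 2, so denominators must be cancelled before specializing.\<close>

lemma lookup_spscale [simp]: "Poly_Mapping.lookup (spscale c p) a = c * Poly_Mapping.lookup p a"
  by (simp add: spscale_def Poly_Mapping.map.rep_eq when_def)

interpretation sp: vector_space spscale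
  by unfold_locales (simp_all add: poly_mapping_eq_iff fun_eq_iff lookup_add algebra_simps)

text \<open>Operators are bare functions, so linearity is a predicate. Together with
  \<open>slinear_ext\<close> it reduces identities between operators to basis monomials.\<close>

definition slinear :: "(('i, 'j) spoly \<Rightarrow> ('a, 'b) spoly) \<Rightarrow> bool" where
  "slinear F \<longleftrightarrow> (\<forall>p q. F (p + q) = F p + F q) \<and> (\<forall>c p. F (spscale c p) = spscale c (F p))"

lemma slinear_add: "slinear F \<Longrightarrow> F (p + q) = F p + F q"
  and slinear_scale: "slinear F \<Longrightarrow> F (spscale c p) = spscale c (F p)"
  by (simp_all add: slinear_def)

lemma slinear_zero: "slinear F \<Longrightarrow> F 0 = 0"
  using slinear_scale[of F 0 0] by simp

lemma slinear_minus: "slinear F \<Longrightarrow> F (- p) = - F p"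
  using slinear_scale[of F "-1" p] by simp

lemma slinear_diff: "slinear F \<Longrightarrow> F (p - q) = F p - F q"
  using slinear_add[of F p "- q"] slinear_minus[of F q] by simp

lemma slinear_sum: "slinear F \<Longrightarrow> F (\<Sum>x\<in>A. f x) = (\<Sum>x\<in>A. F (f x))"
  by (induction A rule: infinite_finite_induct) (simp_all add: slinear_zero slinear_add)

lemmas slinear_simps = slinear_add slinear_scale slinear_zero slinear_minus slinear_diff slinear_sum

lemma slinear_ident [simp]: "slinear (\<lambda>q. q)"
  by (simp add: slinear_def)

lemma slinear_zero_map [simp]: "slinear (\<lambda>q. 0)"
  by (simp add: slinear_def)

lemma slinear_plus [simp]: "slinear F \<Longrightarrow> slinear G \<Longrightarrow> slinear (\<lambda>q. F q + G q)"
  by (simp add: slinear_def sp.scale_right_distrib)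

lemma slinear_sub [simp]: "slinear F \<Longrightarrow> slinear G \<Longrightarrow> slinear (\<lambda>q. F q - G q)"
  by (simp add: slinear_def sp.scale_right_diff_distrib)

lemma slinear_uminus [simp]: "slinear F \<Longrightarrow> slinear (\<lambda>q. - F q)"
  by (simp add: slinear_def)

lemma slinear_spscale [simp]: "slinear F \<Longrightarrow> slinear (\<lambda>q. spscale c (F q))"
  by (simp add: slinear_def sp.scale_right_distrib mult.commute)

lemma slinear_setsum [simp]:
  "(\<And>x. x \<in> A \<Longrightarrow> slinear (F x)) \<Longrightarrow> slinear (\<lambda>q. \<Sum>x\<in>A. F x q)"
  by (simp add: slinear_def sum.distrib sp.scale_sum_right)

lemma slinear_compose: "slinear F \<Longrightarrow> slinear G \<Longrightarrow> slinear (\<lambda>q. F (G q))"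
  by (simp add: slinear_def)

lemma slinear_funpow:
  fixes F :: "('i, 'j) sop"
  shows "slinear F \<Longrightarrow> slinear (F ^^ n)"
proof (induction n)
  case (Suc n)
  have "F ^^ Suc n = (\<lambda>q. F ((F ^^ n) q))" by auto
  then show ?case using slinear_compose[of F "F ^^ n"] Suc by simp
qed (simp add: slinear_def)

lemma spoly_expansion:
  "p = (\<Sum>a\<in>Poly_Mapping.keys p. spscale (Poly_Mapping.lookup p a) (Poly_Mapping.single a 1))"
proof (rule poly_mapping_eqI)
  fix b
  show "Poly_Mapping.lookup p b = Poly_Mapping.lookup
     (\<Sum>a\<in>Poly_Mapping.keys p. spscale (Poly_Mapping.lookup p a) (Poly_Mapping.single a 1)) b"
    by (simp add: lookup_sum lookup_single when_def if_distrib[of "\<lambda>x. _ * x"]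
        sum.delta' in_keys_iff cong: if_cong)
qed

text \<open>Only the monomials occurring in \<open>p\<close> are compared, so that a hypothesis on
  the degree of \<open>p\<close> can be used, as in \<open>euler_homog\<close>.\<close>

lemma slinear_ext:
  assumes "slinear F" and "slinear G"
    and "\<And>a. a \<in> Poly_Mapping.keys p \<Longrightarrow> F (Poly_Mapping.single a 1) = G (Poly_Mapping.single a 1)"
  shows "F p = G p"
proof -
  have "F p = (\<Sum>a\<in>Poly_Mapping.keys p. spscale (Poly_Mapping.lookup p a) (F (Poly_Mapping.single a 1)))"
    by (subst (1) spoly_expansion) (simp add: assms slinear_simps)
  also have "\<dots> = (\<Sum>a\<in>Poly_Mapping.keys p. spscale (Poly_Mapping.lookup p a) (G (Poly_Mapping.single a 1)))"
    using assms(3) by simp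
  also have "\<dots> = G p"
    by (subst (3) spoly_expansion) (simp add: assms slinear_simps)
  finally show ?thesis .
qed

lemma linear_extension_eq:
  assumes "finite A" and "Poly_Mapping.keys p \<subseteq> A"
  shows "(\<Sum>a\<in>Poly_Mapping.keys p. spscale (Poly_Mapping.lookup p a) (f a)) =
    (\<Sum>a\<in>A. spscale (Poly_Mapping.lookup p a) (f a))"
  using assms by (intro sum.mono_neutral_left) (auto simp: in_keys_iff)

text \<open>Over a common finite set containing both supports the sum is visibly additive.
  Derivatives, products, parity and evaluation are all sums of this shape.\<close>

lemma slinear_extension:
  "slinear (\<lambda>p. \<Sum>a\<in>Poly_Mapping.keys p. spscale (Poly_Mapping.lookup p a) (f a))"
proof -
  have "(\<Sum>a\<in>Poly_Mapping.keys (p + q). spscale (Poly_Mapping.lookup (p + q) a) (f a)) =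
    (\<Sum>a\<in>Poly_Mapping.keys p. spscale (Poly_Mapping.lookup p a) (f a)) +
    (\<Sum>a\<in>Poly_Mapping.keys q. spscale (Poly_Mapping.lookup q a) (f a))" for p q
  proof -
    let ?A = "Poly_Mapping.keys p \<union> Poly_Mapping.keys q"
    have A: "finite ?A" by simp
    have "Poly_Mapping.keys (p + q) \<subseteq> ?A" by (rule Poly_Mapping.keys_add)
    from linear_extension_eq[OF A this] show ?thesis
      by (simp add: linear_extension_eq[OF A, of p] linear_extension_eq[OF A, of q]
          lookup_add sp.scale_left_distrib sum.distrib)
  qed
  moreover have "(\<Sum>a\<in>Poly_Mapping.keys (spscale c p). spscale (Poly_Mapping.lookup (spscale c p) a) (f a)) =
     spscale c (\<Sum>a\<in>Poly_Mapping.keys p. spscale (Poly_Mapping.lookup p a) (f a))" for c p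
    by (subst linear_extension_eq[of "Poly_Mapping.keys p"])
      (auto simp: in_keys_iff sp.scale_sum_right)
  ultimately show ?thesis by (simp add: slinear_def)
qed

lemma slinear_spartial [simp]: "slinear (spartial v)"
  unfolding spartial_def by (rule slinear_extension)

lemma spmult_eq: "spmult p q = (\<Sum>a\<in>Poly_Mapping.keys p. spscale (Poly_Mapping.lookup p a)
    (\<Sum>b\<in>Poly_Mapping.keys q. spscale (Poly_Mapping.lookup q b) (smonom_mult a b)))"
  by (simp add: spmult_def sp.scale_sum_right)

lemma slinear_spmult_left [simp]: "slinear (\<lambda>p. spmult p q)"
  unfolding spmult_eq by (rule slinear_extension)

lemma slinear_spmult [simp]: "slinear (spmult p)"
  unfolding spmult_eq by (intro slinear_setsum slinear_spscale slinear_extension)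

lemmas slinear_spmult_comp [simp] = slinear_compose[OF slinear_spmult]
lemmas slinear_spartial_comp [simp] = slinear_compose[OF slinear_spartial]
lemmas spmult_simps = slinear_simps[OF slinear_spmult]
lemmas spartial_simps = slinear_simps[OF slinear_spartial]

lemma spmult_single [simp]:
  "spmult (Poly_Mapping.single a 1) (Poly_Mapping.single b 1) = smonom_mult a b"
  by (simp add: spmult_def)

lemma spartial_single [simp]: "spartial v (Poly_Mapping.single a 1) = smonom_partial v a"
  by (simp add: spartial_def)

lemma single_eq_spscale: "Poly_Mapping.single a c = spscale c (Poly_Mapping.single a 1)"
  by (rule poly_mapping_eqI) (simp add: lookup_single when_def)

text \<open>The sign of moving \<open>\<xi>\<^sub>j\<close> to its place in \<open>\<xi>\<^sub>S\<close>.\<close>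

definition place_sign :: "'j::{finite,linorder} \<Rightarrow> 'j set \<Rightarrow> complex" where
  "place_sign j S = (-1) ^ card {s \<in> S. s < j}"

lemma place_sign_square [simp]: "place_sign j S * place_sign j S = 1"
  by (simp add: place_sign_def flip: power_mult_distrib)

lemma place_sign_self [simp]:
  "place_sign j (insert j S) = place_sign j S" "place_sign j (S - {j}) = place_sign j S"
proof -
  have "{s \<in> insert j S. s < j} = {s \<in> S. s < j}" "{s \<in> S - {j}. s < j} = {s \<in> S. s < j}" by auto
  then show "place_sign j (insert j S) = place_sign j S" "place_sign j (S - {j}) = place_sign j S"
    by (simp_all only: place_sign_def)
qed

text \<open>Together with \<open>place_sign_remove\<close> this is the source of the anticommutation
  of odd coordinates and odd derivatives.\<close>

lemma place_sign_insert:
  assumes "t \<notin> S"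
  shows "place_sign j (insert t S) = (if t < j then - place_sign j S else place_sign j S)"
proof -
  have "{s \<in> insert t S. s < j} = (if t < j then insert t {s \<in> S. s < j} else {s \<in> S. s < j})"
    by auto
  then show ?thesis using assms by (simp add: place_sign_def)
qed

lemma place_sign_remove:
  assumes "t \<in> S"
  shows "place_sign j (S - {t}) = (if t < j then - place_sign j S else place_sign j S)"
  using place_sign_insert[of t "S - {t}" j] assms by (auto simp: insert_absorb)

lemma mult_coord_even [simp]:
  "spmult (coord (Inl i)) (Poly_Mapping.single (\<alpha>, S) 1) = Poly_Mapping.single (\<alpha>(i := Suc (\<alpha> i)), S) 1"
proof -
  have "(\<lambda>k. ((\<lambda>_. 0)(i := 1)) k + \<alpha> k) = \<alpha>(i := Suc (\<alpha> i))" by auto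
  then show ?thesis by (simp add: smonom_mult_def)
qed

lemma mult_coord_odd [simp]:
  "spmult (coord (Inr j)) (Poly_Mapping.single (\<alpha>, S) 1) =
     (if j \<in> S then 0 else Poly_Mapping.single (\<alpha>, insert j S) (place_sign j S))"
proof -
  have "{(s, t). s \<in> {j} \<and> t \<in> S \<and> t < s} = Pair j ` {s \<in> S. s < j}" by auto
  then have "card {(s, t). s = j \<and> t \<in> S \<and> t < s} = card {s \<in> S. s < j}"
    by (simp add: card_image inj_on_def)
  then show ?thesis by (auto simp: smonom_mult_def place_sign_def)
qed

lemma smonom_partial_odd:
  "smonom_partial (Inr j) (\<alpha>, S) = (if j \<in> S then Poly_Mapping.single (\<alpha>, S - {j}) (place_sign j S) else 0)"
  by (simp add: place_sign_def)

abbreviation xop :: "'i + 'j \<Rightarrow> ('i, 'j::{finite,linorder}) sop" where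
  "xop v \<equiv> spmult (coord v)"

text \<open>The Koszul sign (-1)^(|u||v|). Its diagonal \<open>ssign u u\<close> is the parity sign
  (-1)^|u|, whose sum over the basis is the superdimension.\<close>

definition ssign :: "'i + 'j \<Rightarrow> 'i + 'j \<Rightarrow> complex" where
  "ssign u v = (if is_odd u \<and> is_odd v then -1 else 1)"

declare smonom_partial.simps(2) [simp del] smonom_partial_odd [simp] coord.simps [simp del]

lemma spscale_single [simp]: "spscale c (Poly_Mapping.single a d) = Poly_Mapping.single a (c * d)"
  by (rule poly_mapping_eqI) (simp add: lookup_single when_def)

lemma xop_even_scaled [simp]: "xop (Inl i) (Poly_Mapping.single (\<alpha>, S) c) =
   Poly_Mapping.single (\<alpha>(i := Suc (\<alpha> i)), S) c"
  by (subst (1) single_eq_spscale) (simp add: slinear_simps del: spscale_single, simp)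

lemma xop_odd_scaled [simp]: "xop (Inr j) (Poly_Mapping.single (\<alpha>, S) c) =
   (if j \<in> S then 0 else Poly_Mapping.single (\<alpha>, insert j S) (c * place_sign j S))"
  by (subst (1) single_eq_spscale) (simp add: slinear_simps del: spscale_single, simp)

lemma partial_even_scaled [simp]: "spartial (Inl i) (Poly_Mapping.single (\<alpha>, S) c) =
   Poly_Mapping.single (\<alpha>(i := \<alpha> i - 1), S) (c * of_nat (\<alpha> i))"
  by (subst (1) single_eq_spscale) (simp add: slinear_simps del: spscale_single, simp)

lemma partial_odd_scaled [simp]: "spartial (Inr j) (Poly_Mapping.single (\<alpha>, S) c) =
   (if j \<in> S then Poly_Mapping.single (\<alpha>, S - {j}) (c * place_sign j S) else 0)"
  by (subst (1) single_eq_spscale) (simp add: slinear_simps del: spscale_single, simp)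

lemma xop_xop:
  fixes q :: "('i, 'j::{finite,linorder}) spoly"
  shows "xop u (xop v q) = spscale (ssign u v) (xop v (xop u q))"
proof (rule slinear_ext[of "\<lambda>q. xop u (xop v q)" "\<lambda>q. spscale (ssign u v) (xop v (xop u q))"])
  fix a :: "('i, 'j) smonom"
  obtain \<alpha> S where a: "a = (\<alpha>, S)" by (cases a)
  show "xop u (xop v (Poly_Mapping.single a 1)) = spscale (ssign u v) (xop v (xop u (Poly_Mapping.single a 1)))"
    by (cases u; cases v)
      (auto simp: a ssign_def slinear_simps fun_upd_twist insert_commute place_sign_insert
        mult.commute simp flip: single_uminus)
qed auto

lemma spartial_spartial:
  fixes q :: "('i, 'j::{finite,linorder}) spoly"
  shows "spartial u (spartial v q) = spscale (ssign u v) (spartial v (spartial u q))"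
proof (rule slinear_ext[of "\<lambda>q. spartial u (spartial v q)"
      "\<lambda>q. spscale (ssign u v) (spartial v (spartial u q))"])
  fix a :: "('i, 'j) smonom"
  obtain \<alpha> S where a: "a = (\<alpha>, S)" by (cases a)
  have [simp]: "S - {x} - {y} = S - {y} - {x}" for x y by auto
  show "spartial u (spartial v (Poly_Mapping.single a 1)) =
      spscale (ssign u v) (spartial v (spartial u (Poly_Mapping.single a 1)))"
    by (cases u; cases v)
      (auto simp: a ssign_def slinear_simps fun_upd_twist place_sign_remove mult.commute
        simp flip: single_uminus)
qed auto

text \<open>With \<open>xop_xop\<close> and \<open>spartial_spartial\<close> these are the relations
  of the Weyl-Clifford superalgebra. The commutators of R and Delta are computed from them without
  returning to monomials.\<close>

lemma spartial_xop:
  fixes q :: "('i, 'j::{finite,linorder}) spoly"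
  shows "spartial u (xop v q) = (if u = v then q else 0) + spscale (ssign u v) (xop v (spartial u q))"
proof (rule slinear_ext[of "\<lambda>q. spartial u (xop v q)"
      "\<lambda>q. (if u = v then q else 0) + spscale (ssign u v) (xop v (spartial u q))" q])
  fix a :: "('i, 'j) smonom"
  obtain \<alpha> S where a: "a = (\<alpha>, S)" by (cases a)
  \<comment> \<open>Truncated subtraction spoils the exponent only if it is 0, and then the
    coefficient kills the monomial.\<close>
  have [simp]: "Poly_Mapping.single (\<alpha>(i := Suc (\<alpha> i - Suc 0)), S) (of_nat (\<alpha> i)) =
      Poly_Mapping.single (\<alpha>, S) (of_nat (\<alpha> i) :: complex)" for i
    by (cases "\<alpha> i") (auto intro!: arg_cong2[of _ _ _ _ Poly_Mapping.single])
  show "spartial u (xop v (Poly_Mapping.single a 1)) = (if u = v then Poly_Mapping.single a 1 else 0) +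
      spscale (ssign u v) (xop v (spartial u (Poly_Mapping.single a 1)))"
    by (cases u; cases v)
      (auto simp: a ssign_def slinear_simps fun_upd_twist place_sign_remove place_sign_insert
        mult.commute insert_absorb insert_Diff_if single_add Suc_diff_1 simp flip: single_uminus)
  show "slinear (\<lambda>q. (if u = v then q else 0) + spscale (ssign u v) (xop v (spartial u q)))"
    by (cases "u = v") simp_all
qed auto

section \<open>Laplacian and multiplication by the quadratic form\<close>

lemma spscale_if [simp]: "spscale c (if b then p else 0) = (if b then spscale c p else 0)"
  by simp

lemma sum_if_const: "(\<Sum>x\<in>A. if b then f x else 0) = (if b then \<Sum>x\<in>A. f x else 0)"
  by simp

lemma spscale_two: "spscale 2 p = p + p"
  by (rule poly_mapping_eqI) (simp add: lookup_add)

lemma spscale_sum_commute: "(\<Sum>u\<in>A. \<Sum>v\<in>B. spscale (f u v) (spscale c (g u v))) =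
    spscale c (\<Sum>u\<in>A. \<Sum>v\<in>B. spscale (f u v) (g u v))"
  by (simp add: sp.scale_sum_right mult.commute)

lemma ssign_commute: "ssign u v = ssign v u"
  by (auto simp: ssign_def)

lemma ssign_square [simp]: "ssign u v * ssign u v = 1"
  by (auto simp: ssign_def)

lemma ssign_cong: "is_odd u = is_odd u' \<Longrightarrow> is_odd v = is_odd v' \<Longrightarrow> ssign u v = ssign u' v'"
  by (auto simp: ssign_def)

text \<open>\<open>h\<close> is the inverse of the Gram matrix. The dimensions of V enter these
  assumptions only through the superdimension 2m - 2n = -2k.\<close>

locale superform =
  fixes \<omega> h :: "('i::finite, 'j::{finite,linorder}) smat" and k :: nat
  assumes form_parity: "is_odd u \<noteq> is_odd v \<Longrightarrow> \<omega> u v = 0"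
    and form_sym: "\<omega> u v = ssign u v * \<omega> v u"
    and inverse_parity: "is_odd u \<noteq> is_odd v \<Longrightarrow> h u v = 0"
    and inverse_sym: "h u v = ssign u v * h v u"
    and inverse_form: "(\<Sum>v\<in>UNIV. h p v * \<omega> v u) = (if p = u then 1 else 0)"
    and form_inverse: "(\<Sum>v\<in>UNIV. \<omega> p v * h v u) = (if p = u then 1 else 0)"
    and superdim: "(\<Sum>u\<in>UNIV. ssign u (u :: 'i + 'j)) = - 2 * of_nat k"
begin

definition euler :: "('i, 'j) sop" where
  "euler q = (\<Sum>v\<in>UNIV. xop v (spartial v q))"

text \<open>The transposed order in \<open>\<omega> v u\<close> matters on the odd part, where the
  form is skew: it fixes the relative sign of the even and the odd part of the quadratic form, on
  which invariance depends.\<close>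

definition rsq :: "('i, 'j) sop" where
  "rsq q = (\<Sum>u\<in>UNIV. \<Sum>v\<in>UNIV. spscale (\<omega> v u) (xop u (xop v q)))"

definition lap :: "('i, 'j) sop" where
  "lap q = (\<Sum>u\<in>UNIV. \<Sum>v\<in>UNIV. spscale (h u v) (spartial u (spartial v q)))"

definition grad :: "'i + 'j \<Rightarrow> ('i, 'j) sop" where
  "grad v q = (\<Sum>p\<in>UNIV. spscale (h p v) (spartial p q))"

lemma slinear_euler [simp]: "slinear euler"
  unfolding euler_def[abs_def] by simp

lemma slinear_rsq [simp]: "slinear rsq"
  unfolding rsq_def[abs_def] by simp

lemma slinear_lap [simp]: "slinear lap"
  unfolding lap_def[abs_def] by simp

lemma lap_xop: "lap (xop v q) = spscale 2 (grad v q) + xop v (lap q)"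
proof -
  have *: "spscale (h v r * ssign r v) x = spscale (h r v) x" for r x
    using inverse_sym[of r v] by (simp add: mult.commute)
  \<comment> \<open>\<open>h\<close> pairs only indices of equal parity, so the two Koszul signs
    cancel and the even operator \<open>lap\<close> passes a coordinate without a sign.\<close>
  have **: "spscale (h p r * (ssign r v * ssign p v)) x = spscale (h p r) x" for p r x
    using inverse_parity[of p r] ssign_cong[of p r v v] by (cases "is_odd p = is_odd r") auto
  have "lap (xop v q) = (\<Sum>p\<in>UNIV. \<Sum>r\<in>UNIV.
     (if r = v then spscale (h p r) (spartial p q) else 0) +
     (if p = v then spscale (h p r * ssign r v) (spartial r q) else 0) +
     spscale (h p r * (ssign r v * ssign p v)) (xop v (spartial p (spartial r q))))"
    unfolding lap_def by (intro sum.cong refl)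
      (simp add: spartial_xop spmult_simps spartial_simps sp.scale_right_distrib mult.assoc)
  also have "\<dots> = grad v q + grad v q + xop v (lap q)"
    by (simp add: sum.distrib sum_if_const * ** grad_def lap_def spmult_simps spartial_simps)
  finally show ?thesis by (simp add: spscale_two)
qed

lemma xop_rsq: "xop v (rsq q) = rsq (xop v q)"
proof -
  have *: "spscale (\<omega> r u) (xop v (xop u (xop r q))) = spscale (\<omega> r u) (xop u (xop r (xop v q)))" for u r
  proof (cases "is_odd u = is_odd r")
    case True
    then have "ssign v u = ssign v r" by (rule ssign_cong[OF refl])
    then show ?thesis
      by (subst xop_xop[of v u], subst xop_xop[of v r]) (simp add: spmult_simps spartial_simps)
  qed (simp add: form_parity)
  show ?thesis by (simp add: rsq_def spmult_simps spartial_simps * del: sp.scale_cancel_left)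
qed

lemma spartial_lap: "spartial v (lap q) = lap (spartial v q)"
proof -
  have *: "spscale (h u r) (spartial v (spartial u (spartial r q))) =
     spscale (h u r) (spartial u (spartial r (spartial v q)))" for u r
  proof (cases "is_odd u = is_odd r")
    case True
    then have "ssign v u = ssign v r" by (rule ssign_cong[OF refl])
    then show ?thesis
      by (subst spartial_spartial[of v u], subst spartial_spartial[of v r]) (simp add: spmult_simps spartial_simps)
  qed (simp add: inverse_parity)
  show ?thesis by (simp add: lap_def spmult_simps spartial_simps * del: sp.scale_cancel_left)
qed

lemma spartial_rsq:
  "spartial u (rsq q) = spscale 2 (\<Sum>r\<in>UNIV. spscale (\<omega> r u) (xop r q)) + rsq (spartial u q)"
proof -
  have *: "spscale (\<omega> u p * ssign u p) x = spscale (\<omega> p u) x" for p x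
    using form_sym[of p u] ssign_commute[of p u] by (simp add: mult.commute)
  have **: "spscale (\<omega> r p * (ssign u p * ssign u r)) x = spscale (\<omega> r p) x" for p r x
    using form_parity[of p r] form_parity[of r p] ssign_cong[of u u p r]
    by (cases "is_odd p = is_odd r") auto
  have "spartial u (rsq q) = (\<Sum>p\<in>UNIV. \<Sum>r\<in>UNIV.
      (if u = p then spscale (\<omega> r p) (xop r q) else 0) +
      (if u = r then spscale (\<omega> r p * ssign u p) (xop p q) else 0) +
      spscale (\<omega> r p * (ssign u p * ssign u r)) (xop p (xop r (spartial u q))))"
    unfolding rsq_def slinear_sum[OF slinear_spartial] slinear_scale[OF slinear_spartial]
    by (intro sum.cong refl)
      (auto simp add: spartial_xop spmult_simps spartial_simps sp.scale_right_distrib mult.assoc)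
  also have "\<dots> = (\<Sum>r\<in>UNIV. spscale (\<omega> r u) (xop r q)) +
      (\<Sum>r\<in>UNIV. spscale (\<omega> r u) (xop r q)) + rsq (spartial u q)"
    by (simp add: sum.distrib sum_if_const * ** rsq_def)
  finally show ?thesis by (simp add: spscale_two)
qed

text \<open>Contracting with \<open>h\<close> in the wrong index order costs the parity sign. This
  is how the superdimension, rather than the dimension, enters \<open>lap_rsq\<close>.\<close>

lemma form_inverse': "(\<Sum>u\<in>UNIV. \<omega> v u * h p u) = (if p = v then ssign v v else 0)"
proof -
  have *: "\<omega> v u * h p u = ssign v v * (h p u * \<omega> u v)" for u
    using form_sym[of v u] form_parity[of u v] ssign_cong[of v v u v]
    by (cases "is_odd u = is_odd v") auto
  show ?thesis unfolding * by (simp add: inverse_form flip: sum_distrib_left)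
qed

text \<open>Each of the two mixed contractions gives 2E. In the first one the derivative also hits
  the coordinate just multiplied in, which adds twice the superdimension, that is -4k.\<close>

lemma lap_rsq: "lap (rsq q) = rsq (lap q) + spscale 4 (euler q) - spscale (4 * of_nat k) q"
proof -
  have "lap (rsq q) = (\<Sum>u\<in>UNIV. \<Sum>v\<in>UNIV. spscale (\<omega> v u) (spscale 2 (grad u (xop v q)))) +
     (\<Sum>u\<in>UNIV. \<Sum>v\<in>UNIV. spscale (\<omega> v u) (spscale 2 (xop u (grad v q)))) + rsq (lap q)"
    by (simp add: rsq_def slinear_sum[OF slinear_lap] slinear_scale[OF slinear_lap] lap_xop spmult_simps sp.scale_right_distrib sum.distrib add.assoc)
  moreover have "(\<Sum>u\<in>UNIV. \<Sum>v\<in>UNIV. spscale (\<omega> v u) (spscale 2 (xop u (grad v q)))) = spscale 2 (euler q)"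
  proof -
    have "(\<Sum>v\<in>UNIV. spscale (\<omega> v u) (xop u (grad v q))) = xop u (spartial u q)" for u
    proof -
      have "(\<Sum>v\<in>UNIV. spscale (\<omega> v u) (xop u (grad v q))) =
          (\<Sum>v\<in>UNIV. \<Sum>p\<in>UNIV. spscale (h p v * \<omega> v u) (xop u (spartial p q)))"
        by (simp add: grad_def spmult_simps spartial_simps sp.scale_sum_right mult.commute)
      also have "\<dots> = (\<Sum>p\<in>UNIV. spscale (\<Sum>v\<in>UNIV. h p v * \<omega> v u) (xop u (spartial p q)))"
        by (subst sum.swap) (simp add: sp.scale_sum_left)
      also have "\<dots> = xop u (spartial u q)"
        by (simp add: inverse_form if_distrib[of "\<lambda>c. spscale c _"] cong: if_cong)
      finally show ?thesis .
    qed
    then show ?thesis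
      by (simp only: spscale_sum_commute euler_def)
  qed
  moreover have "(\<Sum>u\<in>UNIV. \<Sum>v\<in>UNIV. spscale (\<omega> v u) (spscale 2 (grad u (xop v q)))) =
      spscale 2 (euler q) - spscale (4 * of_nat k) q"
  proof -
    have "(\<Sum>u\<in>UNIV. spscale (\<omega> v u) (grad u (xop v q))) = spscale (ssign v v) q + xop v (spartial v q)" for v
    proof -
      have "(\<Sum>u\<in>UNIV. spscale (\<omega> v u) (grad u (xop v q))) =
          (\<Sum>u\<in>UNIV. \<Sum>p\<in>UNIV. spscale (\<omega> v u * h p u) (spartial p (xop v q)))"
        by (simp add: grad_def sp.scale_sum_right)
      also have "\<dots> = (\<Sum>p\<in>UNIV. spscale (\<Sum>u\<in>UNIV. \<omega> v u * h p u) (spartial p (xop v q)))"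
        by (subst sum.swap) (simp add: sp.scale_sum_left)
      also have "\<dots> = spscale (ssign v v) (spartial v (xop v q))"
        by (simp add: form_inverse' if_distrib[of "\<lambda>c. spscale c _"] cong: if_cong)
      finally show ?thesis by (simp add: spartial_xop sp.scale_right_distrib)
    qed
    then have "(\<Sum>v\<in>UNIV. \<Sum>u\<in>UNIV. spscale (\<omega> v u) (grad u (xop v q))) =
        spscale (- 2 * of_nat k) q + euler q"
      by (simp add: sum.distrib euler_def superdim flip: sp.scale_sum_left)
    then have "spscale 2 (\<Sum>v\<in>UNIV. \<Sum>u\<in>UNIV. spscale (\<omega> v u) (grad u (xop v q))) =
       spscale 2 (euler q) - spscale (4 * of_nat k) q"
      by (simp add: sp.scale_right_diff_distrib)
    then show ?thesis
      by (subst sum.swap) (simp only: spscale_sum_commute)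
  qed
  ultimately show ?thesis
    using sp.scale_left_distrib[of 2 2 "euler q"] by (simp only:) simp
qed

end

lemma sum_UNIV_Plus:
  fixes f :: "'i::finite + 'j::finite \<Rightarrow> 'c::comm_monoid_add"
  shows "(\<Sum>v\<in>UNIV. f v) = (\<Sum>i\<in>UNIV. f (Inl i)) + (\<Sum>j\<in>UNIV. f (Inr j))"
  by (simp add: UNIV_Plus_UNIV[symmetric] sum.Plus del: UNIV_Plus_UNIV)

section \<open>Degrees of superpolynomials\<close>

lemma homog_zero [simp]: "0 \<in> homog d"
  by (simp add: homog_def)

lemma homog_spscale [intro]: "p \<in> homog d \<Longrightarrow> spscale c p \<in> homog d"
  by (auto simp: homog_def in_keys_iff)

lemma homog_add [intro]: "p \<in> homog d \<Longrightarrow> q \<in> homog d \<Longrightarrow> p + q \<in> homog d"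
  using Poly_Mapping.keys_add[of p q] by (auto simp: homog_def)

lemma homog_diff [intro]: "p \<in> homog d \<Longrightarrow> q \<in> homog d \<Longrightarrow> p - q \<in> homog d"
  using homog_add[of p d "- q"] homog_spscale[of q d "-1"] by simp

lemma homog_sum [intro]: "(\<And>x. x \<in> A \<Longrightarrow> f x \<in> homog d) \<Longrightarrow> (\<Sum>x\<in>A. f x) \<in> homog d"
  by (induction A rule: infinite_finite_induct) auto

lemma homog_single: "smonom_deg a = d \<Longrightarrow> Poly_Mapping.single a c \<in> homog d"
  by (auto simp: homog_def)

lemma homog_map:
  assumes "slinear F" and "p \<in> homog d"
    and "\<And>a. smonom_deg a = d \<Longrightarrow> F (Poly_Mapping.single a 1) \<in> homog d'"
  shows "F p \<in> homog d'"
proof -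
  have "F p = (\<Sum>a\<in>Poly_Mapping.keys p. spscale (Poly_Mapping.lookup p a) (F (Poly_Mapping.single a 1)))"
    using arg_cong[OF spoly_expansion[of p], of F]
    by (simp add: slinear_sum[OF assms(1)] slinear_scale[OF assms(1)] del: spscale_single)
  also have "\<dots> \<in> homog d'"
    by (intro homog_sum homog_spscale assms(3)) (use assms(2) in \<open>auto simp: homog_def[of d]\<close>)
  finally show ?thesis .
qed

text \<open>Stated additively, so that it serves for raising and for lowering an exponent without
  truncated subtraction.\<close>

lemma smonom_deg_upd: "smonom_deg (\<alpha>(i := n), S) + \<alpha> i = smonom_deg (\<alpha>, S) + n"
proof -
  have "(\<Sum>j\<in>UNIV. (\<alpha>(i := n)) j) = n + sum \<alpha> (UNIV - {i})"
    by (subst sum.remove[of _ i]) (auto intro!: sum.cong)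
  moreover have "sum \<alpha> UNIV = \<alpha> i + sum \<alpha> (UNIV - {i})"
    by (subst sum.remove[of _ i]) auto
  ultimately show ?thesis by (simp add: smonom_deg_def)
qed

lemma xop_homog:
  fixes p :: "('i::finite, 'j::{finite,linorder}) spoly"
  assumes "p \<in> homog d"
  shows "xop v p \<in> homog (Suc d)"
proof (rule homog_map[OF _ assms])
  fix a :: "('i, 'j) smonom"
  assume a: "smonom_deg a = d"
  obtain \<alpha> S where "a = (\<alpha>, S)" by (cases a)
  with a show "xop v (Poly_Mapping.single a 1) \<in> homog (Suc d)"
    using smonom_deg_upd[of \<alpha> "projl v" "Suc (\<alpha> (projl v))" S]
    by (cases v) (auto intro!: homog_single, simp add: smonom_deg_def)
qed simp

lemma spartial_homog:
  fixes p :: "('i::finite, 'j::{finite,linorder}) spoly"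
  assumes "p \<in> homog d"
  shows "spartial v p \<in> homog (d - 1)"
proof (rule homog_map[OF _ assms])
  fix a :: "('i, 'j) smonom"
  assume a: "smonom_deg a = d"
  obtain \<alpha> S where [simp]: "a = (\<alpha>, S)" by (cases a)
  show "spartial v (Poly_Mapping.single a 1) \<in> homog (d - 1)"
  proof (cases v)
    case (Inl i)
    have "smonom_deg (\<alpha>(i := \<alpha> i - 1), S) = d - 1" if "\<alpha> i \<noteq> 0"
      using smonom_deg_upd[of \<alpha> i "\<alpha> i - 1" S] a that by simp
    then show ?thesis using Inl by (cases "\<alpha> i = 0") (auto intro!: homog_single)
  next
    case (Inr j)
    have "0 < card S" if "j \<in> S" using that by (auto simp: card_gt_0_iff)
    then show ?thesis using a Inr
      by (auto intro!: homog_single simp: smonom_deg_def)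
  qed
qed simp

lemma spartial_homog_0:
  fixes p :: "('i::finite, 'j::{finite,linorder}) spoly"
  assumes "p \<in> homog 0"
  shows "spartial v p = 0"
proof (rule slinear_ext[of "spartial v" "\<lambda>q. 0" p])
  fix a assume "a \<in> Poly_Mapping.keys p"
  then have a: "smonom_deg a = 0" using assms by (auto simp: homog_def)
  obtain \<alpha> S where "a = (\<alpha>, S)" by (cases a)
  then show "spartial v (Poly_Mapping.single a 1) = 0"
    using a by (cases v) (auto simp: smonom_deg_def)
qed auto

context superform begin

text \<open>Each x_v d_v is diagonal on monomials: it counts the exponent of an even coordinate, or
  the presence of an odd one.\<close>

lemma euler_homog:
  assumes "p \<in> homog d"
  shows "euler p = spscale (of_nat d) p"
proof (rule slinear_ext[of euler "spscale (of_nat d)" p])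
  fix a assume "a \<in> Poly_Mapping.keys p"
  then have a: "smonom_deg a = d" using assms by (auto simp: homog_def)
  obtain \<alpha> S where aS: "a = (\<alpha>, S)" by (cases a)
  have "xop (Inl i) (spartial (Inl i) (Poly_Mapping.single a 1)) =
      spscale (of_nat (\<alpha> i)) (Poly_Mapping.single a 1)" for i
    by (cases "\<alpha> i") (auto simp: aS spmult_simps intro!: arg_cong2[of _ _ _ _ Poly_Mapping.single])
  moreover have "xop (Inr j) (spartial (Inr j) (Poly_Mapping.single a 1)) =
      spscale (of_bool (j \<in> S)) (Poly_Mapping.single a 1)" for j
    by (auto simp: aS insert_absorb spmult_simps)
  ultimately have "euler (Poly_Mapping.single a 1) =
      spscale ((\<Sum>i\<in>UNIV. of_nat (\<alpha> i)) + (\<Sum>j\<in>UNIV. of_bool (j \<in> S))) (Poly_Mapping.single a 1)"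
    unfolding euler_def sum_UNIV_Plus by (simp only: sp.scale_left_distrib sp.scale_sum_left)
  also have "(\<Sum>i\<in>UNIV. of_nat (\<alpha> i)) + (\<Sum>j\<in>UNIV. of_bool (j \<in> S)) = (of_nat d :: complex)"
    using a by (simp add: aS smonom_deg_def Int_def flip: a)
  finally show "euler (Poly_Mapping.single a 1) = spscale (of_nat d) (Poly_Mapping.single a 1)" .
qed (auto intro: slinear_spscale[of "\<lambda>q. q", simplified])

lemma rsq_homog: "p \<in> homog d \<Longrightarrow> rsq p \<in> homog (d + 2)"
  unfolding rsq_def by (intro homog_sum homog_spscale) (simp add: xop_homog)

lemma lap_homog: "p \<in> homog d \<Longrightarrow> lap p \<in> homog (d - 2)"
  unfolding lap_def
  by (intro homog_sum homog_spscale) (metis diff_diff_left one_add_one spartial_homog)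

lemma lap_homog_small: "p \<in> homog d \<Longrightarrow> d < 2 \<Longrightarrow> lap p = 0"
  unfolding lap_def
proof (intro sum.neutral ballI)
  fix u v
  assume "p \<in> homog d" and "d < 2"
  then have "spartial v p \<in> homog 0" using spartial_homog[of p d v] by simp
  then show "spscale (h u v) (spartial u (spartial v p)) = 0" by (simp add: spartial_homog_0)
qed

end

section \<open>The orthosymplectic Lie superalgebra\<close>

text \<open>The sign (-1)^(|u|(|u|+|v|)) of the contragredient action.\<close>

definition gsign :: "'i + 'j \<Rightarrow> 'i + 'j \<Rightarrow> complex" where
  "gsign u v = (if is_odd u \<and> \<not> is_odd v then -1 else 1)"

lemma slinear_gl_act [simp]: "slinear (gl_act X)"
  unfolding gl_act_def by simp

lemma gl_act_eq: "gl_act X q =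
    - (\<Sum>u\<in>UNIV. \<Sum>v\<in>UNIV. spscale (gsign u v * X u v) (xop v (spartial u q)))"
  by (simp add: gl_act_def gsign_def)

lemma spoly_eq_neg_self: "(p :: ('i, 'j) spoly) = - p \<Longrightarrow> p = 0"
proof (rule poly_mapping_eqI)
  fix a assume "p = - p"
  then have "Poly_Mapping.lookup p a = Poly_Mapping.lookup (- p) a" by (rule arg_cong)
  then have "Poly_Mapping.lookup p a = - Poly_Mapping.lookup p a" by (simp only: lookup_uminus)
  then show "Poly_Mapping.lookup p a = Poly_Mapping.lookup 0 a" by simp
qed

text \<open>Super-skew coefficients are paired with a supersymmetric expression, so exchanging the
  indices shows the sum to be its own negative.\<close>

lemma sum_skew_eq_0:
  fixes f :: "'a \<Rightarrow> 'a \<Rightarrow> ('i, 'j) spoly"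
  assumes "\<And>v r. M v r = - s v r * M r v" and "\<And>v r. f v r = spscale (s v r) (f r v)"
    and "\<And>v r. s v r * s v r = (1 :: complex)"
  shows "(\<Sum>v\<in>A. \<Sum>r\<in>A. spscale (M v r) (f v r)) = 0"
proof (rule spoly_eq_neg_self)
  have "spscale (M v r) (f v r) = - spscale (M r v) (f r v)" for v r
  proof -
    have "spscale (M v r) (f v r) = spscale (- s v r * M r v) (spscale (s v r) (f r v))"
      by (subst assms(1)[of v r], subst assms(2)[of v r]) (rule refl)
    also have "\<dots> = spscale (- (s v r * s v r) * M r v) (f r v)"
      by (simp add: mult_ac)
    finally show ?thesis using assms(3) by simp
  qed
  then have "(\<Sum>v\<in>A. \<Sum>r\<in>A. spscale (M v r) (f v r)) = (\<Sum>v\<in>A. \<Sum>r\<in>A. - spscale (M r v) (f r v))"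
    by (intro sum.cong refl)
  also have "\<dots> = - (\<Sum>v\<in>A. \<Sum>r\<in>A. spscale (M r v) (f r v))"
    by (simp add: sum_negf)
  also have "(\<Sum>v\<in>A. \<Sum>r\<in>A. spscale (M r v) (f r v)) = (\<Sum>v\<in>A. \<Sum>r\<in>A. spscale (M v r) (f v r))"
    by (rule sum.swap)
  finally show "(\<Sum>v\<in>A. \<Sum>r\<in>A. spscale (M v r) (f v r)) = - (\<Sum>v\<in>A. \<Sum>r\<in>A. spscale (M v r) (f v r))" .
qed

definition has_parity :: "bool \<Rightarrow> ('i, 'j) smat \<Rightarrow> bool" where
  "has_parity b X \<longleftrightarrow> (\<forall>u v. X u v \<noteq> 0 \<longrightarrow> (is_odd u \<noteq> is_odd v) = b)"

context superform begin

text \<open>The bilinear form (v, w) -> omega(X v, w). In terms of it, membership in osp is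
  super-skewness, a condition that does not mention the parity of \<open>X\<close>.\<close>

definition lower :: "('i, 'j) smat \<Rightarrow> ('i, 'j) smat" where
  "lower X v w = (\<Sum>u\<in>UNIV. X u v * \<omega> u w)"

definition skew :: "('i, 'j) smat \<Rightarrow> bool" where
  "skew X \<longleftrightarrow> (\<forall>v w. lower X v w = - ssign v w * lower X w v)"

lemma skewD: "skew X \<Longrightarrow> lower X v w = - ssign v w * lower X w v"
  unfolding skew_def by (elim allE)

lemma skewI: "(\<And>v w. lower X v w = - ssign v w * lower X w v) \<Longrightarrow> skew X"
  unfolding skew_def by (intro allI)

text \<open>Where \<open>X u w\<close> and \<open>\<omega> u v\<close> are both non-zero, |X| = |v|
  + |w|. So (-1)^(|X||v|) times the sign of exchanging the arguments of the form is the Koszul sign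
  (-1)^(|v||w|).\<close>

lemma osp_part_iff: "X \<in> osp_part \<omega> b \<longleftrightarrow> has_parity b X \<and> skew X"
proof -
  have "(if b \<and> is_odd v then -1 else 1) * (\<Sum>u\<in>UNIV. X u w * \<omega> v u) = ssign v w * lower X w v"
    if par: "has_parity b X" for v w
    unfolding lower_def sum_distrib_left
  proof (intro sum.cong refl)
    fix u
    show "(if b \<and> is_odd v then -1 else 1) * (X u w * \<omega> v u) = ssign v w * (X u w * \<omega> u v)"
    proof (cases "X u w = 0 \<or> \<omega> u v = 0")
      case True
      then show ?thesis using form_sym[of v u] by auto
    next
      case False
      then have "is_odd u = is_odd v" "(is_odd u \<noteq> is_odd w) = b"
        using par form_parity[of u v] by (auto simp: has_parity_def)
      then show ?thesis using form_sym[of v u] by (auto simp: ssign_def)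
    qed
  qed
  then have *: "has_parity b X \<Longrightarrow>
     (lower X v w + (if b \<and> is_odd v then -1 else 1) * (\<Sum>u\<in>UNIV. X u w * \<omega> v u) = 0) =
     (lower X v w = - ssign v w * lower X w v)" for v w
    by (simp only: mult_minus_left eq_neg_iff_add_eq_0)
  show ?thesis
    unfolding osp_part_def skew_def mem_Collect_eq has_parity_def[symmetric] lower_def[symmetric]
    by (cases "has_parity b X") (simp_all only: * simp_thms)
qed

lemma skew_combination:
  assumes "skew X" and "skew Y"
  shows "skew (\<lambda>u v. a * X u v + c * Y u v)"
proof -
  have *: "lower (\<lambda>u v. a * X u v + c * Y u v) v w = a * lower X v w + c * lower Y v w" for v w
    by (simp add: lower_def algebra_simps sum.distrib sum_distrib_left)
  have **: "a * lower X v w + c * lower Y v w =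
      - ssign v w * (a * lower X w v + c * lower Y w v)" for v w
    by (subst skewD[OF assms(1), of v w], subst skewD[OF assms(2), of v w]) (simp add: algebra_simps)
  have "lower (\<lambda>u v. a * X u v + c * Y u v) v w =
      - ssign v w * lower (\<lambda>u v. a * X u v + c * Y u v) w v" for v w
    unfolding * by (rule **)
  then show ?thesis by (rule skewI)
qed

text \<open>Super-skewness never relates an even entry to an odd one, so both parity components of a
  skew matrix are again skew.\<close>

lemma osp_iff: "X \<in> osp \<omega> \<longleftrightarrow> skew X"
proof
  assume "X \<in> osp \<omega>"
  then obtain A B where "X = (\<lambda>u v. A u v + B u v)" "skew A" "skew B"
    by (auto simp: osp_def osp_part_iff)
  then show "skew X" using skew_combination[of A B 1 1] by simp
next
  assume X: "skew X"
  define P where "P b u v = (if (is_odd u \<noteq> is_odd v) = b then X u v else 0)" for b u v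
  have "lower (P b) v w = (if (is_odd v \<noteq> is_odd w) = b then lower X v w else 0)" for b v w
  proof -
    have "P b u v * \<omega> u w = (if (is_odd v \<noteq> is_odd w) = b then X u v * \<omega> u w else 0)" for u
      using form_parity[of u w] by (auto simp: P_def)
    then show ?thesis by (simp add: lower_def)
  qed
  then have "lower (P b) v w = - ssign v w * lower (P b) w v" for b v w
    using skewD[OF X, of v w] by (cases "(is_odd v \<noteq> is_odd w) = b") auto
  then have "skew (P b)" for b
    by (rule skewI)
  then have "P b \<in> osp_part \<omega> b" for b
    by (auto simp: osp_part_iff has_parity_def P_def)
  moreover have "X = (\<lambda>u v. P False u v + P True u v)"
    by (auto simp: P_def fun_eq_iff)
  ultimately show "X \<in> osp \<omega>"
    unfolding osp_def mem_Collect_eq by (intro exI[of _ "P False"] exI[of _ "P True"] conjI)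
qed

text \<open>Skewness with the index raised by \<open>h\<close> instead of lowered by the form, as
  needed for second order derivatives.\<close>

lemma skew_raise:
  assumes "skew X"
  shows "(\<Sum>v\<in>UNIV. X u v * h p v) = - (ssign p u * ssign p p * ssign u u) * (\<Sum>v\<in>UNIV. X p v * h u v)"
proof -
  have X: "X u v = (\<Sum>w\<in>UNIV. lower X v w * h w u)" for u v
  proof -
    have "(\<Sum>w\<in>UNIV. lower X v w * h w u) = (\<Sum>w\<in>UNIV. \<Sum>r\<in>UNIV. X r v * (\<omega> r w * h w u))"
      by (simp add: lower_def sum_distrib_right mult.assoc)
    also have "\<dots> = (\<Sum>r\<in>UNIV. X r v * (\<Sum>w\<in>UNIV. \<omega> r w * h w u))"
      by (subst sum.swap) (simp add: sum_distrib_left)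
    also have "\<dots> = X u v"
      by (simp add: form_inverse if_distrib[of "\<lambda>c. _ * c"] cong: if_cong)
    finally show ?thesis by simp
  qed
  have "(\<Sum>v\<in>UNIV. X p v * h u v) = (\<Sum>v\<in>UNIV. \<Sum>w\<in>UNIV. lower X v w * h w p * h u v)"
    by (simp add: X[of p] sum_distrib_right)
  also have "\<dots> = (\<Sum>w\<in>UNIV. \<Sum>v\<in>UNIV. lower X v w * h w p * h u v)"
    by (rule sum.swap)
  also have "\<dots> = (\<Sum>w\<in>UNIV. \<Sum>v\<in>UNIV. - (ssign p u * ssign p p * ssign u u) * (lower X w v * h v u * h p w))"
  proof (intro sum.cong refl)
    fix w v
    show "lower X v w * h w p * h u v =
       - (ssign p u * ssign p p * ssign u u) * (lower X w v * h v u * h p w)"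
    proof (cases "is_odd w = is_odd p \<and> is_odd v = is_odd u")
      case True
      then have "ssign v w = ssign p u" "ssign w p = ssign p p" "ssign u v = ssign u u"
        by (auto simp: ssign_def)
      then show ?thesis
        using skewD[OF assms, of v w] inverse_sym[of w p] inverse_sym[of u v] by simp
    next
      case False
      then show ?thesis using inverse_parity[of w p] inverse_parity[of p w]
          inverse_parity[of u v] inverse_parity[of v u] by auto
    qed
  qed
  also have "\<dots> = - (ssign p u * ssign p p * ssign u u) * (\<Sum>v\<in>UNIV. X u v * h p v)"
    by (simp add: X[of u] sum_distrib_right sum_distrib_left mult.assoc)
  finally have *: "(\<Sum>v\<in>UNIV. X p v * h u v) =
     - (ssign p u * ssign p p * ssign u u) * (\<Sum>v\<in>UNIV. X u v * h p v)" .
  have "(- (ssign p u * ssign p p * ssign u u)) * (- (ssign p u * ssign p p * ssign u u)) = 1"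
    by (auto simp: ssign_def)
  then show ?thesis unfolding * mult.assoc[symmetric] by simp
qed

text \<open>X acts by derivations, so the commutator with R is twice a sum of M v r x_v x_r. Here
  \<open>M\<close> is super-skew, whereas products of coordinates are supersymmetric.\<close>

lemma gl_act_rsq:
  assumes "skew X"
  shows "gl_act X (rsq q) = rsq (gl_act X q)"
proof -
  define M where "M v r = (\<Sum>u\<in>UNIV. gsign u v * X u v * \<omega> r u)" for v r
  have M: "M v r = gsign r v * ssign r r * lower X v r" for v r
    unfolding M_def lower_def sum_distrib_left
  proof (intro sum.cong refl)
    fix u
    show "gsign u v * X u v * \<omega> r u = gsign r v * ssign r r * (X u v * \<omega> u r)"
      using form_parity[of r u] form_parity[of u r] form_sym[of r u]
      by (cases "is_odd u = is_odd r") (auto simp: gsign_def ssign_def)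
  qed
  have "(\<Sum>v\<in>UNIV. \<Sum>r\<in>UNIV. spscale (M v r) (xop v (xop r q))) = 0"
  proof (rule sum_skew_eq_0)
    show "M v r = - ssign v r * M r v" for v r
      unfolding M using skewD[OF assms, of v r] by (auto simp: gsign_def ssign_def)
  qed (rule xop_xop, simp)
  also have "(\<Sum>v\<in>UNIV. \<Sum>r\<in>UNIV. spscale (M v r) (xop v (xop r q))) =
     (\<Sum>v\<in>UNIV. \<Sum>u\<in>UNIV. \<Sum>r\<in>UNIV. spscale (gsign u v * X u v) (xop v (spscale (\<omega> r u) (xop r q))))"
    unfolding M_def sp.scale_sum_left
    by (rule sum.cong[OF refl], subst sum.swap) (simp add: spmult_simps)
  finally have *: "(\<Sum>u\<in>UNIV. \<Sum>v\<in>UNIV. spscale (gsign u v * X u v)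
      (xop v (\<Sum>r\<in>UNIV. spscale (\<omega> r u) (xop r q)))) = 0"
    by (subst sum.swap) (simp add: spmult_simps sp.scale_sum_right)
  have "gl_act X (rsq q) = - (\<Sum>u\<in>UNIV. \<Sum>v\<in>UNIV. spscale (gsign u v * X u v)
      (spscale 2 (xop v (\<Sum>r\<in>UNIV. spscale (\<omega> r u) (xop r q))))) + rsq (gl_act X q)"
    unfolding gl_act_eq spartial_rsq spmult_simps slinear_simps[OF slinear_rsq] sp.scale_right_distrib
      sum.distrib xop_rsq by simp
  also have "(\<Sum>u\<in>UNIV. \<Sum>v\<in>UNIV. spscale (gsign u v * X u v)
      (spscale 2 (xop v (\<Sum>r\<in>UNIV. spscale (\<omega> r u) (xop r q))))) = 0"
    unfolding spscale_sum_commute * by simp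
  finally show ?thesis by simp
qed

text \<open>The dual argument: the commutator is a sum of products of two derivatives with
  super-skew coefficients, the skewness coming from \<open>skew_raise\<close>.\<close>

lemma gl_act_lap:
  assumes "skew X"
  shows "gl_act X (lap q) = lap (gl_act X q)"
proof -
  define M where "M u p = (\<Sum>v\<in>UNIV. gsign u v * X u v * h p v)" for u p
  have M: "M u p = gsign u p * (\<Sum>v\<in>UNIV. X u v * h p v)" for u p
    unfolding M_def sum_distrib_left
  proof (intro sum.cong refl)
    fix v
    show "gsign u v * X u v * h p v = gsign u p * (X u v * h p v)"
      using inverse_parity[of p v] by (cases "is_odd v = is_odd p") (auto simp: gsign_def)
  qed
  have "(\<Sum>u\<in>UNIV. \<Sum>p\<in>UNIV. spscale (M u p) (spartial p (spartial u q))) = 0"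
  proof (rule sum_skew_eq_0)
    show "M u p = - ssign p u * M p u" for u p
      unfolding M using skew_raise[OF assms, of u p] by (auto simp: gsign_def ssign_def)
  qed (rule spartial_spartial, simp)
  also have "(\<Sum>u\<in>UNIV. \<Sum>p\<in>UNIV. spscale (M u p) (spartial p (spartial u q))) =
     (\<Sum>u\<in>UNIV. \<Sum>v\<in>UNIV. spscale (gsign u v * X u v) (grad v (spartial u q)))"
    unfolding M_def sp.scale_sum_left grad_def sp.scale_sum_right
    by (rule sum.cong[OF refl], subst sum.swap) simp
  finally have *: "(\<Sum>u\<in>UNIV. \<Sum>v\<in>UNIV. spscale (gsign u v * X u v) (grad v (spartial u q))) = 0" .
  have "lap (gl_act X q) = - (\<Sum>u\<in>UNIV. \<Sum>v\<in>UNIV. spscale (gsign u v * X u v)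
      (spscale 2 (grad v (spartial u q)))) + gl_act X (lap q)"
    unfolding gl_act_eq slinear_simps[OF slinear_lap] lap_xop sp.scale_right_distrib
      sum.distrib spartial_lap by simp
  also have "(\<Sum>u\<in>UNIV. \<Sum>v\<in>UNIV. spscale (gsign u v * X u v)
      (spscale 2 (grad v (spartial u q)))) = 0"
    unfolding spscale_sum_commute * by simp
  finally show ?thesis by simp
qed

end

section \<open>The invariant form and dual bases of osp\<close>

lemma inv_form_diff_right:
  "inv_form Y (\<lambda>u v. Z u v - (\<Sum>i<N. c i * X i u v)) =
    inv_form Y Z - (\<Sum>i<(N::nat). c i * inv_form Y (X i))"
proof -
  let ?s = "\<lambda>u. if is_odd u then -1 else (1::complex)"
  have "(\<Sum>u\<in>UNIV. ?s u * (\<Sum>w\<in>UNIV. Y u w * (Z w u - (\<Sum>i<N. c i * X i w u)))) =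
     (\<Sum>u\<in>UNIV. \<Sum>w\<in>UNIV. ?s u * (Y u w * Z w u)) -
     (\<Sum>u\<in>UNIV. \<Sum>w\<in>UNIV. \<Sum>i<N. c i * (?s u * (Y u w * X i w u)))"
    by (simp add: sum_distrib_left right_diff_distrib sum_subtractf mult_ac)
  also have "(\<Sum>u\<in>UNIV. \<Sum>w\<in>UNIV. \<Sum>i<N. c i * (?s u * (Y u w * X i w u))) =
      (\<Sum>i<N. c i * (\<Sum>u\<in>UNIV. ?s u * (\<Sum>w\<in>UNIV. Y u w * X i w u)))"
    unfolding sum_distrib_left by (subst sum.swap[of _ "{..<N}"], subst sum.swap[of _ "{..<N}"]) (rule refl)
  finally show ?thesis
    by (simp add: inv_form_def diff_divide_distrib sum_divide_distrib sum_distrib_left)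
qed

lemma inv_form_diff_left:
  "inv_form (\<lambda>u v. Z u v - (\<Sum>i<N. c i * X i u v)) Y =
    inv_form Z Y - (\<Sum>i<(N::nat). c i * inv_form (X i) Y)"
proof -
  let ?s = "\<lambda>u. if is_odd u then -1 else (1::complex)"
  have "(\<Sum>u\<in>UNIV. ?s u * (\<Sum>w\<in>UNIV. (Z u w - (\<Sum>i<N. c i * X i u w)) * Y w u)) =
     (\<Sum>u\<in>UNIV. \<Sum>w\<in>UNIV. ?s u * (Z u w * Y w u)) -
     (\<Sum>u\<in>UNIV. \<Sum>w\<in>UNIV. \<Sum>i<N. c i * (?s u * (X i u w * Y w u)))"
    by (simp add: sum_distrib_left sum_distrib_right left_diff_distrib right_diff_distrib sum_subtractf mult_ac)
  also have "(\<Sum>u\<in>UNIV. \<Sum>w\<in>UNIV. \<Sum>i<N. c i * (?s u * (X i u w * Y w u))) =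
      (\<Sum>i<N. c i * (\<Sum>u\<in>UNIV. ?s u * (\<Sum>w\<in>UNIV. X i u w * Y w u)))"
    unfolding sum_distrib_left by (subst sum.swap[of _ "{..<N}"], subst sum.swap[of _ "{..<N}"]) (rule refl)
  finally show ?thesis
    by (simp add: inv_form_def diff_divide_distrib sum_divide_distrib sum_distrib_left)
qed

lemma inv_form_divide_left: "inv_form (\<lambda>u v. Z u v / c) Y = inv_form Z Y / c"
  by (simp add: inv_form_def sum_divide_distrib[symmetric])

lemma inv_form_parity:
  assumes "has_parity b X" and "has_parity b' Y" and "b \<noteq> b'"
  shows "inv_form X Y = 0"
proof -
  have *: "X u w * Y w u = 0" for u w
    using assms unfolding has_parity_def by (metis mult_eq_0_iff)
  show ?thesis unfolding inv_form_def * by simp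
qed

text \<open>Supersymmetry of the form, from the cyclicity of the supertrace. On the odd part it is
  skew, so left and right dual bases differ.\<close>

lemma inv_form_commute:
  assumes "has_parity b X" and "has_parity b Y"
  shows "inv_form Y X = (if b then -1 else 1) * inv_form X Y"
proof -
  have "(\<Sum>u\<in>UNIV. (if is_odd u then -1 else 1) * (\<Sum>w\<in>UNIV. Y u w * X w u)) =
      (\<Sum>u\<in>UNIV. \<Sum>w\<in>UNIV. (if is_odd u then -1 else 1) * (Y u w * X w u))"
    by (simp only: sum_distrib_left)
  also have "\<dots> = (\<Sum>w\<in>UNIV. \<Sum>u\<in>UNIV. (if is_odd u then -1 else 1) * (Y u w * X w u))"
    by (rule sum.swap)
  also have "\<dots> = (\<Sum>w\<in>UNIV. \<Sum>u\<in>UNIV. (if b then -1 else 1) * ((if is_odd w then -1 else 1) * (X w u * Y u w)))"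
  proof (intro sum.cong refl)
    fix w u
    have "X w u \<noteq> 0 \<Longrightarrow> (is_odd w \<noteq> is_odd u) = b"
      using assms by (simp add: has_parity_def)
    then show "(if is_odd u then -1 else 1) * (Y u w * X w u) =
        (if b then -1 else 1) * ((if is_odd w then -1 else 1) * (X w u * Y u w))"
      by (cases "X w u = 0") (auto simp: mult.commute)
  qed
  also have "\<dots> = (if b then -1 else 1) * (\<Sum>w\<in>UNIV. (if is_odd w then -1 else 1) * (\<Sum>u\<in>UNIV. X w u * Y u w))"
    by (simp only: sum_distrib_left)
  finally show ?thesis by (simp add: inv_form_def)
qed

context superform begin

text \<open>An elementary matrix minus its adjoint with respect to \<open>\<omega>\<close>.\<close>

definition ospgen :: "'i + 'j \<Rightarrow> 'i + 'j \<Rightarrow> ('i, 'j) smat" where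
  "ospgen p q u v = (if u = p \<and> v = q then 1 else 0) - ssign p q * h q u * \<omega> p v"

lemma lower_ospgen:
  "lower (ospgen p q) v w = (if v = q then \<omega> p w else 0) - (if q = w then ssign p q * \<omega> p v else 0)"
proof -
  have "lower (ospgen p q) v w = (\<Sum>u\<in>UNIV. if u = p then (if v = q then \<omega> u w else 0) else 0) -
      (\<Sum>u\<in>UNIV. ssign p q * \<omega> p v * (h q u * \<omega> u w))"
    unfolding lower_def sum_subtractf[symmetric]
    by (intro sum.cong refl) (auto simp: ospgen_def algebra_simps)
  then show ?thesis by (simp add: inverse_form flip: sum_distrib_left)
qed

lemma skew_ospgen: "skew (ospgen p q)"
proof (rule skewI)
  fix v w
  show "lower (ospgen p q) v w = - ssign v w * lower (ospgen p q) w v"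
    unfolding lower_ospgen using form_parity[of p w] form_parity[of p v]
    by (cases "is_odd p"; cases "is_odd q"; cases "is_odd v"; cases "is_odd w") (auto simp: ssign_def)
qed

lemma ospgen_osp_part: "ospgen p q \<in> osp_part \<omega> (is_odd p \<noteq> is_odd q)"
proof -
  have "has_parity (is_odd p \<noteq> is_odd q) (ospgen p q)"
    using inverse_parity[of q] form_parity[of p] unfolding has_parity_def ospgen_def
    by (auto split: if_splits)
  then show ?thesis by (simp add: osp_part_iff skew_ospgen)
qed

text \<open>Since \<open>Y\<close> is skew, the adjoint part of \<open>ospgen\<close> contributes as
  much as the elementary matrix, which cancels the factor 1/2. In particular the form is
  nondegenerate on osp.\<close>

lemma inv_form_ospgen:
  assumes "skew Y"
  shows "inv_form Y (ospgen p q) = ssign q q * Y q p"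
proof -
  have "(\<Sum>u\<in>UNIV. ssign u u * (\<Sum>w\<in>UNIV. Y u w * ospgen p q w u)) =
     (\<Sum>u\<in>UNIV. \<Sum>w\<in>UNIV. ssign u u * (Y u w * (if w = p \<and> u = q then 1 else 0))) -
     (\<Sum>u\<in>UNIV. \<Sum>w\<in>UNIV. ssign p q * (h q w * (Y u w * (ssign u u * \<omega> p u))))"
    by (simp add: ospgen_def right_diff_distrib sum_subtractf sum_distrib_left mult_ac)
  also have "(\<Sum>u\<in>UNIV. \<Sum>w\<in>UNIV. ssign u u * (Y u w * (if w = p \<and> u = q then 1 else 0))) =
      (\<Sum>u\<in>UNIV. \<Sum>w\<in>UNIV. if w = p then if u = q then ssign u u * Y u w else 0 else 0)"
    by (intro sum.cong refl) auto
  also have "\<dots> = ssign q q * Y q p" by simp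
  also have "(\<Sum>u\<in>UNIV. \<Sum>w\<in>UNIV. ssign p q * (h q w * (Y u w * (ssign u u * \<omega> p u)))) =
      (\<Sum>w\<in>UNIV. \<Sum>u\<in>UNIV. ssign p q * (h q w * (Y u w * (ssign u u * \<omega> p u))))"
    by (rule sum.swap)
  also have "\<dots> = (\<Sum>w\<in>UNIV. ssign p q * (h q w * lower Y w p))"
  proof -
    have "ssign u u * \<omega> p u = \<omega> u p" for u
      using form_sym[of u p] form_parity[of u p] form_parity[of p u]
      by (cases "is_odd u = is_odd p") (auto simp: ssign_def)
    then show ?thesis by (simp add: lower_def sum_distrib_left)
  qed
  also have "\<dots> = (\<Sum>w\<in>UNIV. - (h q w * lower Y p w))"
  proof (intro sum.cong refl)
    fix w
    show "ssign p q * (h q w * lower Y w p) = - (h q w * lower Y p w)"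
      using skewD[OF assms, of w p] inverse_parity[of q w]
      by (cases "is_odd q = is_odd w") (auto simp: ssign_def)
  qed
  also have "\<dots> = - (\<Sum>w\<in>UNIV. \<Sum>u\<in>UNIV. Y u p * (\<omega> u w * h q w))"
    by (simp add: lower_def sum_distrib_left mult_ac sum_negf)
  also have "(\<Sum>w\<in>UNIV. \<Sum>u\<in>UNIV. Y u p * (\<omega> u w * h q w)) = (\<Sum>u\<in>UNIV. Y u p * (\<Sum>w\<in>UNIV. \<omega> u w * h q w))"
    by (subst sum.swap) (simp only: sum_distrib_left)
  also have "\<dots> = Y q p * ssign q q"
    by (simp add: form_inverse' if_distrib[of "\<lambda>c. _ * c"] cong: if_cong)
  finally show ?thesis by (simp add: inv_form_def ssign_def)
qed

text \<open>A skew matrix is minus its own adjoint, so antisymmetrizing its expansion in elementary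
  matrices doubles it. Hence the \<open>ospgen p q\<close> span osp.\<close>

lemma skew_expansion:
  assumes "skew Z"
  shows "Z u v = (\<Sum>p\<in>UNIV. \<Sum>q\<in>UNIV. Z p q * ospgen p q u v) / 2"
proof -
  have "(\<Sum>p\<in>UNIV. \<Sum>q\<in>UNIV. Z p q * ospgen p q u v) =
     (\<Sum>p\<in>UNIV. \<Sum>q\<in>UNIV. Z p q * (if u = p \<and> v = q then 1 else 0)) -
     (\<Sum>p\<in>UNIV. \<Sum>q\<in>UNIV. Z p q * (ssign p q * h q u * \<omega> p v))"
    by (simp add: ospgen_def right_diff_distrib sum_subtractf)
  also have "(\<Sum>p\<in>UNIV. \<Sum>q\<in>UNIV. Z p q * (if u = p \<and> v = q then 1 else 0)) =
     (\<Sum>p\<in>UNIV. \<Sum>q\<in>UNIV. if v = q then if u = p then Z p q else 0 else 0)"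
    by (intro sum.cong refl) auto
  also have "\<dots> = Z u v" by simp
  also have "(\<Sum>p\<in>UNIV. \<Sum>q\<in>UNIV. Z p q * (ssign p q * h q u * \<omega> p v)) =
     (\<Sum>q\<in>UNIV. \<Sum>p\<in>UNIV. ssign v q * h q u * (Z p q * \<omega> p v))"
  proof (subst sum.swap, intro sum.cong refl)
    fix p q
    show "Z p q * (ssign p q * h q u * \<omega> p v) = ssign v q * h q u * (Z p q * \<omega> p v)"
      using form_parity[of p v] by (cases "is_odd p = is_odd v") (auto simp: ssign_def)
  qed
  also have "\<dots> = (\<Sum>q\<in>UNIV. ssign v q * h q u * lower Z q v)"
    by (simp add: lower_def sum_distrib_left)
  also have "\<dots> = (\<Sum>q\<in>UNIV. - (h q u * lower Z v q))"
  proof (intro sum.cong refl)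
    fix q
    show "ssign v q * h q u * lower Z q v = - (h q u * lower Z v q)"
      by (subst skewD[OF assms, of q v]) (auto simp: ssign_def)
  qed
  also have "\<dots> = - (\<Sum>q\<in>UNIV. \<Sum>r\<in>UNIV. Z r v * (\<omega> r q * h q u))"
    by (simp add: lower_def sum_distrib_left mult_ac sum_negf)
  also have "(\<Sum>q\<in>UNIV. \<Sum>r\<in>UNIV. Z r v * (\<omega> r q * h q u)) = (\<Sum>r\<in>UNIV. Z r v * (\<Sum>q\<in>UNIV. \<omega> r q * h q u))"
    by (subst sum.swap) (simp only: sum_distrib_left)
  also have "\<dots> = Z u v"
    by (simp add: form_inverse if_distrib[of "\<lambda>c. _ * c"] cong: if_cong)
  finally show ?thesis by simp
qed

text \<open>Only summands with non-zero coefficients are required to have parity \<open>b\<close>: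
  in the application the coefficients of the other parity vanish by
  \<open>inv_form_parity\<close>.\<close>

lemma osp_part_combination:
  assumes "Z \<in> osp_part \<omega> b" and "\<And>i. i < N \<Longrightarrow> c i \<noteq> 0 \<Longrightarrow> X i \<in> osp_part \<omega> b"
  shows "(\<lambda>u v. Z u v - (\<Sum>i<(N::nat). c i * X i u v)) \<in> osp_part \<omega> b"
  using assms(2)
proof (induction N)
  case 0
  then show ?case using assms(1) by simp
next
  case (Suc N)
  define R where "R = (\<lambda>u v. Z u v - (\<Sum>i<N. c i * X i u v))"
  have R: "R \<in> osp_part \<omega> b" unfolding R_def using Suc by simp
  have eq: "(\<lambda>u v. Z u v - (\<Sum>i<Suc N. c i * X i u v)) = (\<lambda>u v. 1 * R u v + (- c N) * X N u v)"
    by (simp add: R_def algebra_simps)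
  show ?case
  proof (cases "c N = 0")
    case True
    then show ?thesis unfolding eq using R by simp
  next
    case False
    then have "X N \<in> osp_part \<omega> b" using Suc.prems by simp
    then have "has_parity b (\<lambda>u v. 1 * R u v + (- c N) * X N u v)"
      "skew (\<lambda>u v. 1 * R u v + (- c N) * X N u v)"
      using R skew_combination[of R "X N" 1 "- c N"] unfolding osp_part_iff has_parity_def
      by (simp_all only: mult_1 add_0 mult_zero_right) (metis add_0 mult_zero_right)
    then show ?thesis unfolding eq osp_part_iff by blast
  qed
qed


definition biorthogonal ::
    "nat \<Rightarrow> (nat \<Rightarrow> ('i, 'j) smat) \<Rightarrow> (nat \<Rightarrow> ('i, 'j) smat) \<Rightarrow> bool" where
  "biorthogonal N X Y \<longleftrightarrow>
     (\<forall>i<N. \<exists>b. X i \<in> osp_part \<omega> b \<and> Y i \<in> osp_part \<omega> b) \<and>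
     (\<forall>i<N. \<forall>j<N. inv_form (Y i) (X j) = (if i = j then 1 else 0))"

text \<open>Membership in the span of the \<open>X i\<close>, phrased with the coefficients that the
  dual vectors dictate.\<close>

definition expands :: "nat \<Rightarrow> (nat \<Rightarrow> ('i, 'j) smat) \<Rightarrow> (nat \<Rightarrow> ('i, 'j) smat) \<Rightarrow> ('i, 'j) smat \<Rightarrow> bool" where
  "expands N X Y Z \<longleftrightarrow> Z = (\<lambda>u v. \<Sum>i<N. inv_form (Y i) Z * X i u v)"

lemma expandsD:
  assumes "expands N X Y Z"
  shows "Z u v = (\<Sum>i<N. inv_form (Y i) Z * X i u v)"
  using arg_cong[OF assms[unfolded expands_def], of "\<lambda>z. z u v"] .

text \<open>A Gram-Schmidt step for a form with isotropic vectors: \<open>R\<close> cannot be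
  normalized against itself, so its dual vector is manufactured from an \<open>ospgen p q\<close>
  that detects a non-zero entry of \<open>R\<close>.\<close>

lemma biorthogonal_extend:
  assumes XY: "biorthogonal N X Y" and Z: "Z \<in> osp_part \<omega> b" and nexp: "\<not> expands N X Y Z"
  obtains R y where "biorthogonal (Suc N) (X(N := R)) (Y(N := y))"
    and "expands (Suc N) (X(N := R)) (Y(N := y)) Z"
    and "\<And>W. expands N X Y W \<Longrightarrow> expands (Suc N) (X(N := R)) (Y(N := y)) W"
proof -
  have parity: "\<exists>b. X i \<in> osp_part \<omega> b \<and> Y i \<in> osp_part \<omega> b" if "i < N" for i
    using XY that by (auto simp: biorthogonal_def)
  have same: "X i \<in> osp_part \<omega> b \<and> Y i \<in> osp_part \<omega> b"
    if i: "i < N" and W: "W \<in> osp_part \<omega> b" "inv_form (Y i) W \<noteq> 0 \<or> inv_form W (X i) \<noteq> 0" for i W b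
  proof -
    obtain b' where b': "X i \<in> osp_part \<omega> b'" "Y i \<in> osp_part \<omega> b'"
      using parity[OF i] by blast
    then have "b' = b"
      using W inv_form_parity[of b' "Y i" b W] inv_form_parity[of b W b' "X i"]
      unfolding osp_part_iff by blast
    with b' show ?thesis by simp
  qed
  define R where "R = (\<lambda>u v. Z u v - (\<Sum>i<N. inv_form (Y i) Z * X i u v))"
  have R: "R \<in> osp_part \<omega> b"
    unfolding R_def by (rule osp_part_combination[OF Z]) (use same[OF _ Z] in blast)
  have YR: "inv_form (Y i) R = 0" if "i < N" for i
  proof -
    have "(\<Sum>j<N. inv_form (Y j) Z * inv_form (Y i) (X j)) = (\<Sum>j<N. if i = j then inv_form (Y j) Z else 0)"
      using XY that by (intro sum.cong refl) (auto simp: biorthogonal_def)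
    then show ?thesis unfolding R_def inv_form_diff_right using that by simp
  qed
  have "\<exists>q p. R q p \<noteq> 0"
  proof (rule ccontr)
    assume "\<not> ?thesis"
    then have "R u v = 0" for u v by blast
    then have "Z u v = (\<Sum>i<N. inv_form (Y i) Z * X i u v)" for u v
      unfolding R_def by (simp only: right_minus_eq)
    then have "expands N X Y Z" unfolding expands_def by (intro ext)
    with nexp show False by contradiction
  qed
  then obtain q p where qp: "R q p \<noteq> 0" by blast
  define W where "W = ospgen p q"
  have "(is_odd p \<noteq> is_odd q) = b"
    using R qp unfolding osp_part_iff has_parity_def by metis
  then have W: "W \<in> osp_part \<omega> b"
    unfolding W_def using ospgen_osp_part[of p q] by (simp only:)
  have "inv_form R W \<noteq> 0"
    using qp R inv_form_ospgen[of R p q] by (auto simp: W_def osp_part_iff ssign_def)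
  \<comment> \<open>A left dual basis needs \<open>R\<close> in the second argument; the exchange
    costs only a sign.\<close>
  then have WR: "inv_form W R \<noteq> 0"
    using inv_form_commute[of b R W] R W by (auto simp: osp_part_iff)
  define V where "V = (\<lambda>u v. W u v - (\<Sum>i<N. inv_form W (X i) * Y i u v))"
  define y where "y = (\<lambda>u v. V u v / inv_form W R)"
  have V: "V \<in> osp_part \<omega> b"
    unfolding V_def by (rule osp_part_combination[OF W]) (use same[OF _ W] in blast)
  have y: "y \<in> osp_part \<omega> b"
  proof -
    have "has_parity b y" using V by (auto simp: y_def osp_part_iff has_parity_def)
    moreover have "y = (\<lambda>u v. (1 / inv_form W R) * V u v + 0 * V u v)" by (simp add: y_def)
    ultimately show ?thesis
      using skew_combination[of V V "1 / inv_form W R" 0] V by (simp only: osp_part_iff)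
  qed
  have yR: "inv_form y R = 1"
    unfolding y_def inv_form_divide_left unfolding V_def inv_form_diff_left using WR YR by simp
  have yX: "inv_form y (X i) = 0" if "i < N" for i
  proof -
    have "(\<Sum>j<N. inv_form W (X j) * inv_form (Y j) (X i)) = (\<Sum>j<N. if i = j then inv_form W (X j) else 0)"
      using XY that by (intro sum.cong refl) (auto simp: biorthogonal_def)
    then show ?thesis
      unfolding y_def inv_form_divide_left unfolding V_def inv_form_diff_left using that by simp
  qed
  have ext: "(\<Sum>i<Suc N. inv_form ((Y(N := y)) i) U * (X(N := R)) i u v) =
      (\<Sum>i<N. inv_form (Y i) U * X i u v) + inv_form y U * R u v" for U u v
    by simp
  \<comment> \<open>\<open>y\<close> is orthogonal to the old \<open>X i\<close>, so it sees only
    the part of \<open>U\<close> not yet expanded. Old expansions get the new coefficient 0, and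
    \<open>Z\<close> gets 1.\<close>
  have yW: "inv_form y U = inv_form y (\<lambda>u v. U u v - (\<Sum>i<N. inv_form (Y i) U * X i u v))" for U
    unfolding inv_form_diff_right using yX by simp
  show thesis
  proof
    show "biorthogonal (Suc N) (X(N := R)) (Y(N := y))"
      using XY R y yR yX YR unfolding biorthogonal_def by (auto simp: less_Suc_eq)
    have "inv_form y Z = 1" using yW[of Z] yR by (simp add: R_def)
    then show "expands (Suc N) (X(N := R)) (Y(N := y)) Z"
      unfolding expands_def ext by (simp add: R_def)
    fix U assume U: "expands N X Y U"
    then have 1: "U u v - (\<Sum>i<N. inv_form (Y i) U * X i u v) = 0" for u v
      by (simp flip: expandsD)
    have 0: "inv_form y U = 0"
      unfolding yW[of U] 1 by (simp add: inv_form_def)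
    show "expands (Suc N) (X(N := R)) (Y(N := y)) U"
      unfolding expands_def ext 0 mult_zero_left add_0_right
      by (rule U[unfolded expands_def])
  qed
qed

text \<open>The extension step is run through the finitely many generators
  \<open>ospgen p q\<close>; \<open>skew_expansion\<close> passes from them to all of osp.\<close>

lemma dual_bases_exist: "\<exists>N X Y. dual_bases \<omega> N X Y"
proof -
  have "\<exists>N X Y. biorthogonal N X Y \<and> (\<forall>(p, q)\<in>S. expands N X Y (ospgen p q))"
    if "finite S" for S :: "(('i + 'j) \<times> ('i + 'j)) set"
    using that
  proof (induction S)
    case empty
    have "biorthogonal 0 (\<lambda>_. undefined) (\<lambda>_. undefined)" by (simp add: biorthogonal_def)
    then show ?case by blast
  next
    case (insert x S)
    obtain p q where x: "x = (p, q)" by (cases x)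
    obtain N X Y where XY: "biorthogonal N X Y" "\<forall>(p, q)\<in>S. expands N X Y (ospgen p q)"
      using insert by blast
    show ?case
    proof (cases "expands N X Y (ospgen p q)")
      case True
      then show ?thesis
        by - (rule exI[of _ N], rule exI[of _ X], rule exI[of _ Y], use XY x in simp)
    next
      case False
      then obtain R y where "biorthogonal (Suc N) (X(N := R)) (Y(N := y))"
        "expands (Suc N) (X(N := R)) (Y(N := y)) (ospgen p q)"
        "\<And>W. expands N X Y W \<Longrightarrow> expands (Suc N) (X(N := R)) (Y(N := y)) W"
        using biorthogonal_extend[OF XY(1) ospgen_osp_part] by blast
      then show ?thesis
        by - (rule exI[of _ "Suc N"], rule exI[of _ "X(N := R)"], rule exI[of _ "Y(N := y)"], use XY(2) x in \<open>auto simp del: fun_upd_apply\<close>)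
    qed
  qed
  from this[of UNIV] obtain N X Y where XY: "biorthogonal N X Y" "\<And>p q. expands N X Y (ospgen p q)"
    by auto
  have "\<exists>c. Z = (\<lambda>u v. \<Sum>i<N. c i * X i u v)" if "Z \<in> osp \<omega>" for Z
  proof (intro exI ext)
    fix u v
    have gen: "ospgen p q u v = (\<Sum>i<N. inv_form (Y i) (ospgen p q) * X i u v)" for p q
      by (rule expandsD[OF XY(2)])
    have "Z u v = (\<Sum>p\<in>UNIV. \<Sum>q\<in>UNIV. Z p q * ospgen p q u v) / 2"
      using that by (intro skew_expansion) (simp add: osp_iff)
    also have "(\<Sum>p\<in>UNIV. \<Sum>q\<in>UNIV. Z p q * ospgen p q u v) =
        (\<Sum>p\<in>UNIV. \<Sum>q\<in>UNIV. \<Sum>i<N. Z p q * inv_form (Y i) (ospgen p q) * X i u v)"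
      by (subst gen) (simp add: sum_distrib_left mult.assoc)
    also have "\<dots> = (\<Sum>i<N. (\<Sum>p\<in>UNIV. \<Sum>q\<in>UNIV. Z p q * inv_form (Y i) (ospgen p q)) * X i u v)"
      unfolding sum_distrib_right
      by (subst sum.swap[of _ "{..<N}"], subst sum.swap[of _ "{..<N}"]) (rule refl)
    finally show "Z u v = (\<Sum>i<N. ((\<Sum>p\<in>UNIV. \<Sum>q\<in>UNIV. Z p q * inv_form (Y i) (ospgen p q)) / 2) * X i u v)"
      by (simp only: sum_divide_distrib[of _ "{..<N}"] times_divide_eq_left)
  qed
  then have "dual_bases \<omega> N X Y"
    using XY(1) unfolding dual_bases_def biorthogonal_def by blast
  then show ?thesis by blast
qed

text \<open>The form pairs \<open>Y\<close> with \<open>ospgen p q\<close> to an entry of \<open>Y\<close>, so expanding \<open>ospgen p q\<close> in a basis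
  computes the entries of the Casimir tensor, whatever the dual bases are.\<close>

lemma dual_bases_tensor:
  assumes "dual_bases \<omega> N X Y"
  shows "(\<Sum>i<N. X i u v * Y i q p) = ssign q q * ospgen p q u v"
proof -
  have "ospgen p q \<in> osp \<omega>" by (simp add: osp_iff skew_ospgen)
  then obtain c where c: "ospgen p q = (\<lambda>u v. \<Sum>i<N. c i * X i u v)"
    using assms unfolding dual_bases_def by blast
  have Y: "c j = ssign q q * Y j q p" if "j < N" for j
  proof -
    have zero: "inv_form (Y j) (\<lambda>u v. 0) = 0" by (simp add: inv_form_def)
    have "inv_form (Y j) (\<lambda>u v. ospgen p q u v - (\<Sum>i<N. c i * X i u v)) = 0"
      unfolding c by (simp add: zero)
    then have "inv_form (Y j) (ospgen p q) = (\<Sum>i<N. c i * inv_form (Y j) (X i))"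
      unfolding inv_form_diff_right by simp
    also have "\<dots> = (\<Sum>i<N. if j = i then c i else 0)"
      using assms that by (intro sum.cong refl) (auto simp: dual_bases_def)
    also have "\<dots> = c j" using that by simp
    finally have "c j = inv_form (Y j) (ospgen p q)" by simp
    also have "\<dots> = ssign q q * Y j q p"
    proof (rule inv_form_ospgen)
      show "skew (Y j)" using assms that unfolding dual_bases_def osp_part_iff by blast
    qed
    finally show ?thesis .
  qed
  have "ssign q q * ospgen p q u v = (\<Sum>i<N. ssign q q * (ssign q q * (X i u v * Y i q p)))"
    unfolding c by (simp add: Y sum_distrib_left mult_ac)
  also have "\<dots> = (\<Sum>i<N. X i u v * Y i q p)"
    by (simp flip: mult.assoc)
  finally show ?thesis by simp
qed

end

section \<open>The Casimir operator\<close>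

lemma sum_swap_34: "(\<Sum>u\<in>A. \<Sum>v\<in>B. \<Sum>b\<in>C. \<Sum>a\<in>D. f u v b a) = (\<Sum>v\<in>B. \<Sum>a\<in>D. \<Sum>u\<in>A. \<Sum>b\<in>C. f u v b a)"
  by (subst sum.swap, rule sum.cong[OF refl], subst (2) sum.swap, subst sum.swap, rule refl)

context superform begin

text \<open>The operator E(E - 2k - 2) - R Delta as it leaves the computation: the sum of the x_v E
  d_v is E(E - 1), and it is evaluated only on homogeneous elements.\<close>

definition casimir_op :: "('i, 'j) sop" where
  "casimir_op q = spscale (- 2 * of_nat k) (euler q) + (\<Sum>v\<in>UNIV. xop v (euler (spartial v q)))
     - euler q - rsq (lap q)"

text \<open>The entries of the Casimir tensor with all signs collected. The first summand comes from
  the elementary matrix in \<open>ospgen\<close>, the second from its adjoint;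
  \<open>casimir_first\<close> and \<open>casimir_second\<close> sum them up.\<close>

lemma casimir_coeff:
  "gsign u v * gsign b a * (ssign b b * ospgen a b u v) =
    (if u = a then if v = b then ssign a a else 0 else 0) - ssign a b * h u b * \<omega> a v"
proof (cases "is_odd u = is_odd b \<and> is_odd a = is_odd v")
  case True
  then show ?thesis using inverse_sym[of u b]
    by (auto simp: ospgen_def gsign_def ssign_def)
next
  case False
  then have "h b u * \<omega> a v = 0" "h u b * \<omega> a v = 0"
    using inverse_parity[of u b] inverse_parity[of b u] form_parity[of a v] by auto
  then show ?thesis
    by (auto simp: ospgen_def gsign_def ssign_def)
qed

lemma casimir_first:
  "(\<Sum>u\<in>UNIV. \<Sum>v\<in>UNIV. spscale (ssign u u) (xop v (spartial u (xop u (spartial v q))))) =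
   spscale (- 2 * of_nat k) (euler q) + (\<Sum>v\<in>UNIV. xop v (euler (spartial v q)))"
proof -
  have "(\<Sum>u\<in>UNIV. \<Sum>v\<in>UNIV. spscale (ssign u u) (xop v (spartial u (xop u (spartial v q))))) =
    (\<Sum>u\<in>UNIV. spscale (ssign u (u :: 'i + 'j)) (\<Sum>v\<in>UNIV. xop v (spartial v q))) +
    (\<Sum>u\<in>UNIV. \<Sum>v\<in>UNIV. xop v (xop u (spartial u (spartial v q))))"
    by (simp add: spartial_xop spmult_simps sp.scale_right_distrib sum.distrib sp.scale_sum_right)
  also have "(\<Sum>u\<in>UNIV. spscale (ssign u (u :: 'i + 'j)) (\<Sum>v\<in>UNIV. xop v (spartial v q))) =
      spscale (- 2 * of_nat k) (euler q)"
    by (simp add: euler_def superdim flip: sp.scale_sum_left)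
  also have "(\<Sum>u\<in>UNIV. \<Sum>v\<in>UNIV. xop v (xop u (spartial u (spartial v q)))) =
     (\<Sum>v\<in>UNIV. xop v (euler (spartial v q)))"
    by (subst sum.swap) (simp add: euler_def spmult_simps)
  finally show ?thesis .
qed

text \<open>Moving the derivative past x_a leaves a contraction of \<open>h\<close> with the form,
  which is E, and the normally ordered remainder R Delta.\<close>

lemma casimir_second:
  "(\<Sum>u\<in>UNIV. \<Sum>v\<in>UNIV. \<Sum>b\<in>UNIV. \<Sum>a\<in>UNIV. spscale (ssign a b * h u b * \<omega> a v)
     (xop v (spartial u (xop a (spartial b q))))) = euler q + rsq (lap q)"
proof -
  have *: "spscale (ssign a b * h u b * \<omega> a v) (xop v (spartial u (xop a (spartial b q)))) =
     (if u = a then spscale (h b u * \<omega> u v) (xop v (spartial b q)) else 0) +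
     spscale (\<omega> a v * h u b) (xop v (xop a (spartial u (spartial b q))))" for u v b a
  proof -
    have 1: "spscale (ssign a b * h u b * \<omega> a v * ssign u a) y = spscale (\<omega> a v * h u b) y" for y
      using inverse_parity[of u b] by (cases "is_odd u = is_odd b") (auto simp: ssign_def)
    have 2: "ssign x b * h x b = h b x" for x
      using inverse_sym[of b x] ssign_commute[of b x] by simp
    show ?thesis
      by (auto simp: spartial_xop spmult_simps sp.scale_right_distrib 1 2)
  qed
  have "(\<Sum>u\<in>UNIV. \<Sum>v\<in>UNIV. \<Sum>b\<in>UNIV. \<Sum>a\<in>UNIV. spscale (ssign a b * h u b * \<omega> a v)
     (xop v (spartial u (xop a (spartial b q))))) =
     (\<Sum>u\<in>UNIV. \<Sum>v\<in>UNIV. \<Sum>b\<in>UNIV. spscale (h b u * \<omega> u v) (xop v (spartial b q))) +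
     (\<Sum>u\<in>UNIV. \<Sum>v\<in>UNIV. \<Sum>b\<in>UNIV. \<Sum>a\<in>UNIV.
        spscale (\<omega> a v * h u b) (xop v (xop a (spartial u (spartial b q)))))"
    by (simp add: * sum.distrib)
  also have "(\<Sum>u\<in>UNIV. \<Sum>v\<in>UNIV. \<Sum>b\<in>UNIV. \<Sum>a\<in>UNIV.
        spscale (\<omega> a v * h u b) (xop v (xop a (spartial u (spartial b q))))) =
     (\<Sum>v\<in>UNIV. \<Sum>a\<in>UNIV. \<Sum>u\<in>UNIV. \<Sum>b\<in>UNIV.
        spscale (\<omega> a v * h u b) (xop v (xop a (spartial u (spartial b q)))))"
    by (rule sum_swap_34)
  also have "\<dots> = rsq (lap q)"
    by (simp add: rsq_def lap_def spmult_simps sp.scale_sum_right)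
  also have "(\<Sum>u\<in>UNIV. \<Sum>v\<in>UNIV. \<Sum>b\<in>UNIV. spscale (h b u * \<omega> u v) (xop v (spartial b q))) =
     (\<Sum>v\<in>UNIV. \<Sum>b\<in>UNIV. \<Sum>u\<in>UNIV. spscale (h b u * \<omega> u v) (xop v (spartial b q)))"
    by (subst sum.swap, rule sum.cong[OF refl], rule sum.swap)
  also have "\<dots> = (\<Sum>v\<in>UNIV. \<Sum>b\<in>UNIV. if b = v then xop v (spartial b q) else 0)"
  proof (intro sum.cong refl)
    fix v b
    have "(\<Sum>u\<in>UNIV. spscale (h b u * \<omega> u v) (xop v (spartial b q))) =
        spscale (\<Sum>u\<in>UNIV. h b u * \<omega> u v) (xop v (spartial b q))"
      by (rule sp.scale_sum_left[symmetric])
    also have "\<dots> = (if b = v then xop v (spartial b q) else 0)"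
      unfolding inverse_form by simp
    finally show "(\<Sum>u\<in>UNIV. spscale (h b u * \<omega> u v) (xop v (spartial b q))) =
       (if b = v then xop v (spartial b q) else 0)" .
  qed
  also have "\<dots> = euler q" by (simp add: euler_def)
  finally show ?thesis .
qed

lemma gl_act_gl_act:
  "gl_act X (gl_act Y q) = (\<Sum>u\<in>UNIV. \<Sum>v\<in>UNIV. \<Sum>b\<in>UNIV. \<Sum>a\<in>UNIV.
     spscale (gsign u v * gsign b a * (X u v * Y b a)) (xop v (spartial u (xop a (spartial b q)))))"
  unfolding gl_act_eq
  by (simp add: spmult_simps spartial_simps sp.scale_sum_right sum_negf mult_ac)

text \<open>The sum depends on the bases only through the tensor of
  \<open>dual_bases_tensor\<close>, whose entries do not involve them. This makes the description of
  \<open>casimir\<close> unique.\<close>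

lemma casimir_sum:
  assumes "dual_bases \<omega> N X Y"
  shows "(\<Sum>i<N. gl_act (X i) (gl_act (Y i) q)) = casimir_op q"
proof -
  have "(\<Sum>i<N. gl_act (X i) (gl_act (Y i) q)) = (\<Sum>u\<in>UNIV. \<Sum>v\<in>UNIV. \<Sum>b\<in>UNIV. \<Sum>a\<in>UNIV. \<Sum>i<N.
     spscale (gsign u v * gsign b a * (X i u v * Y i b a)) (xop v (spartial u (xop a (spartial b q)))))"
    unfolding gl_act_gl_act
    apply (subst sum.swap, rule sum.cong[OF refl])+
    apply (rule refl)
    done
  also have "\<dots> = (\<Sum>u\<in>UNIV. \<Sum>v\<in>UNIV. \<Sum>b\<in>UNIV. \<Sum>a\<in>UNIV.
     (if u = a then if v = b then spscale (ssign u u) (xop v (spartial u (xop u (spartial v q)))) else 0 else 0) -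
     spscale (ssign a b * h u b * \<omega> a v) (xop v (spartial u (xop a (spartial b q)))))"
  proof (intro sum.cong refl)
    fix u v b a
    have "(\<Sum>i<N. spscale (gsign u v * gsign b a * (X i u v * Y i b a)) (xop v (spartial u (xop a (spartial b q))))) =
      spscale (gsign u v * gsign b a * (\<Sum>i<N. X i u v * Y i b a)) (xop v (spartial u (xop a (spartial b q))))"
      by (simp only: sum_distrib_left sp.scale_sum_left)
    also have "\<dots> = spscale ((if u = a then if v = b then ssign a a else 0 else 0) - ssign a b * h u b * \<omega> a v)
       (xop v (spartial u (xop a (spartial b q))))"
      unfolding dual_bases_tensor[OF assms] casimir_coeff ..
    finally show "(\<Sum>i<N. spscale (gsign u v * gsign b a * (X i u v * Y i b a)) (xop v (spartial u (xop a (spartial b q))))) =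
      (if u = a then if v = b then spscale (ssign u u) (xop v (spartial u (xop u (spartial v q)))) else 0 else 0) -
     spscale (ssign a b * h u b * \<omega> a v) (xop v (spartial u (xop a (spartial b q))))"
      by (auto simp: sp.scale_left_diff_distrib)
  qed
  also have "\<dots> = casimir_op q"
    unfolding sum_subtractf casimir_second casimir_op_def casimir_first[symmetric]
    by (simp add: sum_if_const)
  finally show ?thesis .
qed

lemma casimir_eq_op: "casimir \<omega> = casimir_op"
proof -
  obtain N X Y where XY: "dual_bases \<omega> N X Y" using dual_bases_exist by blast
  show ?thesis
    unfolding casimir_def
  proof (rule the_equality)
    show "\<exists>N X Y. dual_bases \<omega> N X Y \<and> casimir_op = (\<lambda>q. \<Sum>i<N. gl_act (X i) (gl_act (Y i) q))"
      by (intro exI conjI, rule XY, rule ext, rule casimir_sum[OF XY, symmetric])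
  next
    fix C assume "\<exists>N X Y. dual_bases \<omega> N X Y \<and> C = (\<lambda>q. \<Sum>i<N. gl_act (X i) (gl_act (Y i) q))"
    then show "C = casimir_op" using casimir_sum by auto
  qed
qed

lemma casimir_homog:
  assumes "q \<in> homog d"
  shows "casimir \<omega> q = spscale (of_nat d * (of_nat d - 2 * of_nat k - 2)) q - rsq (lap q)"
proof -
  have "(\<Sum>v\<in>UNIV. xop v (euler (spartial v q))) = spscale (of_nat (d - 1)) (euler q)"
    unfolding euler_homog[OF spartial_homog[OF assms]] euler_def[of q] spmult_simps sp.scale_sum_right ..
  then have "casimir \<omega> q = spscale (- 2 * of_nat k * of_nat d + of_nat (d - 1) * of_nat d - of_nat d) q - rsq (lap q)"
    unfolding casimir_eq_op casimir_op_def
    by (simp add: euler_homog[OF assms] sp.scale_left_distrib sp.scale_left_diff_distrib)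
  also have "- 2 * of_nat k * of_nat d + of_nat (d - 1) * of_nat d - of_nat d =
      (of_nat d * (of_nat d - 2 * of_nat k - 2) :: complex)"
    \<comment> \<open>At d = 0 the truncated \<open>d - 1\<close> is multiplied by d.\<close>
    by (cases d) (simp_all add: algebra_simps)
  finally show ?thesis .
qed

end

section \<open>Polynomials in a linear operator\<close>

text \<open>The operator p(F), by Horner's scheme.\<close>

definition pact :: "('i, 'j) sop \<Rightarrow> complex poly \<Rightarrow> ('i, 'j) sop" where
  "pact F p = fold_coeffs (\<lambda>a f q. spscale a q + f (F q)) p (\<lambda>q. 0)"

lemma pact_0 [simp]: "pact F 0 q = 0"
  by (simp add: pact_def)

lemma pact_pCons [simp]: "pact F (pCons a p) q = spscale a q + pact F p (F q)"
proof (cases "p = 0 \<and> a = 0")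
  case False
  then show ?thesis by (auto simp: pact_def)
qed simp

lemma pact_1 [simp]: "pact F 1 q = q"
  by (simp add: one_pCons)

lemma pact_add: "pact F (p + r) q = pact F p q + pact F r q"
  by (induction p r arbitrary: q rule: poly_induct2) (simp_all add: sp.scale_left_distrib)

lemma pact_smult: "pact F (smult c p) q = spscale c (pact F p q)"
  by (induction p arbitrary: q) (simp_all add: sp.scale_right_distrib)

lemma pact_diff: "pact F (p - r) q = pact F p q - pact F r q"
  using pact_add[of F p "- r" q] pact_smult[of F "-1" r q] by simp

lemma pact_sum: "pact F (\<Sum>i\<in>A. p i) q = (\<Sum>i\<in>A. pact F (p i) q)"
  by (induction A rule: infinite_finite_induct) (simp_all add: pact_add)

lemma slinear_pact:
  assumes "slinear F"
  shows "slinear (pact F p)"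
proof (induction p)
  case 0
  show ?case by (simp add: slinear_def)
next
  case (pCons a p)
  have "slinear (\<lambda>q. spscale a q + pact F p (F q))"
    using slinear_compose[OF pCons(2) assms] by simp
  then show ?case by (simp add: slinear_def)
qed

lemma pact_commute:
  assumes "slinear F"
  shows "pact F p (F q) = F (pact F p q)"
  by (induction p arbitrary: q) (simp_all add: slinear_simps[OF assms])

lemma pact_mult:
  assumes "slinear F"
  shows "pact F (p * r) q = pact F p (pact F r q)"
  by (induction p arbitrary: q) (simp_all add: pact_add pact_smult pact_commute[OF assms])

lemma pact_commute_pact:
  assumes "slinear F"
  shows "pact F p (pact F r q) = pact F r (pact F p q)"
  by (simp only: mult.commute flip: pact_mult[OF assms])

lemma pact_linear_factor: "pact F [:- e, 1:] q = F q - spscale e q"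
  by simp

lemma pact_eigen:
  assumes "slinear F" and "F u = spscale e u"
  shows "pact F p u = spscale (poly p e) u"
  by (induction p) (simp_all add: assms slinear_scale[OF slinear_pact[OF assms(1)]]
      sp.scale_left_distrib mult.commute)

lemma pact_homog:
  assumes "\<And>q. q \<in> homog d \<Longrightarrow> F q \<in> homog d" and "q \<in> homog d"
  shows "pact F p q \<in> homog d"
  using assms(2) by (induction p arbitrary: q) (auto intro: assms(1))

text \<open>Normalize \<open>g\<close> to have value 1 at \<open>c\<close>. Then 1 - g is divisible
  by the linear factor, (1 - g)^N by its power, and the geometric sum shows 1 - (1 - g)^N to be a
  multiple of g.\<close>

lemma bezout_linear_power:
  fixes g :: "complex poly"
  assumes "poly g c \<noteq> 0"
  shows "\<exists>a b. a * g + b * [:- c, 1:] ^ N = 1"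
proof -
  define f where "f = smult (1 / poly g c) g"
  have "[:- c, 1:] dvd 1 - f"
    using assms by (simp add: f_def flip: poly_eq_0_iff_dvd)
  then have "[:- c, 1:] ^ N dvd (1 - f) ^ N" by (rule dvd_power_same)
  then obtain b where b: "(1 - f) ^ N = [:- c, 1:] ^ N * b" by (elim dvdE)
  have "1 - (1 - f) ^ N = (1 - (1 - f)) * (\<Sum>i<N. (1 - f) ^ i)" by (rule one_diff_power_eq)
  also have "\<dots> = (smult (1 / poly g c) (\<Sum>i<N. (1 - f) ^ i)) * g"
    by (simp add: f_def mult.commute)
  finally have "1 = smult (1 / poly g c) (\<Sum>i<N. (1 - f) ^ i) * g + b * [:- c, 1:] ^ N"
    using b by (simp add: algebra_simps)
  then show ?thesis by metis
qed

text \<open>\<open>pact F ([:-e, 1:] ^ N) q = 0\<close> for some \<open>N\<close> says that \<open>q\<close> is a generalized eigenvector.\<close>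

lemma pact_cancel:
  assumes F: "slinear F" and "poly g e \<noteq> 0"
    and "pact F g q = 0" and "pact F ([:- e, 1:] ^ N) q = 0"
  shows "q = 0"
proof -
  obtain a b where "a * g + b * [:- e, 1:] ^ N = 1"
    using bezout_linear_power[OF assms(2)] by blast
  then have "q = pact F (a * g + b * [:- e, 1:] ^ N) q" by simp
  also have "\<dots> = 0"
    by (simp add: pact_add pact_mult[OF F] assms slinear_zero[OF slinear_pact[OF F]] del: pact_pCons)
  finally show ?thesis .
qed

text \<open>On generalized eigenvectors for \<open>c\<close> the operator F - r is invertible, and
  the inverse is a polynomial in F. Hence it preserves whatever F preserves, in particular the
  degree.\<close>

lemma pact_solve:
  assumes F: "slinear F" and "c \<noteq> r" and w: "pact F ([:- c, 1:] ^ N) w = 0"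
  obtains a where "F (pact F a w) - spscale r (pact F a w) = w"
    and "pact F ([:- c, 1:] ^ N) (pact F a w) = 0"
proof -
  have "poly [:- r, 1:] c \<noteq> 0" using assms(2) by simp
  from bezout_linear_power[OF this] obtain a b
    where "a * [:- r, 1:] + b * [:- c, 1:] ^ N = 1" by blast
  then have "w = pact F (a * [:- r, 1:] + b * [:- c, 1:] ^ N) w" by simp
  also have "\<dots> = pact F a (pact F [:- r, 1:] w) + pact F b (pact F ([:- c, 1:] ^ N) w)"
    by (simp only: pact_add pact_mult[OF F])
  also have "\<dots> = pact F [:- r, 1:] (pact F a w)"
    unfolding w by (simp only: slinear_zero[OF slinear_pact[OF F]] add_0_right pact_commute_pact[OF F, of a])
  finally have "F (pact F a w) - spscale r (pact F a w) = w"
    by (simp only: pact_linear_factor)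
  moreover have "pact F ([:- c, 1:] ^ N) (pact F a w) = 0"
    unfolding pact_commute_pact[OF F, of _ a] w by (rule slinear_zero[OF slinear_pact[OF F]])
  ultimately show thesis by (rule that)
qed

text \<open>Primary decomposition, with repetitions in \<open>rs\<close> allowed because several of
  the e_j may coincide. \<open>S\<close> stands for any additively closed set, in the application
  the set where two linear maps agree.\<close>

lemma generalized_eigenvectors_span:
  assumes F: "slinear F" and W: "\<And>q. q \<in> homog d \<Longrightarrow> F q \<in> homog d"
    and "\<And>w c N. c \<in> set rs \<Longrightarrow> w \<in> homog d \<Longrightarrow> pact F ([:- c, 1:] ^ N) w = 0 \<Longrightarrow> w \<in> S"
    and "0 \<in> S" and "\<And>p q. p \<in> S \<Longrightarrow> q \<in> S \<Longrightarrow> p + q \<in> S"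
    and "q \<in> homog d" and "pact F (\<Prod>r\<leftarrow>rs. [:- r, 1:]) q = 0"
  shows "q \<in> S"
  using assms(3-)
proof (induction rs arbitrary: S q)
  case Nil
  then show ?case by simp
next
  case (Cons r rs)
  note S = Cons.prems(1) and S0 = Cons.prems(2) and Sadd = Cons.prems(3) and q = Cons.prems(4)
    and ann = Cons.prems(5)
  define K where "K = {w \<in> homog d. \<exists>N. pact F ([:- r, 1:] ^ N) w = 0}"
  have K0: "0 \<in> K" by (auto simp: K_def slinear_zero[OF slinear_pact[OF F]])
  have K_up: "pact F ([:- r, 1:] ^ (M + N)) w = 0" if "pact F ([:- r, 1:] ^ N) w = 0" for M N w
    unfolding power_add pact_mult[OF F] that by (rule slinear_zero[OF slinear_pact[OF F]])
  have Kadd: "p + w \<in> K" if pw: "p \<in> K" "w \<in> K" for p w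
  proof -
    obtain M N where "pact F ([:- r, 1:] ^ M) p = 0" "pact F ([:- r, 1:] ^ N) w = 0"
      using pw by (auto simp: K_def)
    then have "pact F ([:- r, 1:] ^ (M + N)) (p + w) = 0"
      using K_up[of M p N] K_up[of N w M]
      by (simp add: slinear_add[OF slinear_pact[OF F]] add.commute del: pact_pCons)
    then show ?thesis using pw by (auto simp: K_def)
  qed
  have Kneg: "- w \<in> K" if "w \<in> K" for w
    using that homog_spscale[of w d "-1"] by (auto simp: K_def slinear_minus[OF slinear_pact[OF F]])
  have KS: "K \<subseteq> S" unfolding K_def using S[of r] by auto
  \<comment> \<open>The vectors that modulo \<open>K\<close> have the form (F - r) u with u in
    \<open>S\<close>. The induction hypothesis is applied to this set and to (F - r) q.\<close>
  define S' where "S' = {w. \<exists>u\<in>S. u \<in> homog d \<and> (F u - spscale r u) - w \<in> K}"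
  have "F q - spscale r q \<in> S'"
  proof (rule Cons.IH)
    show "w \<in> S'" if c: "c \<in> set rs" and w: "w \<in> homog d" "pact F ([:- c, 1:] ^ N) w = 0" for w c N
    \<comment> \<open>For c = r the vector lies in \<open>K\<close> up to sign and u = 0 will do;
      otherwise F - r is inverted on it.\<close>
    proof (cases "c = r")
      case True
      then have "- w \<in> K" using w by (intro Kneg) (auto simp: K_def)
      then show ?thesis unfolding S'_def using S0 by (auto intro!: bexI[of _ 0] simp: slinear_zero[OF F])
    next
      case False
      obtain a where a: "F (pact F a w) - spscale r (pact F a w) = w"
        "pact F ([:- c, 1:] ^ N) (pact F a w) = 0"
        using pact_solve[OF F False w(2)] by blast
      have "pact F a w \<in> homog d" using W w(1) by (rule pact_homog)
      moreover have "pact F a w \<in> S" using S[of c "pact F a w" N] c a(2) calculation by simp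
      ultimately show ?thesis unfolding S'_def using K0 a(1) by auto
    qed
    show "0 \<in> S'" unfolding S'_def using S0 K0 by (auto intro!: bexI[of _ 0] simp: slinear_zero[OF F])
    show "p + w \<in> S'" if pw: "p \<in> S'" "w \<in> S'" for p w
    proof -
      obtain u v where uv: "u \<in> S" "u \<in> homog d" "(F u - spscale r u) - p \<in> K"
        "v \<in> S" "v \<in> homog d" "(F v - spscale r v) - w \<in> K"
        using pw by (auto simp: S'_def)
      have "(F (u + v) - spscale r (u + v)) - (p + w) = ((F u - spscale r u) - p) + ((F v - spscale r v) - w)"
        by (simp add: slinear_add[OF F] sp.scale_right_distrib algebra_simps)
      then have "(F (u + v) - spscale r (u + v)) - (p + w) \<in> K"
        using Kadd[OF uv(3) uv(6)] by (simp only:)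
      then show ?thesis unfolding S'_def using uv Sadd by blast
    qed
    show "F q - spscale r q \<in> homog d" using q W by auto
    show "pact F (\<Prod>r\<leftarrow>rs. [:- r, 1:]) (F q - spscale r q) = 0"
      using ann unfolding pact_linear_factor[symmetric]
      by (simp only: list.map prod_list.Cons mult.commute[of "[:- r, 1:]"] pact_mult[OF F])
  qed
  then obtain u where u: "u \<in> S" "u \<in> homog d" "(F u - spscale r u) - (F q - spscale r q) \<in> K"
    by (auto simp: S'_def)
  then obtain N where "pact F ([:- r, 1:] ^ N) ((F u - spscale r u) - (F q - spscale r q)) = 0"
    by (auto simp: K_def)
  \<comment> \<open>So F - r maps u - q into \<open>K\<close>, hence u - q is itself a generalized
    eigenvector for r, and q is u minus an element of \<open>K\<close>.\<close>
  moreover have "(F u - spscale r u) - (F q - spscale r q) = pact F [:- r, 1:] (u - q)"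
    by (simp add: slinear_diff[OF F] sp.scale_right_diff_distrib algebra_simps)
  ultimately have "pact F ([:- r, 1:] ^ Suc N) (u - q) = 0"
    by (simp only: power_Suc2 pact_mult[OF F])
  then have "u - q \<in> K" using u(2) q unfolding K_def by blast
  then have "- (u - q) \<in> S" using Kneg KS by blast
  then have "u + - (u - q) \<in> S" using u(1) Sadd by blast
  then show ?case by simp
qed

section \<open>The spectrum of R Delta in a fixed degree\<close>

context superform begin

text \<open>The value of R Delta on R^j f for harmonic f of degree d - 2j, see
  \<open>rlap_rsq_funpow_harmonic\<close>. It is symmetric under j -> d - k - 1 - j.\<close>

definition tev :: "nat \<Rightarrow> nat \<Rightarrow> complex" where
  "tev d j = 4 * of_nat j * (of_nat d - of_nat j - of_nat k - 1)"

definition rlap :: "('i, 'j) sop" where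
  "rlap q = rsq (lap q)"

lemma slinear_rlap [simp]: "slinear rlap"
  unfolding rlap_def[abs_def] by (rule slinear_compose) simp_all

lemma rlap_homog: "q \<in> homog d \<Longrightarrow> rlap q \<in> homog d"
  unfolding rlap_def
proof (cases "d < 2")
  case False
  then have "d - 2 + 2 = d" by simp
  then show "q \<in> homog d \<Longrightarrow> rsq (lap q) \<in> homog d"
    using rsq_homog[OF lap_homog, of q d] by (simp only:)
qed (simp add: lap_homog_small slinear_zero[OF slinear_rsq])

lemma slinear_rsq_funpow [simp]: "slinear (rsq ^^ i)" and slinear_lap_funpow [simp]: "slinear (lap ^^ i)"
  by (simp_all add: slinear_funpow)

lemma lap_funpow_homog: "q \<in> homog d \<Longrightarrow> (lap ^^ i) q \<in> homog (d - 2 * i)"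
proof (induction i)
  case (Suc i)
  then show ?case using lap_homog[of "(lap ^^ i) q" "d - 2 * i"] by simp
qed simp

lemma lap_funpow_small:
  assumes "q \<in> homog d" and "d < 2 * i"
  shows "(lap ^^ i) q = 0"
proof -
  have "(lap ^^ Suc (d div 2)) q = 0"
    using lap_homog_small[OF lap_funpow_homog[OF assms(1), of "d div 2"]] by simp
  then have "(lap ^^ (i - Suc (d div 2) + Suc (d div 2))) q = 0"
    unfolding funpow_add o_def by (simp add: slinear_zero[OF slinear_lap_funpow])
  moreover have "i - Suc (d div 2) + Suc (d div 2) = i" using assms(2) by simp
  ultimately show ?thesis by simp
qed

lemma lap_rsq_homog:
  assumes "q \<in> homog d"
  shows "lap (rsq q) = rlap q + spscale (4 * (of_nat d - of_nat k)) q"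
  by (simp add: lap_rsq rlap_def euler_homog[OF assms] right_diff_distrib
      sp.scale_left_diff_distrib algebra_simps)

text \<open>Every Delta that R Delta is moved across shifts it by the commutator of Delta and R in
  the current degree; e_i is the accumulated shift.\<close>

lemma rlap_lap_funpow:
  "q \<in> homog d \<Longrightarrow> rlap ((lap ^^ i) q) = (lap ^^ i) (rlap q - spscale (tev d i) q)"
proof (induction i arbitrary: q d)
  case 0
  then show ?case by (simp add: tev_def)
next
  case (Suc i)
  show ?case
  proof (cases "d < 2")
    case True
    then have "lap q = 0" using Suc.prems by (simp add: lap_homog_small)
    then show ?thesis
      by (simp add: funpow_swap1 slinear_simps[OF slinear_lap] slinear_simps[OF slinear_lap_funpow] rlap_def
          slinear_zero[OF slinear_rsq])
  next
    case False
    then obtain d' where d: "d = d' + 2" by (metis add.commute le_add_diff_inverse not_less)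
    have l: "lap q \<in> homog d'" using lap_homog[OF Suc.prems] d by simp
    \<comment> \<open>Uses tev d (i + 1) = tev d' i + 4 (d' - k) for d = d' + 2.\<close>
    have "lap (rlap q - spscale (tev d (Suc i)) q) = rlap (lap q) - spscale (tev d' i) (lap q)"
      unfolding slinear_simps[OF slinear_lap] rlap_def[of q] lap_rsq_homog[OF l]
      by (simp add: tev_def d algebra_simps flip: sp.scale_left_distrib sp.scale_left_diff_distrib)
    then show ?thesis using Suc.IH[OF l] by (simp add: funpow_swap1)
  qed
qed

definition rpoly :: "nat \<Rightarrow> nat \<Rightarrow> complex poly" where
  "rpoly d i = (\<Prod>j<i. [:- tev d j, 1:])"

lemma rpoly_Suc: "rpoly d (Suc i) = rpoly d i * [:- tev d i, 1:]"
  by (simp add: rpoly_def)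

text \<open>The innermost R Delta is moved to the right of Delta^i by
  \<open>rlap_lap_funpow\<close>, where it becomes R Delta - e_i.\<close>

lemma rsq_lap_funpow: "q \<in> homog d \<Longrightarrow> (rsq ^^ i) ((lap ^^ i) q) = pact rlap (rpoly d i) q"
proof (induction i arbitrary: q)
  case 0
  then show ?case by (simp add: rpoly_def)
next
  case (Suc i)
  have "(rsq ^^ Suc i) ((lap ^^ Suc i) q) = (rsq ^^ i) (rlap ((lap ^^ i) q))"
    by (simp add: funpow_swap1 rlap_def)
  also have "\<dots> = (rsq ^^ i) ((lap ^^ i) (rlap q - spscale (tev d i) q))"
    using rlap_lap_funpow[OF Suc.prems] by simp
  also have "\<dots> = pact rlap (rpoly d i) (rlap q - spscale (tev d i) q)"
    by (rule Suc.IH) (use Suc.prems rlap_homog in blast)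
  also have "\<dots> = pact rlap (rpoly d (Suc i)) q"
    unfolding rpoly_Suc pact_mult[OF slinear_rlap] pact_linear_factor ..
  finally show ?case .
qed

lemma rlap_annihilator:
  assumes "q \<in> homog d" and "d < 2 * i"
  shows "pact rlap (rpoly d i) q = 0"
  using rsq_lap_funpow[OF assms(1), of i] lap_funpow_small[OF assms]
  by (simp add: slinear_zero[OF slinear_rsq_funpow])

text \<open>With d = a + b, the Casimir eigenvalue is d(d - 2k - 2) - e_b, so in degree d the
  operator C - c is minus R Delta - e_b. Generalized eigenspaces of C and R Delta therefore
  correspond.\<close>

lemma casimir_shift:
  assumes "b \<le> a"
  shows "p \<in> homog (a + b) \<Longrightarrow>
    ((\<lambda>q. casimir \<omega> q - spscale (casimir_eigenvalue k (a, b)) q) ^^ N) p =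
    spscale ((-1) ^ N) (pact rlap ([:- tev (a + b) b, 1:] ^ N) p)"
proof (induction N)
  case (Suc N)
  define w where "w = pact rlap ([:- tev (a + b) b, 1:] ^ N) p"
  have w: "w \<in> homog (a + b)"
    unfolding w_def using rlap_homog Suc.prems by (rule pact_homog)
  have e: "casimir_eigenvalue k (a, b) =
      of_nat (a + b) * (of_nat (a + b) - 2 * of_nat k - 2) - tev (a + b) b"
    by (simp add: casimir_eigenvalue_def tev_def algebra_simps)
  have "casimir \<omega> q - spscale (casimir_eigenvalue k (a, b)) q = - (rlap q - spscale (tev (a + b) b) q)"
    if "q \<in> homog (a + b)" for q
    unfolding casimir_homog[OF that] e by (simp add: rlap_def sp.scale_left_diff_distrib)
  from this[OF homog_spscale[OF w]]
  have "((\<lambda>q. casimir \<omega> q - spscale (casimir_eigenvalue k (a, b)) q) ^^ Suc N) p =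
      - (rlap (spscale ((-1) ^ N) w) - spscale (tev (a + b) b) (spscale ((-1) ^ N) w))"
    using Suc by (simp add: w_def)
  also have "\<dots> = spscale ((-1) ^ Suc N) (rlap w - spscale (tev (a + b) b) w)"
    by (simp add: slinear_simps[OF slinear_rlap] sp.scale_right_diff_distrib mult.commute)
  also have "rlap w - spscale (tev (a + b) b) w = pact rlap ([:- tev (a + b) b, 1:] ^ Suc N) p"
    unfolding w_def power_Suc pact_mult[OF slinear_rlap] pact_linear_factor ..
  finally show ?case .
qed simp

lemma Vmod_eq:
  assumes "b \<le> a"
  shows "Vmod \<omega> k (a, b) =
    {p \<in> homog (a + b). \<exists>N. pact rlap ([:- tev (a + b) b, 1:] ^ N) p = 0}"
  unfolding Vmod_def using casimir_shift[OF assms] by auto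

lemma rsq_funpow_homog: "f \<in> homog a \<Longrightarrow> (rsq ^^ b) f \<in> homog (a + 2 * b)"
proof (induction b)
  case (Suc b)
  then show ?case using rsq_homog[of "(rsq ^^ b) f" "a + 2 * b"] by simp
qed simp

lemma rlap_rsq_funpow_harmonic:
  assumes f: "f \<in> homog a" and "lap f = 0"
  shows "rlap ((rsq ^^ b) f) = spscale (tev (a + 2 * b) b) ((rsq ^^ b) f)"
proof (induction b)
  case 0
  then show ?case by (simp add: rlap_def assms(2) tev_def slinear_zero[OF slinear_rsq])
next
  case (Suc b)
  have "rlap ((rsq ^^ Suc b) f) = rsq (lap (rsq ((rsq ^^ b) f)))"
    by (simp add: rlap_def)
  also have "\<dots> = rsq (spscale (tev (a + 2 * b) b + 4 * (of_nat (a + 2 * b) - of_nat k)) ((rsq ^^ b) f))"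
    unfolding lap_rsq_homog[OF rsq_funpow_homog[OF f]] Suc.IH sp.scale_left_distrib ..
  also have "tev (a + 2 * b) b + 4 * (of_nat (a + 2 * b) - of_nat k) = tev (a + 2 * Suc b) (Suc b)"
    by (simp add: tev_def algebra_simps)
  finally show ?case by (simp add: slinear_simps[OF slinear_rsq])
qed

end

section \<open>Constant coefficient operators and tensors\<close>

lemma place_sign_cancel [simp]: "place_sign j S * (place_sign j S * x) = x"
  by (simp only: mult.assoc[symmetric] place_sign_square mult_1)

lemma lookup_slinear:
  assumes "slinear F"
  shows "Poly_Mapping.lookup (F p) c =
    (\<Sum>a\<in>Poly_Mapping.keys p. Poly_Mapping.lookup p a * Poly_Mapping.lookup (F (Poly_Mapping.single a 1)) c)"
proof -
  have "F p = (\<Sum>a\<in>Poly_Mapping.keys p. spscale (Poly_Mapping.lookup p a) (F (Poly_Mapping.single a 1)))"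
    using arg_cong[OF spoly_expansion[of p], of F]
    by (simp add: slinear_sum[OF assms] slinear_scale[OF assms] del: spscale_single)
  then show ?thesis by (simp add: lookup_sum)
qed

lemma sum_keys_delta:
  "(\<Sum>a\<in>Poly_Mapping.keys p. Poly_Mapping.lookup p a * (if a = c then t else 0)) =
    t * (Poly_Mapping.lookup p c :: complex)"
proof -
  have "(\<Sum>a\<in>Poly_Mapping.keys p. Poly_Mapping.lookup p a * (if a = c then t else 0)) =
      (\<Sum>a\<in>Poly_Mapping.keys p. if a = c then t * Poly_Mapping.lookup p c else 0)"
    by (intro sum.cong) auto
  then show ?thesis by (simp add: in_keys_iff)
qed

lemma lookup_spartial_even:
  fixes p :: "('i, 'j::{finite,linorder}) spoly"
  shows "Poly_Mapping.lookup (spartial (Inl i) p) (\<alpha>, S) =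
    of_nat (Suc (\<alpha> i)) * Poly_Mapping.lookup p (\<alpha>(i := Suc (\<alpha> i)), S)"
proof -
  have "Poly_Mapping.lookup (spartial (Inl i) (Poly_Mapping.single a 1)) (\<alpha>, S) =
      (if a = (\<alpha>(i := Suc (\<alpha> i)), S) then of_nat (Suc (\<alpha> i)) else 0)" for a :: "('i, 'j) smonom"
  proof (cases a)
    case (Pair \<beta> T)
    have "\<beta> = \<alpha>(i := Suc (\<alpha> i))" if "\<beta>(i := \<beta> i - Suc 0) = \<alpha>" "\<beta> i \<noteq> 0"
      using that(2) unfolding that(1)[symmetric] by simp
    note * = this
    have part: "spartial (Inl i) (Poly_Mapping.single a 1) =
        Poly_Mapping.single (\<beta>(i := \<beta> i - Suc 0), T) (of_nat (\<beta> i))"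
      using Pair by simp
    show ?thesis
    proof (cases "a = (\<alpha>(i := Suc (\<alpha> i)), S)")
      case True
      then have "\<beta> = \<alpha>(i := Suc (\<alpha> i))" "T = S" using Pair by simp_all
      then show ?thesis unfolding part by (simp add: True)
    next
      case False
      show ?thesis
      proof (cases "\<beta> i = 0")
        case True
        then show ?thesis using False unfolding part by simp
      next
        case nz: False
        have "(\<beta>(i := \<beta> i - Suc 0), T) \<noteq> (\<alpha>, S)"
          using * nz False Pair by (auto simp del: fun_upd_apply)
        then show ?thesis using False unfolding part by (simp add: lookup_single_not_eq)
      qed
    qed
  qed
  then show ?thesis
    unfolding lookup_slinear[OF slinear_spartial, of _ p] by (simp only: sum_keys_delta)
qed

lemma lookup_spartial_odd:
  fixes p :: "('i, 'j::{finite,linorder}) spoly"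
  assumes "j \<notin> S"
  shows "Poly_Mapping.lookup (spartial (Inr j) p) (\<alpha>, S) =
    place_sign j S * Poly_Mapping.lookup p (\<alpha>, insert j S)"
proof -
  have "Poly_Mapping.lookup (spartial (Inr j) (Poly_Mapping.single a 1)) (\<alpha>, S) =
      (if a = (\<alpha>, insert j S) then place_sign j S else 0)" for a :: "('i, 'j) smonom"
  proof (cases a)
    case (Pair \<beta> T)
    have "T = insert j S" if "j \<in> T" "T - {j} = S"
      using that by blast
    then have "a \<noteq> (\<alpha>, insert j S) \<Longrightarrow> j \<notin> T \<or> (\<beta>, T - {j}) \<noteq> (\<alpha>, S)"
      using Pair by blast
    then show ?thesis
      using Pair assms by (cases "a = (\<alpha>, insert j S)") (auto simp: lookup_single_not_eq)
  qed
  then show ?thesis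
    unfolding lookup_slinear[OF slinear_spartial, of _ p] by (simp only: sum_keys_delta)
qed

text \<open>Taylor's formula: a coefficient is, up to a factor, the constant term of an iterated
  derivative.\<close>

lemma lookup_by_spartial:
  fixes c :: "('i::finite, 'j::{finite,linorder}) smonom"
  shows "\<exists>vs \<gamma>. \<forall>p :: ('i, 'j) spoly.
    Poly_Mapping.lookup p c = \<gamma> * Poly_Mapping.lookup (foldr spartial vs p) (\<lambda>_. 0, {})"
proof (induction "smonom_deg c" arbitrary: c)
  case 0
  obtain \<alpha> S where c: "c = (\<alpha>, S)" by (cases c)
  then have "c = (\<lambda>_. 0, {})" using 0 by (auto simp: smonom_deg_def)
  then show ?case by (intro exI[of _ "[]"] exI[of _ 1]) simp
next
  case (Suc d)
  obtain \<alpha> S where c: "c = (\<alpha>, S)" by (cases c)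
  have "(\<exists>i. \<alpha> i \<noteq> 0) \<or> S \<noteq> {}"
    using Suc(2) c by (auto simp: smonom_deg_def)
  then obtain c' v \<delta> where c': "smonom_deg c' = d"
    "\<And>p. Poly_Mapping.lookup p c = \<delta> * Poly_Mapping.lookup (spartial v p) c'"
  proof (elim disjE exE)
    fix i assume i: "\<alpha> i \<noteq> 0"
    have "smonom_deg (\<alpha>(i := \<alpha> i - 1), S) = d"
      using smonom_deg_upd[of \<alpha> i "\<alpha> i - 1" S] Suc(2) c i by simp
    moreover have "Poly_Mapping.lookup p c = 1 / of_nat (\<alpha> i) *
        Poly_Mapping.lookup (spartial (Inl i) p) (\<alpha>(i := \<alpha> i - 1), S)" for p :: "('i, 'j) spoly"
      unfolding lookup_spartial_even using i by (simp add: c)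
    ultimately show ?thesis by (rule that)
  next
    assume "S \<noteq> {}"
    then obtain j where j: "j \<in> S" by blast
    then obtain n where "card S = Suc n" by (cases "card S") auto
    then have "smonom_deg (\<alpha>, S - {j}) = d"
      using Suc(2) j by (simp add: c smonom_deg_def)
    moreover have "Poly_Mapping.lookup p c = place_sign j S *
        Poly_Mapping.lookup (spartial (Inr j) p) (\<alpha>, S - {j})" for p :: "('i, 'j) spoly"
      by (subst lookup_spartial_odd) (use j in \<open>simp_all add: c insert_absorb\<close>)
    ultimately show ?thesis by (rule that)
  qed
  obtain vs \<gamma> where vs: "\<And>p. Poly_Mapping.lookup p c' = \<gamma> * Poly_Mapping.lookup (foldr spartial vs p) (\<lambda>_. 0, {})"
    using Suc(1)[of c'] c'(1) by blast
  show ?case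
  proof (intro exI allI)
    fix p
    show "Poly_Mapping.lookup p c = (\<delta> * \<gamma>) *
        Poly_Mapping.lookup (foldr spartial (vs @ [v]) p) (\<lambda>_. 0, {})"
      unfolding c'(2)[of p] vs[of "spartial v p"] by simp
  qed
qed

definition odd_count :: "('i + 'j) list \<Rightarrow> nat" where
  "odd_count vs = length (filter is_odd vs)"

lemma slinear_foldr_spartial [simp]:
  fixes vs :: "('i + 'j::{finite,linorder}) list"
  shows "slinear (foldr spartial vs)"
  by (induction vs) (simp_all add: comp_def id_def)

lemma spartial_foldr:
  fixes q :: "('i, 'j::{finite,linorder}) spoly"
  shows "spartial u (foldr spartial vs q) =
    spscale (if is_odd u then (-1) ^ odd_count vs else 1) (foldr spartial vs (spartial u q))"
proof (induction vs)
  case Nil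
  then show ?case by (simp add: odd_count_def)
next
  case (Cons v vs)
  have "spartial u (foldr spartial (v # vs) q) =
      spscale (ssign u v) (spartial v (spartial u (foldr spartial vs q)))"
    unfolding foldr.simps o_apply by (rule spartial_spartial)
  also have "\<dots> = spscale (if is_odd u then (-1) ^ odd_count (v # vs) else 1)
      (foldr spartial (v # vs) (spartial u q))"
    unfolding Cons.IH by (auto simp: spartial_simps ssign_def odd_count_def)
  finally show ?case .
qed

lemma foldr_spartial_commute:
  fixes q :: "('i, 'j::{finite,linorder}) spoly"
  shows "foldr spartial us (foldr spartial vs q) =
    spscale ((-1) ^ (odd_count us * odd_count vs)) (foldr spartial vs (foldr spartial us q))"
proof (induction us)
  case Nil
  then show ?case by (simp add: odd_count_def)
next
  case (Cons u us)
  have "foldr spartial (u # us) (foldr spartial vs q) =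
      spscale ((-1) ^ (odd_count us * odd_count vs)) (spartial u (foldr spartial vs (foldr spartial us q)))"
    using Cons.IH by (simp add: spartial_simps)
  also have "\<dots> = spscale ((-1) ^ (odd_count (u # us) * odd_count vs))
      (foldr spartial vs (foldr spartial (u # us) q))"
    unfolding spartial_foldr[of u vs "foldr spartial us q"]
    by (simp add: odd_count_def power_add mult.commute)
  finally show ?case .
qed

lemma slinear_parity [simp]: "slinear parity_op"
proof -
  have *: "parity_op = (\<lambda>p. \<Sum>a\<in>Poly_Mapping.keys p. spscale (Poly_Mapping.lookup p a)
      (Poly_Mapping.single a ((-1) ^ card (snd a))))"
    by (simp add: parity_op_def fun_eq_iff mult.commute)
  show ?thesis unfolding * by (rule slinear_extension)
qed

lemma parity_single [simp]: "parity_op (Poly_Mapping.single a c) = Poly_Mapping.single a ((-1) ^ card (snd a) * c)"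
  by (simp add: parity_op_def)

lemma lookup_parity: "Poly_Mapping.lookup (parity_op p) a = (-1) ^ card (snd a) * Poly_Mapping.lookup p a"
  by (simp add: parity_op_def lookup_sum lookup_single when_def in_keys_iff)

lemma parity_parity [simp]: "parity_op (parity_op p) = p"
  by (rule poly_mapping_eqI) (simp add: lookup_parity minus_one_power_iff)

abbreviation psign :: "'i + 'j \<Rightarrow> complex" where
  "psign v \<equiv> if is_odd v then -1 else 1"

lemma parity_xop:
  fixes p :: "('i, 'j::{finite,linorder}) spoly"
  shows "parity_op (xop v p) = spscale (psign v) (xop v (parity_op p))"
proof (rule slinear_ext[of "\<lambda>p. parity_op (xop v p)" "\<lambda>p. spscale (psign v) (xop v (parity_op p))"])
  show "slinear (\<lambda>p. parity_op (xop v p))" by (rule slinear_compose) simp_all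
  fix a :: "('i, 'j) smonom"
  obtain \<alpha> S where "a = (\<alpha>, S)" by (cases a)
  then show "parity_op (xop v (Poly_Mapping.single a 1)) = spscale (psign v) (xop v (parity_op (Poly_Mapping.single a 1)))"
    by (cases v) (auto simp: slinear_zero[OF slinear_parity] simp flip: single_uminus)
qed simp

lemma parity_spartial:
  fixes p :: "('i, 'j::{finite,linorder}) spoly"
  shows "parity_op (spartial v p) = spscale (psign v) (spartial v (parity_op p))"
proof (rule slinear_ext[of "\<lambda>p. parity_op (spartial v p)" "\<lambda>p. spscale (psign v) (spartial v (parity_op p))"])
  show "slinear (\<lambda>p. parity_op (spartial v p))" by (rule slinear_compose) simp_all
  fix a :: "('i, 'j) smonom"
  obtain \<alpha> S where a: "a = (\<alpha>, S)" by (cases a)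
  have "(-1) ^ (card S - Suc 0) = - ((-1) ^ card S :: complex)" if "j \<in> S" for j
    using that by (cases "card S") auto
  then show "parity_op (spartial v (Poly_Mapping.single a 1)) = spscale (psign v) (spartial v (parity_op (Poly_Mapping.single a 1)))"
    by (cases v) (auto simp: a slinear_zero[OF slinear_parity] simp flip: single_uminus)
qed simp

lemma parity_foldr:
  fixes p :: "('i, 'j::{finite,linorder}) spoly"
  shows "parity_op (foldr spartial vs p) = spscale ((-1) ^ odd_count vs) (foldr spartial vs (parity_op p))"
  by (induction vs) (simp_all add: odd_count_def parity_spartial spartial_simps)

text \<open>A constant is even, so the number of odd derivatives must match the number of odd
  coordinates modulo 2.\<close>

lemma constant_term_parity:
  fixes \<alpha> :: "'i \<Rightarrow> nat" and S :: "'j::{finite,linorder} set"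
  assumes "Poly_Mapping.lookup (foldr spartial vs (Poly_Mapping.single (\<alpha>, S) 1)) (\<lambda>_. 0, {}) \<noteq> 0"
  shows "even (odd_count vs + card S)"
proof -
  let ?x = "foldr spartial vs (Poly_Mapping.single (\<alpha>, S) 1)"
  have "Poly_Mapping.lookup ?x (\<lambda>_. 0, {}) = Poly_Mapping.lookup (parity_op ?x) (\<lambda>_. 0, {})"
    by (simp add: lookup_parity)
  also have "parity_op ?x = spscale ((-1) ^ (odd_count vs + card S)) ?x"
  proof -
    have "parity_op (Poly_Mapping.single (\<alpha>, S) 1) = spscale ((-1) ^ card S) (Poly_Mapping.single (\<alpha>, S) 1)"
      by simp
    then show ?thesis
      unfolding parity_foldr by (simp only: slinear_scale[OF slinear_foldr_spartial] sp.scale_scale power_add)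
  qed
  finally have "Poly_Mapping.lookup ?x (\<lambda>_. 0, {}) =
      (-1) ^ (odd_count vs + card S) * Poly_Mapping.lookup ?x (\<lambda>_. 0, {})"
    by simp
  then show ?thesis using assms by (cases "even (odd_count vs + card S)") auto
qed

text \<open>Taylor's formula for D x^a, with the extra derivatives moved inside D. The point is the
  order of quantifiers: \<open>vs\<close> and the factor serve all operators D at once.\<close>

lemma const_diff_ops_coeff:
  fixes a c :: "('i::finite, 'j::{finite,linorder}) smonom"
  shows "\<exists>vs \<kappa>. \<forall>d. \<forall>D\<in>const_diff_ops d. Poly_Mapping.lookup (D (Poly_Mapping.single a 1)) c =
     \<kappa> * spairing D (foldr spartial vs (Poly_Mapping.single a 1))"
proof -
  obtain \<alpha> S where a: "a = (\<alpha>, S)" by (cases a)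
  obtain us \<gamma> where us: "\<And>p :: ('i, 'j) spoly. Poly_Mapping.lookup p c =
      \<gamma> * Poly_Mapping.lookup (foldr spartial us p) (\<lambda>_. 0, {})"
    using lookup_by_spartial[of c] by blast
  define \<kappa> where "\<kappa> = \<gamma> * (-1) ^ (odd_count us * (odd_count us + card S))"
  have *: "Poly_Mapping.lookup (foldr spartial vs (Poly_Mapping.single a 1)) c =
     \<kappa> * Poly_Mapping.lookup (foldr spartial vs (foldr spartial us (Poly_Mapping.single a 1))) (\<lambda>_. 0, {})"
    (is "_ = \<kappa> * ?y") for vs
  proof (cases "?y = 0")
    case True
    then show ?thesis unfolding us[of "foldr spartial vs _"] foldr_spartial_commute[of us vs] by simp
  next
    case False
    then have "even (odd_count (vs @ us) + card S)"
      using constant_term_parity[of "vs @ us" \<alpha> S] by (simp add: a)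
    \<comment> \<open>\<open>odd_count vs\<close> has the parity of
      \<open>odd_count us + card S\<close>, so the sign no longer depends on \<open>vs\<close>, that
      is, on the operator.\<close>
    then have "(-1) ^ (odd_count us * odd_count vs) = ((-1) ^ (odd_count us * (odd_count us + card S)) :: complex)"
      by (auto simp: odd_count_def minus_one_power_iff)
    then show ?thesis
      unfolding us[of "foldr spartial vs _"] foldr_spartial_commute[of us vs] by (simp add: \<kappa>_def)
  qed
  have "Poly_Mapping.lookup (D (Poly_Mapping.single a 1)) c =
     \<kappa> * spairing D (foldr spartial us (Poly_Mapping.single a 1))" if D: "D \<in> const_diff_ops d" for d D
  proof -
    obtain f where "D = (\<lambda>q. \<Sum>vs | length vs = d. spscale (f vs) (foldr spartial vs q))"
      using D by (auto simp: const_diff_ops_def)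
    then show ?thesis
      unfolding spairing_def by (simp add: lookup_sum * sum_distrib_left mult_ac)
  qed
  then show ?thesis by blast
qed

lemma slinear_const_diff_ops: "D \<in> const_diff_ops d \<Longrightarrow> slinear D"
  unfolding const_diff_ops_def by auto

lemma tens_op_Nil [simp]: "tens_op [] q = 0"
  and tens_op_Cons [simp]: "tens_op ((p, D) # ts) q = spmult p (D q) + tens_op ts q"
  and tens_hom_Nil [simp]: "tens_hom [] q = 0"
  and tens_hom_Cons [simp]: "tens_hom ((p, D) # ts) q = spscale (spairing D q) p + tens_hom ts q"
  by (simp_all add: tens_op_def tens_hom_def)

lemma tensors_Nil [simp]: "[] \<in> tensors"
  and tensors_Cons [simp]: "(p, D) # ts \<in> tensors \<longleftrightarrow> (\<exists>d. D \<in> const_diff_ops d) \<and> ts \<in> tensors"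
  by (auto simp: tensors_def)

lemma slinear_tens_op:
  assumes "ts \<in> tensors"
  shows "slinear (tens_op ts)"
  using assms
proof (induction ts)
  case Nil
  then show ?case by (simp add: slinear_def)
next
  case (Cons x ts)
  obtain p D where x: "x = (p, D)" by (cases x)
  have "slinear (\<lambda>q. spmult p (D q) + tens_op ts q)"
    using Cons x slinear_const_diff_ops by (intro slinear_plus slinear_spmult_comp) auto
  then show ?case by (simp add: x slinear_def)
qed

lemma slinear_tens_hom:
  assumes "ts \<in> tensors"
  shows "slinear (tens_hom ts)"
  using assms
proof (induction ts)
  case Nil
  then show ?case by (simp add: slinear_def)
next
  case (Cons x ts)
  obtain p D where x: "x = (p, D)" by (cases x)
  have D: "slinear D" using Cons(2) x slinear_const_diff_ops by auto
  have "slinear (\<lambda>q. spscale (spairing D q) p)"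
    by (simp add: slinear_def spairing_def slinear_simps[OF D] lookup_add sp.scale_left_distrib)
  then have "slinear (\<lambda>q. spscale (spairing D q) p + tens_hom ts q)"
    using Cons x by (intro slinear_plus) auto
  then show ?case by (simp add: x slinear_def)
qed

lemma spmult_expansion:
  assumes "finite A" and "Poly_Mapping.keys r \<subseteq> A"
  shows "spmult p r = (\<Sum>c\<in>A. spscale (Poly_Mapping.lookup r c) (spmult p (Poly_Mapping.single c 1)))"
proof -
  have "spmult p r = (\<Sum>c\<in>Poly_Mapping.keys r. spscale (Poly_Mapping.lookup r c) (spmult p (Poly_Mapping.single c 1)))"
    using arg_cong[OF spoly_expansion[of r], of "spmult p"] by (simp add: spmult_simps del: spscale_single)
  also have "\<dots> = (\<Sum>c\<in>A. spscale (Poly_Mapping.lookup r c) (spmult p (Poly_Mapping.single c 1)))"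
    by (rule linear_extension_eq[OF assms])
  finally show ?thesis .
qed

text \<open>The value of \<open>tens_op\<close> at a monomial is a linear combination of values of
  \<open>tens_hom\<close>, with multipliers that do not depend on the tensor. So different lists for
  the same tensor do no harm.\<close>

lemma tens_op_determined:
  fixes ts ts' :: "(('i::finite, 'j::{finite,linorder}) spoly \<times> ('i, 'j) sop) list"
  assumes "ts \<in> tensors" and "ts' \<in> tensors" and "tens_hom ts = tens_hom ts'"
  shows "tens_op ts = tens_op ts'"
proof
  fix q
  show "tens_op ts q = tens_op ts' q"
  proof (rule slinear_ext[of "tens_op ts" "tens_op ts'"])
    fix a :: "('i, 'j) smonom"
    let ?q = "Poly_Mapping.single a 1 :: ('i, 'j) spoly"
    obtain vs \<kappa> where \<kappa>: "\<And>c d D. D \<in> const_diff_ops d \<Longrightarrow> Poly_Mapping.lookup (D ?q) c =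
        \<kappa> c * spairing D (foldr spartial (vs c) ?q)"
      using const_diff_ops_coeff[of a] by metis
    \<comment> \<open>A finite support common to both lists, so that both operators are given by one
      and the same sum.\<close>
    define A where "A = (\<Union>(p, D)\<in>set ts \<union> set ts'. Poly_Mapping.keys (D ?q))"
    have A: "finite A" by (auto simp: A_def)
    have *: "tens_op us ?q = (\<Sum>c\<in>A. spscale (\<kappa> c)
        (spmult (tens_hom us (foldr spartial (vs c) ?q)) (Poly_Mapping.single c 1)))"
      if "us \<in> tensors" "set us \<subseteq> set ts \<union> set ts'" for us
      using that
    proof (induction us)
      case Nil
      then show ?case by (simp add: slinear_zero[OF slinear_spmult_left])
    next
      case (Cons x us)
      obtain p D where x: "x = (p, D)" by (cases x)
      have D: "\<exists>d. D \<in> const_diff_ops d" "Poly_Mapping.keys (D ?q) \<subseteq> A"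
        using Cons.prems x by (auto simp: A_def)
      have "spmult p (D ?q) = (\<Sum>c\<in>A. spscale (\<kappa> c * spairing D (foldr spartial (vs c) ?q))
          (spmult p (Poly_Mapping.single c 1)))"
        using spmult_expansion[OF A D(2)] \<kappa> D(1) by (elim exE) simp
      then show ?case
        using Cons by (simp add: x slinear_simps[OF slinear_spmult_left] sp.scale_right_distrib sum.distrib)
    qed
    show "tens_op ts ?q = tens_op ts' ?q"
      using *[of ts] *[of ts'] assms by simp
  qed (simp_all add: slinear_tens_op assms)
qed

section \<open>Construction of tensors\<close>

lemma const_diff_ops_ident: "(\<lambda>q. q) \<in> const_diff_ops 0"
  unfolding const_diff_ops_def by (auto intro!: exI[of _ "\<lambda>_. 1"])

lemma const_diff_ops_comp_spartial:
  fixes D :: "('i::finite, 'j::{finite,linorder}) sop"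
  assumes "D \<in> const_diff_ops d"
  shows "(\<lambda>q. D (spartial v q)) \<in> const_diff_ops (Suc d)"
proof -
  obtain f where f: "D = (\<lambda>q. \<Sum>vs | length vs = d. spscale (f vs) (foldr spartial vs q))"
    using assms by (auto simp: const_diff_ops_def)
  have "(\<Sum>ws | length ws = Suc d. spscale (if last ws = v then f (butlast ws) else 0) (foldr spartial ws q)) =
     D (spartial v q)" for q
  proof -
    have "(\<Sum>ws | length ws = Suc d. spscale (if last ws = v then f (butlast ws) else 0) (foldr spartial ws q)) =
       (\<Sum>(vs, w)\<in>{vs. length vs = d} \<times> UNIV. if w = v then spscale (f vs) (foldr spartial vs (spartial v q)) else 0)"
    proof (rule sum.reindex_bij_witness[of _ "\<lambda>(vs, w). vs @ [w]" "\<lambda>ws. (butlast ws, last ws)"])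
      fix ws :: "('i + 'j) list" assume "ws \<in> {ws. length ws = Suc d}"
      then obtain vs w where ws: "ws = vs @ [w]" by (cases ws rule: rev_cases) auto
      show "(case (butlast ws, last ws) of (vs, w) \<Rightarrow>
          if w = v then spscale (f vs) (foldr spartial vs (spartial v q)) else 0) =
          spscale (if last ws = v then f (butlast ws) else 0) (foldr spartial ws q)"
        by (simp add: ws)
    qed (auto intro!: append_butlast_last_id)
    also have "\<dots> = D (spartial v q)"
      by (simp add: f flip: sum.cartesian_product)
    finally show ?thesis .
  qed
  then show ?thesis
    unfolding const_diff_ops_def by (auto intro!: exI[of _ "\<lambda>ws. if last ws = v then f (butlast ws) else 0"])
qed

lemma const_diff_ops_zero: "(\<lambda>q. 0) \<in> const_diff_ops d"
  unfolding const_diff_ops_def by (auto intro!: exI[of _ "\<lambda>_. 0"])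

lemma const_diff_ops_add:
  assumes "A \<in> const_diff_ops d" and "B \<in> const_diff_ops d"
  shows "(\<lambda>q. A q + B q) \<in> const_diff_ops d"
proof -
  obtain f g where "A = (\<lambda>q. \<Sum>vs | length vs = d. spscale (f vs) (foldr spartial vs q))"
    "B = (\<lambda>q. \<Sum>vs | length vs = d. spscale (g vs) (foldr spartial vs q))"
    using assms by (auto simp: const_diff_ops_def)
  then have "(\<lambda>q. A q + B q) = (\<lambda>q. \<Sum>vs | length vs = d. spscale (f vs + g vs) (foldr spartial vs q))"
    by (simp add: sp.scale_left_distrib sum.distrib)
  then show ?thesis unfolding const_diff_ops_def mem_Collect_eq by (rule exI[of _ "\<lambda>vs. f vs + g vs"])
qed

lemma const_diff_ops_scale:
  assumes "A \<in> const_diff_ops d"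
  shows "(\<lambda>q. spscale c (A q)) \<in> const_diff_ops d"
proof -
  obtain f where "A = (\<lambda>q. \<Sum>vs | length vs = d. spscale (f vs) (foldr spartial vs q))"
    using assms by (auto simp: const_diff_ops_def)
  then have "(\<lambda>q. spscale c (A q)) = (\<lambda>q. \<Sum>vs | length vs = d. spscale (c * f vs) (foldr spartial vs q))"
    by (simp add: sp.scale_sum_right)
  then show ?thesis unfolding const_diff_ops_def mem_Collect_eq by (rule exI[of _ "\<lambda>vs. c * f vs"])
qed

lemma const_diff_ops_sum:
  "(\<And>x. x \<in> A \<Longrightarrow> B x \<in> const_diff_ops d) \<Longrightarrow> (\<lambda>q. \<Sum>x\<in>A. B x q) \<in> const_diff_ops d"
  by (induction A rule: infinite_finite_induct) (simp_all add: const_diff_ops_zero const_diff_ops_add)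

definition inversion_sign :: "'j::{finite,linorder} set \<Rightarrow> 'j set \<Rightarrow> complex" where
  "inversion_sign S T = (-1) ^ card {(s, t). s \<in> S \<and> t \<in> T \<and> t < s}"

lemma smonom_mult_eq: "smonom_mult (\<alpha>, S) (\<beta>, T) =
    (if S \<inter> T = {} then Poly_Mapping.single (\<lambda>i. \<alpha> i + \<beta> i, S \<union> T) (inversion_sign S T) else 0)"
  by (simp add: smonom_mult_def inversion_sign_def)

lemma inversion_sign_insert:
  assumes "j \<notin> S"
  shows "inversion_sign (insert j S) T = place_sign j T * inversion_sign S T"
proof -
  have "{(s, t). s \<in> insert j S \<and> t \<in> T \<and> t < s} =
      Pair j ` {t \<in> T. t < j} \<union> {(s, t). s \<in> S \<and> t \<in> T \<and> t < s}"
    by auto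
  moreover have "card (Pair j ` {t \<in> T. t < j} \<union> {(s, t). s \<in> S \<and> t \<in> T \<and> t < s}) =
      card {t \<in> T. t < j} + card {(s, t). s \<in> S \<and> t \<in> T \<and> t < s}"
    using assms by (subst card_Un_disjoint) (auto simp: card_image inj_on_def)
  ultimately show ?thesis by (simp add: inversion_sign_def place_sign_def power_add)
qed

lemma place_sign_union:
  assumes "S \<inter> T = {}"
  shows "place_sign j (S \<union> T) = place_sign j S * place_sign j T"
proof -
  have "{s \<in> S \<union> T. s < j} = {s \<in> S. s < j} \<union> {s \<in> T. s < j}" by auto
  moreover have "card ({s \<in> S. s < j} \<union> {s \<in> T. s < j}) = card {s \<in> S. s < j} + card {s \<in> T. s < j}"
    using assms by (intro card_Un_disjoint) auto
  ultimately show ?thesis by (simp add: place_sign_def power_add)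
qed

text \<open>The one case of associativity that is needed; it lets R and the coordinates be pulled
  out of a product.\<close>

lemma spmult_xop:
  fixes p r :: "('i, 'j::{finite,linorder}) spoly"
  shows "spmult (xop v p) r = xop v (spmult p r)"
proof (rule slinear_ext[of "\<lambda>p. spmult (xop v p) r" "\<lambda>p. xop v (spmult p r)"])
  show "slinear (\<lambda>p. spmult (xop v p) r)"
    by (rule slinear_compose[OF slinear_spmult_left slinear_spmult])
  show "slinear (\<lambda>p. xop v (spmult p r))"
    by (rule slinear_compose[OF slinear_spmult slinear_spmult_left])
  fix a :: "('i, 'j) smonom"
  let ?a = "Poly_Mapping.single a 1 :: ('i, 'j) spoly"
  show "spmult (xop v ?a) r = xop v (spmult ?a r)"
  proof (rule slinear_ext[of "\<lambda>r. spmult (xop v ?a) r" "\<lambda>r. xop v (spmult ?a r)"])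
    fix b :: "('i, 'j) smonom"
    obtain \<alpha> S \<beta> T where ab: "a = (\<alpha>, S)" "b = (\<beta>, T)" by (cases a, cases b)
    show "spmult (xop v ?a) (Poly_Mapping.single b 1) = xop v (spmult ?a (Poly_Mapping.single b 1))"
    proof (cases v)
      case (Inl i)
      have "(\<lambda>x. (\<alpha>(i := Suc (\<alpha> i))) x + \<beta> x) = (\<lambda>x. \<alpha> x + \<beta> x)(i := Suc (\<alpha> i + \<beta> i))" by auto
      then show ?thesis
        by (simp add: ab Inl smonom_mult_eq spmult_simps del: fun_upd_apply)
    next
      case (Inr j)
      have "spmult (Poly_Mapping.single (\<alpha>, insert j S) c) (Poly_Mapping.single (\<beta>, T) 1) =
          spscale c (smonom_mult (\<alpha>, insert j S) (\<beta>, T))" for c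
        by (subst single_eq_spscale) (simp add: slinear_scale[OF slinear_spmult_left] del: spscale_single)
      then show ?thesis
        by (auto simp: ab Inr smonom_mult_eq spmult_simps slinear_zero[OF slinear_spmult_left]
            inversion_sign_insert place_sign_union mult_ac)
    qed
  qed simp_all
qed

abbreviation spone :: "('i, 'j::{finite,linorder}) spoly" where
  "spone \<equiv> Poly_Mapping.single (\<lambda>_. 0, {}) 1"

lemma spmult_spone:
  fixes r :: "('i, 'j::{finite,linorder}) spoly"
  shows "spmult spone r = r"
proof (rule slinear_ext[of "spmult spone" "\<lambda>r. r"])
  fix b :: "('i, 'j) smonom"
  obtain \<beta> T where b: "b = (\<beta>, T)" by (cases b)
  show "spmult spone (Poly_Mapping.single b 1) = Poly_Mapping.single b 1"
    by (simp add: b smonom_mult_eq inversion_sign_def)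
qed simp_all

lemma homog_0_constant:
  assumes "p \<in> homog 0"
  shows "p = spscale (Poly_Mapping.lookup p (\<lambda>_. 0, {})) spone"
proof (rule poly_mapping_eqI)
  fix a
  show "Poly_Mapping.lookup p a =
    Poly_Mapping.lookup (spscale (Poly_Mapping.lookup p (\<lambda>_. 0, {})) spone) a"
  proof (cases "a = (\<lambda>_. 0, {})")
    case False
    obtain \<alpha> S where a: "a = (\<alpha>, S)" by (cases a)
    have "a \<notin> Poly_Mapping.keys p"
    proof
      assume "a \<in> Poly_Mapping.keys p"
      then have "smonom_deg a = 0" using assms by (auto simp: homog_def)
      then show False using False by (auto simp: a smonom_deg_def)
    qed
    then show ?thesis using False by (simp add: in_keys_iff lookup_single_not_eq)
  qed simp
qed

lemma homog_constant_term:
  fixes p :: "('i::finite, 'j::finite) spoly"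
  assumes "p \<in> homog d" and "d \<noteq> 0"
  shows "Poly_Mapping.lookup p (\<lambda>_. 0, {}) = 0"
proof -
  have "smonom_deg ((\<lambda>_. 0, {}) :: ('i, 'j) smonom) = 0" by (simp add: smonom_deg_def)
  then have "(\<lambda>_. 0, {}) \<notin> Poly_Mapping.keys p" using assms unfolding homog_def by auto
  then show ?thesis by (simp add: in_keys_iff)
qed

lemma tens_op_append: "tens_op (ts @ us) q = tens_op ts q + tens_op us q"
  and tens_hom_append: "tens_hom (ts @ us) q = tens_hom ts q + tens_hom us q"
  by (simp_all add: tens_op_def tens_hom_def)

lemma tens_op_concat: "tens_op (concat (map f xs)) q = (\<Sum>x\<leftarrow>xs. tens_op (f x) q)"
  and tens_hom_concat: "tens_hom (concat (map f xs)) q = (\<Sum>x\<leftarrow>xs. tens_hom (f x) q)"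
  by (induction xs) (simp_all add: tens_op_append tens_hom_append)

lemma tensors_concat: "(\<And>x. x \<in> set xs \<Longrightarrow> f x \<in> tensors) \<Longrightarrow> concat (map f xs) \<in> tensors"
  by (auto simp: tensors_def)

definition scale_tensor :: "complex \<Rightarrow> (('i, 'j) spoly \<times> ('i, 'j) sop) list \<Rightarrow> (('i, 'j) spoly \<times> ('i, 'j) sop) list" where
  "scale_tensor c ts = map (\<lambda>(p, D). (spscale c p, D)) ts"

lemma scale_tensor:
  shows tens_op_scale_tensor: "tens_op (scale_tensor c ts) q = spscale c (tens_op ts q)"
    and tens_hom_scale_tensor: "tens_hom (scale_tensor c ts) q = spscale c (tens_hom ts q)"
    and tensors_scale_tensor: "ts \<in> tensors \<Longrightarrow> scale_tensor c ts \<in> tensors"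
  by (induction ts) (auto simp: scale_tensor_def slinear_scale[OF slinear_spmult_left]
      sp.scale_right_distrib mult.commute)

text \<open>A coordinate is put on the left and the matching derivative on the right, so the result
  is normally ordered. \<open>tens_op\<close> and \<open>tens_hom\<close> obey the same rule, so
  they differ only through the tensor from which the construction starts.\<close>

definition coord_tensor :: "'i + 'j \<Rightarrow> (('i, 'j::{finite,linorder}) spoly \<times> ('i, 'j) sop) list
     \<Rightarrow> (('i, 'j) spoly \<times> ('i, 'j) sop) list" where
  "coord_tensor v ts = map (\<lambda>(p, D). (xop v p, \<lambda>q. D (spartial v q))) ts"

lemma coord_tensor:
  shows tens_op_coord_tensor: "tens_op (coord_tensor v ts) q = xop v (tens_op ts (spartial v q))"
    and tens_hom_coord_tensor: "tens_hom (coord_tensor v ts) q = xop v (tens_hom ts (spartial v q))"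
  by (induction ts) (auto simp: coord_tensor_def spmult_xop spmult_simps spairing_def)

lemma tensors_coord_tensor:
  assumes "ts \<in> tensors"
  shows "coord_tensor v ts \<in> tensors"
proof -
  have "\<exists>d. (\<lambda>q. D (spartial v q)) \<in> const_diff_ops d" if "D \<in> const_diff_ops d" for D :: "('a, 'b) sop" and d
    using const_diff_ops_comp_spartial[OF that] by blast
  then show ?thesis using assms by (induction ts) (auto simp: coord_tensor_def)
qed

context superform begin

lemma const_diff_ops_comp_lap:
  assumes "D \<in> const_diff_ops d"
  shows "(\<lambda>q. D (lap q)) \<in> const_diff_ops (Suc (Suc d))"
proof -
  have "(\<lambda>q. D (lap q)) = (\<lambda>q. \<Sum>u\<in>UNIV. \<Sum>v\<in>UNIV. spscale (h u v) (D (spartial u (spartial v q))))"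
    by (simp add: lap_def slinear_simps[OF slinear_const_diff_ops[OF assms]])
  also have "\<dots> \<in> const_diff_ops (Suc (Suc d))"
    by (intro const_diff_ops_sum const_diff_ops_scale)
      (rule const_diff_ops_comp_spartial[OF const_diff_ops_comp_spartial[OF assms]])
  finally show ?thesis .
qed

lemma const_diff_ops_lap_funpow: "lap ^^ i \<in> const_diff_ops (2 * i)"
proof (induction i)
  case 0
  then show ?case using const_diff_ops_ident by (simp add: id_def)
next
  case (Suc i)
  have "lap ^^ Suc i = (\<lambda>q. (lap ^^ i) (lap q))"
    by (simp add: funpow_Suc_right comp_def del: funpow.simps)
  then show ?case using const_diff_ops_comp_lap[OF Suc] by simp
qed

text \<open>Tensors are lists, so a sum over the basis needs an enumeration; by
  \<open>sum_list_basis\<close> its order is immaterial.\<close>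

definition basis_list :: "('i + 'j) list" where
  "basis_list = (SOME vs. set vs = UNIV \<and> distinct vs)"

lemma sum_list_basis: "(\<Sum>v\<leftarrow>basis_list. f v) = (\<Sum>v\<in>UNIV. f v)"
proof -
  have "\<exists>vs :: ('i + 'j) list. set vs = UNIV \<and> distinct vs"
    by (rule finite_distinct_list) simp
  then have "set basis_list = UNIV \<and> distinct basis_list"
    unfolding basis_list_def by (rule someI_ex)
  then show ?thesis by (simp add: sum_list_distinct_conv_sum_set)
qed

text \<open>The tensor of the operator \<open>rsq\<^sup>i E (E - 1) \<cdots> (E - j + 1) lap\<^sup>i\<close>, where \<open>E\<close> is the Euler operator.\<close>

primrec ordered_tensor :: "nat \<Rightarrow> nat \<Rightarrow> (('i, 'j) spoly \<times> ('i, 'j) sop) list" where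
  "ordered_tensor i 0 = [((rsq ^^ i) spone, lap ^^ i)]"
| "ordered_tensor i (Suc j) = concat (map (\<lambda>v. coord_tensor v (ordered_tensor i j)) basis_list)"

lemma ordered_tensor_tensors: "ordered_tensor i j \<in> tensors"
  by (induction j) (auto intro!: tensors_concat tensors_coord_tensor intro: const_diff_ops_lap_funpow)

lemma spmult_rsq: "spmult (rsq p) r = rsq (spmult p r)"
  by (simp add: rsq_def slinear_simps[OF slinear_spmult_left] spmult_xop)

lemma spmult_rsq_funpow: "spmult ((rsq ^^ i) spone) r = (rsq ^^ i) r"
  by (induction i) (simp_all add: spmult_spone spmult_rsq)

lemma xop_rsq_funpow: "xop v ((rsq ^^ i) q) = (rsq ^^ i) (xop v q)"
  by (induction i) (simp_all add: xop_rsq)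

lemma spartial_lap_funpow: "spartial v ((lap ^^ i) q) = (lap ^^ i) (spartial v q)"
  by (induction i) (simp_all add: spartial_lap)

text \<open>Coordinates commute with R and derivatives with Delta, so the sum is R^i E Delta^i, with
  E acting in degree d - 2i.\<close>

lemma euler_sandwich:
  assumes "q \<in> homog d"
  shows "(\<Sum>v\<in>UNIV. xop v ((rsq ^^ i) ((lap ^^ i) (spartial v q)))) =
    spscale (of_nat d - 2 * of_nat i) ((rsq ^^ i) ((lap ^^ i) q))"
proof -
  have "(\<Sum>v\<in>UNIV. xop v ((rsq ^^ i) ((lap ^^ i) (spartial v q)))) = (rsq ^^ i) (euler ((lap ^^ i) q))"
    by (simp add: euler_def xop_rsq_funpow slinear_sum[OF slinear_rsq_funpow] flip: spartial_lap_funpow)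
  also have "\<dots> = spscale (of_nat d - 2 * of_nat i) ((rsq ^^ i) ((lap ^^ i) q))"
  proof (cases "d < 2 * i")
    case True
    then show ?thesis
      by (simp add: lap_funpow_small[OF assms] slinear_zero[OF slinear_euler] slinear_zero[OF slinear_rsq_funpow])
  next
    case False
    then show ?thesis
      by (simp add: euler_homog[OF lap_funpow_homog[OF assms]] slinear_scale[OF slinear_rsq_funpow] of_nat_diff)
  qed
  finally show ?thesis .
qed

lemma falling_Suc_left: "falling (x :: complex) (Suc j) = x * falling (x - 1) j"
  unfolding falling_def prod.lessThan_Suc_shift by (simp add: algebra_simps)

lemma ordered_tensor_op:
  "q \<in> homog d \<Longrightarrow> tens_op (ordered_tensor i j) q =
    spscale (falling (of_nat d - 2 * of_nat i) j) ((rsq ^^ i) ((lap ^^ i) q))"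
proof (induction j arbitrary: q d)
  case 0
  then show ?case by (simp add: spmult_rsq_funpow falling_def)
next
  case (Suc j)
  have "tens_op (ordered_tensor i (Suc j)) q = (\<Sum>v\<in>UNIV. xop v (tens_op (ordered_tensor i j) (spartial v q)))"
    by (simp add: tens_op_concat tens_op_coord_tensor sum_list_basis)
  also have "\<dots> = (\<Sum>v\<in>UNIV. spscale (falling (of_nat d - 2 * of_nat i - 1) j) (xop v ((rsq ^^ i) ((lap ^^ i) (spartial v q)))))"
  proof (intro sum.cong refl)
    fix v
    show "xop v (tens_op (ordered_tensor i j) (spartial v q)) =
      spscale (falling (of_nat d - 2 * of_nat i - 1) j) (xop v ((rsq ^^ i) ((lap ^^ i) (spartial v q))))"
    proof (cases d)
      case 0
      then have "spartial v q = 0" using Suc.prems spartial_homog_0 by blast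
      then show ?thesis
        by (simp add: slinear_zero[OF slinear_tens_op[OF ordered_tensor_tensors]] spmult_simps
            slinear_zero[OF slinear_rsq_funpow] slinear_zero[OF slinear_lap_funpow])
    next
      case d: (Suc d')
      then show ?thesis
        using Suc.IH[OF spartial_homog[OF Suc.prems, of v]] by (simp add: spmult_simps algebra_simps)
    qed
  qed
  also have "\<dots> = spscale (falling (of_nat d - 2 * of_nat i - 1) j)
      (spscale (of_nat d - 2 * of_nat i) ((rsq ^^ i) ((lap ^^ i) q)))"
    by (simp only: sp.scale_sum_right[symmetric] euler_sandwich[OF Suc.prems])
  finally show ?case by (simp add: falling_Suc_left mult.commute)
qed

text \<open>The constant-term pairing admits only degree 2i + j, and there the falling factorial of
  \<open>ordered_tensor_op\<close> is j!.\<close>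

lemma ordered_tensor_hom:
  "q \<in> homog d \<Longrightarrow> tens_hom (ordered_tensor i j) q =
    (if d = 2 * i + j then spscale (fact j) ((rsq ^^ i) ((lap ^^ i) q)) else 0)"
proof (induction j arbitrary: q d)
  case 0
  have l: "(lap ^^ i) q \<in> homog (d - 2 * i)" by (rule lap_funpow_homog[OF 0])
  show ?case
  proof (cases "d = 2 * i")
    case True
    then have "(lap ^^ i) q = spscale (spairing (lap ^^ i) q) spone"
      using homog_0_constant[of "(lap ^^ i) q"] l by (simp add: spairing_def del: spscale_single)
    then have "(rsq ^^ i) ((lap ^^ i) q) = spscale (spairing (lap ^^ i) q) ((rsq ^^ i) spone)"
      by (metis slinear_scale[OF slinear_rsq_funpow])
    then show ?thesis using True by simp
  next
    case False
    have "spairing (lap ^^ i) q = 0"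
    proof (cases "d < 2 * i")
      case True
      then show ?thesis using lap_funpow_small[OF 0] by (simp add: spairing_def)
    next
      case False
      then have "d - 2 * i \<noteq> 0" using \<open>d \<noteq> 2 * i\<close> by simp
      then show ?thesis unfolding spairing_def by (rule homog_constant_term[OF l])
    qed
    then show ?thesis using False by simp
  qed
next
  case (Suc j)
  have *: "tens_hom (ordered_tensor i (Suc j)) q = (\<Sum>v\<in>UNIV. xop v (tens_hom (ordered_tensor i j) (spartial v q)))"
    by (simp add: tens_hom_concat tens_hom_coord_tensor sum_list_basis)
  show ?case
  proof (cases d)
    case 0
    then have "spartial v q = 0" for v using Suc.prems spartial_homog_0 by blast
    then show ?thesis
      using 0 unfolding * by (simp add: slinear_zero[OF slinear_tens_hom[OF ordered_tensor_tensors]] spmult_simps)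
  next
    case d: (Suc d')
    have "tens_hom (ordered_tensor i j) (spartial v q) =
       (if d = 2 * i + Suc j then spscale (fact j) ((rsq ^^ i) ((lap ^^ i) (spartial v q))) else 0)" for v
      using Suc.IH[OF spartial_homog[OF Suc.prems, of v]] d by simp
    then have "tens_hom (ordered_tensor i (Suc j)) q = (if d = 2 * i + Suc j then spscale (fact j)
        (\<Sum>v\<in>UNIV. xop v ((rsq ^^ i) ((lap ^^ i) (spartial v q)))) else 0)"
      unfolding * by (simp add: spmult_simps sp.scale_sum_right)
    then show ?thesis
      unfolding euler_sandwich[OF Suc.prems] by (simp add: mult.commute algebra_simps)
  qed
qed

end

section \<open>The Capelli operator\<close>

text \<open>Newton's form on the left and Lagrange's on the right of the polynomial that is 1 at
  \<open>e b\<close> and vanishes at the other nodes; its divided differences of order below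
  \<open>b\<close> are zero. The other nodes may coincide with each other.\<close>

lemma newton_interpolation:
  fixes e :: "nat \<Rightarrow> complex"
  assumes "b \<le> J" and "\<And>j. j \<le> J \<Longrightarrow> j \<noteq> b \<Longrightarrow> e j \<noteq> e b"
  shows "(\<Sum>i=b..J. smult (1 / (\<Prod>j\<in>{..i} - {b}. e b - e j)) (\<Prod>j<i. [:- e j, 1:])) =
    smult (1 / (\<Prod>j\<in>{..J} - {b}. e b - e j)) (\<Prod>j\<in>{..J} - {b}. [:- e j, 1:])"
  using assms
proof (induction J rule: dec_induct)
  case base
  have "{..<b} = {..b} - {b}" by auto
  then show ?case by simp
next
  case (step J)
  let ?c = "\<lambda>J. \<Prod>j\<in>{..J} - {b}. e b - e j"
  let ?P = "\<lambda>J. \<Prod>j\<in>{..J} - {b}. [:- e j, 1:]"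
  have set: "{..Suc J} - {b} = insert (Suc J) ({..J} - {b})" using step(1) by auto
  have c: "?c (Suc J) = (e b - e (Suc J)) * ?c J" unfolding set by simp
  have P: "?P (Suc J) = [:- e (Suc J), 1:] * ?P J" unfolding set by (subst prod.insert) auto
  have "{..<Suc J} = insert b ({..J} - {b})" using step(1) by auto
  then have N: "(\<Prod>j<Suc J. [:- e j, 1:]) = [:- e b, 1:] * ?P J"
    by (simp only:) (subst prod.insert, auto)
  have ne: "e b - e (Suc J) \<noteq> 0" using step(4)[of "Suc J"] step(1) by simp
  have "(\<Sum>i=b..Suc J. smult (1 / ?c i) (\<Prod>j<i. [:- e j, 1:])) =
      smult (1 / ?c J) (?P J) + smult (1 / ?c (Suc J)) ([:- e b, 1:] * ?P J)"
    using step N by simp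
  also have "\<dots> = smult (1 / ?c (Suc J)) (smult (e b - e (Suc J)) (?P J) + [:- e b, 1:] * ?P J)"
    unfolding c using ne by (simp add: smult_add_right)
  \<comment> \<open>(e_b - e_(J+1)) + (t - e_b) = t - e_(J+1).\<close>
  also have "smult (e b - e (Suc J)) (?P J) + [:- e b, 1:] * ?P J = ?P (Suc J)"
    unfolding P by (simp add: smult_diff_left)
  finally show ?case .
qed

context superform begin

lemma tev_diff: "tev (l1 + l2) l2 - tev (l1 + l2) j =
    4 * ((of_nat l2 - of_nat j) * (of_nat l1 - of_nat k - 1 - of_nat j))"
  by (simp add: tev_def algebra_simps)

text \<open>By \<open>tev_diff\<close> the only competitor is j = l1 - k - 1. In the three cases of
  regularity it is negative, equal to l2, or larger than half of l1 + l2.\<close>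

lemma tev_regular:
  assumes "l2 \<le> l1" and "k_regular k (l1, l2)" and "j \<le> (l1 + l2) div 2" and "j \<noteq> l2"
  shows "tev (l1 + l2) j \<noteq> tev (l1 + l2) l2"
proof
  assume "tev (l1 + l2) j = tev (l1 + l2) l2"
  then have "(of_nat l2 - of_nat j) * (of_nat l1 - of_nat k - 1 - of_nat j) = (0 :: complex)"
    using tev_diff[of l1 l2 j] by simp
  moreover have "of_nat l2 - of_nat j \<noteq> (0 :: complex)" using assms(4) by simp
  ultimately have "of_nat l1 - of_nat k - 1 - of_nat j = (0 :: complex)" by (simp only: mult_eq_0_iff simp_thms)
  then have "of_nat l1 = (of_nat (k + 1 + j) :: complex)" by (simp add: algebra_simps)
  then have "l1 = k + 1 + j" by (simp only: of_nat_eq_iff)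
  then show False using assms by (auto simp: k_regular_def)
qed

text \<open>The reflection j -> d - k - 1 - j preserves \<open>tev\<close> and carries a singular
  partition to a quasiregular one, so leaving out the singular partitions loses no
  eigenvalue.\<close>

lemma tev_nonsingular:
  assumes "j \<le> d div 2"
  obtains a b where "(a, b) \<in> nonsingular2 k" and "a + b = d" and "tev d b = tev d j"
proof (cases "(d - j, j) \<in> nonsingular2 k")
  case True
  then show ?thesis using that[of "d - j" j] assms by simp
next
  case False
  have jd: "2 * j \<le> d" using assms by simp
  then have sing: "k + 2 \<le> d - 2 * j" "d - 2 * j \<le> 2 * k + 2"
    using False by (auto simp: nonsingular2_def partitions2_def k_regular_def k_quasiregular_def)
  define b where "b = d - j - k - 1"
  have b: "d = b + j + k + 1" using sing by (simp add: b_def)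
  have "(d - b, b) \<in> nonsingular2 k"
    using sing b by (auto simp: nonsingular2_def partitions2_def k_quasiregular_def)
  moreover have "d - b + b = d" using b by simp
  moreover have "tev d b = tev d j" by (simp add: tev_def b)
  ultimately show ?thesis by (rule that)
qed

text \<open>By \<open>tev_nonsingular\<close> every root of the annihilating polynomial belongs to
  some module, so the modules together span each degree.\<close>

lemma tens_hom_determined:
  assumes ts: "ts \<in> tensors" "ts' \<in> tensors"
    and eq: "\<And>\<mu> q. \<mu> \<in> nonsingular2 k \<Longrightarrow> q \<in> Vmod \<omega> k \<mu> \<Longrightarrow> tens_hom ts q = tens_hom ts' q"
  shows "tens_hom ts = tens_hom ts'"
proof
  fix q
  show "tens_hom ts q = tens_hom ts' q"
  proof (rule slinear_ext[of "tens_hom ts" "tens_hom ts'"])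
    fix m :: "('i, 'j) smonom"
    define d where "d = smonom_deg m"
    have "Poly_Mapping.single m 1 \<in> {w. tens_hom ts w = tens_hom ts' w}"
    proof (rule generalized_eigenvectors_span[OF slinear_rlap])
      show "q \<in> homog d \<Longrightarrow> rlap q \<in> homog d" for q by (rule rlap_homog)
      show "Poly_Mapping.single m 1 \<in> homog d" by (simp add: homog_single d_def)
      then have "pact rlap (rpoly d (Suc (d div 2))) (Poly_Mapping.single m 1) = 0"
        by (rule rlap_annihilator) simp
      moreover have "rpoly d n = (\<Prod>r\<leftarrow>map (tev d) [0..<n]. [:- r, 1:])" for n
        by (induction n) (simp_all add: rpoly_def)
      ultimately show "pact rlap (\<Prod>r\<leftarrow>map (tev d) [0..<Suc (d div 2)]. [:- r, 1:]) (Poly_Mapping.single m 1) = 0"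
        by (simp only:)
      show "w \<in> {w. tens_hom ts w = tens_hom ts' w}"
        if c: "c \<in> set (map (tev d) [0..<Suc (d div 2)])" and w: "w \<in> homog d" "pact rlap ([:- c, 1:] ^ N) w = 0"
        for w c N
      proof -
        obtain j where "j \<le> d div 2" "c = tev d j"
          using c by (auto simp: less_Suc_eq_le simp del: upt_Suc)
        then obtain a b where ab: "(a, b) \<in> nonsingular2 k" "a + b = d" "tev d b = c"
          using tev_nonsingular by metis
        then have "b \<le> a" by (auto simp: nonsingular2_def partitions2_def)
        then have "w \<in> Vmod \<omega> k (a, b)" using Vmod_eq[of b a] ab w by blast
        then show ?thesis using eq[OF ab(1)] by simp
      qed
      show "0 \<in> {w. tens_hom ts w = tens_hom ts' w}"
        using ts by (simp add: slinear_zero[OF slinear_tens_hom])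
      show "p + q \<in> {w. tens_hom ts w = tens_hom ts' w}"
        if "p \<in> {w. tens_hom ts w = tens_hom ts' w}" "q \<in> {w. tens_hom ts w = tens_hom ts' w}" for p q
        using that ts by (simp add: slinear_add[OF slinear_tens_hom])
    qed
    then show "tens_hom ts (Poly_Mapping.single m 1) = tens_hom ts' (Poly_Mapping.single m 1)" by simp
  qed (simp_all add: slinear_tens_hom ts)
qed

text \<open>The divided difference at e_0, ..., e_i of the function that is 1 at e_b and 0 at the
  other nodes.\<close>

definition capelli_coeff :: "nat \<Rightarrow> nat \<Rightarrow> nat \<Rightarrow> complex" where
  "capelli_coeff d b i = 1 / (\<Prod>j\<in>{..i} - {b}. tev d b - tev d j)"

text \<open>The factorial undoes the one in \<open>ordered_tensor_hom\<close>, so in degree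
  \<open>d\<close> the induced map is the Newton sum of the R^i Delta^i.\<close>

definition capelli_tensor :: "nat \<Rightarrow> nat \<Rightarrow> (('i, 'j) spoly \<times> ('i, 'j) sop) list" where
  "capelli_tensor d b = concat (map (\<lambda>i. scale_tensor (capelli_coeff d b i / fact (d - 2 * i))
     (ordered_tensor i (d - 2 * i))) [b..<Suc (d div 2)])"

lemma capelli_tensor_tensors: "capelli_tensor d b \<in> tensors"
  unfolding capelli_tensor_def by (intro tensors_concat tensors_scale_tensor ordered_tensor_tensors)

lemma capelli_tensor_op:
  assumes "q \<in> homog D"
  shows "tens_op (capelli_tensor d b) q = (\<Sum>i=b..d div 2.
     spscale (capelli_coeff d b i / fact (d - 2 * i) * falling (of_nat D - 2 * of_nat i) (d - 2 * i))
       ((rsq ^^ i) ((lap ^^ i) q)))"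
  by (simp add: capelli_tensor_def tens_op_concat tens_op_scale_tensor ordered_tensor_op[OF assms]
      interv_sum_list_conv_sum_set_nat atLeastLessThanSuc_atLeastAtMost del: upt_Suc)

text \<open>In every degree, not only in \<open>d\<close>, the operator is a polynomial in R Delta;
  its eigenvalue on a module is therefore a polynomial evaluated at some e_b.\<close>

lemma capelli_tensor_op_poly:
  assumes "q \<in> homog D"
  shows "tens_op (capelli_tensor d b) q = pact rlap (\<Sum>i=b..d div 2.
     smult (capelli_coeff d b i / fact (d - 2 * i) * falling (of_nat D - 2 * of_nat i) (d - 2 * i)) (rpoly D i)) q"
  by (simp add: capelli_tensor_op[OF assms] pact_sum pact_smult rsq_lap_funpow[OF assms])

lemma capelli_tensor_hom:
  assumes "q \<in> homog D"
  shows "tens_hom (capelli_tensor d b) q =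
    (if D = d then pact rlap (\<Sum>i=b..d div 2. smult (capelli_coeff d b i) (rpoly d i)) q else 0)"
proof -
  have "tens_hom (capelli_tensor d b) q = (\<Sum>i=b..d div 2. spscale (capelli_coeff d b i / fact (d - 2 * i))
      (tens_hom (ordered_tensor i (d - 2 * i)) q))"
    by (simp add: capelli_tensor_def tens_hom_concat tens_hom_scale_tensor
      interv_sum_list_conv_sum_set_nat atLeastLessThanSuc_atLeastAtMost del: upt_Suc)
  also have "\<dots> = (\<Sum>i=b..d div 2. if D = d then spscale (capelli_coeff d b i) ((rsq ^^ i) ((lap ^^ i) q)) else 0)"
    by (intro sum.cong refl) (auto simp: ordered_tensor_hom[OF assms])
  finally show ?thesis
    using rsq_lap_funpow[OF assms] by (cases "D = d") (simp_all add: pact_sum pact_smult)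
qed

lemma capelli_tensor_projection:
  assumes l: "l2 \<le> l1" "k_regular k (l1, l2)"
    and \<mu>: "\<mu> \<in> nonsingular2 k" and q: "q \<in> Vmod \<omega> k \<mu>"
  shows "tens_hom (capelli_tensor (l1 + l2) l2) q = (if \<mu> = (l1, l2) then q else 0)"
proof -
  obtain a b where ab: "\<mu> = (a, b)" by (cases \<mu>)
  have ba: "b \<le> a" using \<mu> by (auto simp: ab nonsingular2_def partitions2_def)
  obtain N where N: "pact rlap ([:- tev (a + b) b, 1:] ^ N) q = 0" and qh: "q \<in> homog (a + b)"
    using q by (auto simp: ab Vmod_eq[OF ba])
  define d where "d = l1 + l2"
  define e where "e = tev d"
  define \<pi> where "\<pi> = (\<Sum>i=l2..d div 2. smult (capelli_coeff d l2 i) (rpoly d i))"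
  let ?J = "{..d div 2} - {l2}"
  have l2d: "l2 \<le> d div 2" using l by (simp add: d_def)
  have e_ne: "e j \<noteq> e l2" if "j \<le> d div 2" "j \<noteq> l2" for j
    unfolding e_def d_def using l that by (intro tev_regular) (auto simp: d_def)
  have \<pi>: "\<pi> = smult (1 / (\<Prod>j\<in>?J. e l2 - e j)) (\<Prod>j\<in>?J. [:- e j, 1:])"
    unfolding \<pi>_def capelli_coeff_def rpoly_def e_def[symmetric]
    using l2d e_ne by (rule newton_interpolation)
  show ?thesis
  proof (cases "a + b = d")
    case False
    then have "\<mu> \<noteq> (l1, l2)" by (auto simp: ab d_def)
    then show ?thesis
      using capelli_tensor_hom[OF qh, of d l2] False by (simp add: d_def)
  next
    case True
    have hom: "tens_hom (capelli_tensor d l2) q = pact rlap \<pi> q"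
      using capelli_tensor_hom[OF qh, of d l2] True by (simp add: \<pi>_def)
    have "{..<Suc (d div 2)} = insert l2 ?J" using l2d by auto
    then have "rpoly d (Suc (d div 2)) = [:- e l2, 1:] * (\<Prod>j\<in>?J. [:- e j, 1:])"
      unfolding rpoly_def e_def by (simp only:) (subst prod.insert, auto)
    \<comment> \<open>With the root \<open>e l2\<close> put back, the interpolation polynomial is a
      multiple of the annihilator.\<close>
    then have kill: "[:- e l2, 1:] * \<pi> = smult (1 / (\<Prod>j\<in>?J. e l2 - e j)) (rpoly d (Suc (d div 2)))"
      unfolding \<pi> by (simp only: mult_smult_right)
    have "pact rlap (rpoly d (Suc (d div 2))) q = 0"
      using qh True by (intro rlap_annihilator[of q d]) auto
    then have ann: "pact rlap ([:- e l2, 1:] * \<pi>) q = 0"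
      unfolding kill pact_smult by simp
    have N': "pact rlap ([:- e b, 1:] ^ N) q = 0" using N True by (simp add: e_def)
    show ?thesis
    proof (cases "b = l2")
      case b: True
      then have "\<mu> = (l1, l2)" using True by (simp add: ab d_def)
      have \<pi>1: "poly \<pi> (e l2) = 1"
        unfolding \<pi> using e_ne[THEN not_sym] by (auto simp: poly_prod)
      \<comment> \<open>Here the simplicity of the root is used: \<pi> is 1 at \<open>e l2\<close>,
        so it acts injectively on generalized eigenvectors, and \<open>rlap\<close> has no nilpotent
        part on this module.\<close>
      have "pact rlap [:- e l2, 1:] q = 0"
      proof (rule pact_cancel[OF slinear_rlap])
        show "poly \<pi> (e l2) \<noteq> 0" using \<pi>1 by simp
        show "pact rlap \<pi> (pact rlap [:- e l2, 1:] q) = 0"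
          using ann by (simp only: pact_mult[OF slinear_rlap] pact_commute_pact[OF slinear_rlap, of \<pi>])
        show "pact rlap ([:- e l2, 1:] ^ N) (pact rlap [:- e l2, 1:] q) = 0"
          using N' b by (simp only: pact_commute_pact[OF slinear_rlap, of "_ ^ N"]
              slinear_zero[OF slinear_pact[OF slinear_rlap]])
      qed
      then have "rlap q = spscale (e l2) q" by simp
      then have "pact rlap \<pi> q = q"
        using pact_eigen[OF slinear_rlap, of q "e l2" \<pi>] \<pi>1 by simp
      then show ?thesis using hom \<open>\<mu> = (l1, l2)\<close> by (simp add: d_def)
    next
      case False
      have "b \<le> d div 2" using ba True by auto
      then have "poly [:- e l2, 1:] (e b) \<noteq> 0" using e_ne[of b] False by simp
      \<comment> \<open>The image under \<pi> is killed by \<open>rlap - e l2\<close> but is a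
        generalized eigenvector for another eigenvalue.\<close>
      then have "pact rlap \<pi> q = 0"
      proof (rule pact_cancel[OF slinear_rlap])
        show "pact rlap [:- e l2, 1:] (pact rlap \<pi> q) = 0"
          using ann by (simp only: pact_mult[OF slinear_rlap])
        show "pact rlap ([:- e b, 1:] ^ N) (pact rlap \<pi> q) = 0"
          using N' by (simp only: pact_commute_pact[OF slinear_rlap, of _ \<pi>]
              slinear_zero[OF slinear_pact[OF slinear_rlap]])
      qed
      moreover have "\<mu> \<noteq> (l1, l2)" using False by (simp add: ab)
      ultimately show ?thesis using hom by (simp add: d_def)
    qed
  qed
qed

section \<open>Invariance and uniqueness of the Capelli operator\<close>

lemma parity_rsq: "parity_op (rsq q) = rsq (parity_op q)"
proof -
  have "spscale (\<omega> v u) (parity_op (xop u (xop v q))) = spscale (\<omega> v u) (xop u (xop v (parity_op q)))" for u v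
    using form_parity[of v u] by (cases "is_odd u = is_odd v") (auto simp: parity_xop spmult_simps)
  then have *: "parity_op (spscale (\<omega> v u) (xop u (xop v q))) = spscale (\<omega> v u) (xop u (xop v (parity_op q)))" for u v
    by (simp only: slinear_scale[OF slinear_parity])
  show ?thesis unfolding rsq_def slinear_sum[OF slinear_parity] * ..
qed

lemma parity_lap: "parity_op (lap q) = lap (parity_op q)"
proof -
  have "spscale (h u v) (parity_op (spartial u (spartial v q))) = spscale (h u v) (spartial u (spartial v (parity_op q)))" for u v
    using inverse_parity[of u v] by (cases "is_odd u = is_odd v") (auto simp: parity_spartial spartial_simps)
  then have *: "parity_op (spscale (h u v) (spartial u (spartial v q))) = spscale (h u v) (spartial u (spartial v (parity_op q)))" for u v
    by (simp only: slinear_scale[OF slinear_parity])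
  show ?thesis unfolding lap_def slinear_sum[OF slinear_parity] * ..
qed

text \<open>In each degree the operator is a combination of the R^i Delta^i with coefficients
  depending on the degree, whence the condition \<open>hom\<close>.\<close>

lemma commutes_with_capelli_tensor:
  assumes A: "slinear A" and hom: "\<And>q d. q \<in> homog d \<Longrightarrow> A q \<in> homog d"
    and rsq: "\<And>q. A (rsq q) = rsq (A q)" and lap: "\<And>q. A (lap q) = lap (A q)"
  shows "A (tens_op (capelli_tensor d b) q) = tens_op (capelli_tensor d b) (A q)"
proof (rule slinear_ext[of "\<lambda>q. A (tens_op (capelli_tensor d b) q)" "\<lambda>q. tens_op (capelli_tensor d b) (A q)"])
  fix m :: "('i, 'j) smonom"
  let ?q = "Poly_Mapping.single m 1 :: ('i, 'j) spoly"
  have q: "?q \<in> homog (smonom_deg m)" by (simp add: homog_single)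
  have "A ((rsq ^^ i) p) = (rsq ^^ i) (A p)" "A ((lap ^^ i) p) = (lap ^^ i) (A p)" for i p
    by (induction i) (simp_all add: rsq lap)
  then show "A (tens_op (capelli_tensor d b) ?q) = tens_op (capelli_tensor d b) (A ?q)"
    unfolding capelli_tensor_op[OF q] capelli_tensor_op[OF hom[OF q]]
    by (simp only: slinear_sum[OF A] slinear_scale[OF A])
next
  note T = slinear_tens_op[OF capelli_tensor_tensors[of d b]]
  show "slinear (\<lambda>q. A (tens_op (capelli_tensor d b) q))" by (rule slinear_compose[OF A T])
  show "slinear (\<lambda>q. tens_op (capelli_tensor d b) (A q))" by (rule slinear_compose[OF T A])
qed

lemma gl_act_homog:
  assumes "q \<in> homog d"
  shows "gl_act X q \<in> homog d"
proof -
  have "xop v (spartial u q) \<in> homog d" for u v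
  proof (cases d)
    case 0
    then show ?thesis using spartial_homog_0[of q u] assms by (simp add: spmult_simps)
  next
    case (Suc d')
    then show ?thesis using xop_homog[OF spartial_homog[OF assms], of v u] by simp
  qed
  then have "(\<Sum>u\<in>UNIV. \<Sum>v\<in>UNIV. spscale (gsign u v * X u v) (xop v (spartial u q))) \<in> homog d"
    by (intro homog_sum homog_spscale)
  from homog_spscale[OF this, of "-1"] show ?thesis unfolding gl_act_eq by simp
qed

lemma gl_act_combination:
  "gl_act (\<lambda>u v. X u v + c * (if u = v then -1 else 0)) q = gl_act X q + spscale c (euler q)"
proof -
  have "spscale (gsign u v * (X u v + c * (if u = v then -1 else 0))) (xop v (spartial u q)) =
      spscale (gsign u v * X u v) (xop v (spartial u q)) - (if v = u then spscale c (xop v (spartial v q)) else 0)" for u v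
    by (auto simp: sp.scale_right_diff_distrib sp.scale_left_diff_distrib sp.scale_left_distrib gsign_def
        algebra_simps)
  then show ?thesis
    unfolding gl_act_eq by (simp add: sum_subtractf euler_def sp.scale_sum_right)
qed

lemma op_part_sum: "slinear A \<Longrightarrow> op_part False A q + op_part True A q = A q"
  unfolding op_part_def by (rule poly_mapping_eqI) (simp add: lookup_add algebra_simps)

text \<open>An operator commuting with parity has no odd part, so the supercommutator collapses to
  the commutator.\<close>

lemma supercomm_even:
  assumes A: "slinear A" and D: "slinear D"
    and par: "\<And>q. parity_op (D q) = D (parity_op q)" and comm: "\<And>q. A (D q) = D (A q)"
  shows "supercomm A D = (\<lambda>_. 0)"
proof
  fix q
  have "op_part True D p = 0" for p
    unfolding op_part_def by (simp add: par slinear_scale[OF D])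
  moreover have "op_part False D p = D p" for p
    unfolding op_part_def by (simp add: par flip: spscale_two)
  moreover have "op_part a A 0 = 0" for a
    unfolding op_part_def by (simp add: slinear_zero[OF A] slinear_zero[OF slinear_parity])
  ultimately have "supercomm A D q = op_part False A (D q) + op_part True A (D q)
      - D (op_part False A q + op_part True A q)"
    by (simp add: supercomm_def UNIV_bool slinear_add[OF D] algebra_simps)
  then show "supercomm A D q = 0" by (simp add: op_part_sum[OF A] comm)
qed

lemma capelli_tensor_invariant: "tens_op (capelli_tensor d b) \<in> PD_inv \<omega>"
proof -
  have "supercomm (gl_act Y) (tens_op (capelli_tensor d b)) = (\<lambda>_. 0)" if "Y \<in> gosp \<omega>" for Y
  proof (rule supercomm_even)
    show "slinear (tens_op (capelli_tensor d b))"
      by (rule slinear_tens_op[OF capelli_tensor_tensors])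
    show "parity_op (tens_op (capelli_tensor d b) q) = tens_op (capelli_tensor d b) (parity_op q)" for q
    proof (rule commutes_with_capelli_tensor)
      show "parity_op q \<in> homog d" if "q \<in> homog d" for q :: "('i, 'j) spoly" and d
        using that by (auto simp: homog_def in_keys_iff lookup_parity)
    qed (simp_all add: parity_rsq parity_lap)
    obtain X c where X: "skew X" and Y: "Y = (\<lambda>u v. X u v + c * (if u = v then -1 else 0))"
      using \<open>Y \<in> gosp \<omega>\<close> by (auto simp: gosp_def osp_iff)
    let ?T = "tens_op (capelli_tensor d b)"
    have "gl_act X (?T q) = ?T (gl_act X q)" for q
      by (rule commutes_with_capelli_tensor) (simp_all add: gl_act_homog gl_act_rsq[OF X] gl_act_lap[OF X])
    \<comment> \<open>The central element acts by E, which commutes with neither R nor Delta; here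
      it is the preservation of degree that counts.\<close>
    moreover have "euler (?T q) = ?T (euler q)" for q
    proof (rule slinear_ext[of "\<lambda>q. euler (?T q)" "\<lambda>q. ?T (euler q)"])
      fix m :: "('i, 'j) smonom"
      let ?q = "Poly_Mapping.single m 1 :: ('i, 'j) spoly"
      have q: "?q \<in> homog (smonom_deg m)" by (simp add: homog_single)
      have "?T ?q \<in> homog (smonom_deg m)"
        unfolding capelli_tensor_op_poly[OF q] using rlap_homog q by (rule pact_homog)
      then show "euler (?T ?q) = ?T (euler ?q)"
        using q by (simp add: euler_homog slinear_scale[OF slinear_tens_op[OF capelli_tensor_tensors]] del: spscale_single)
    next
      note T = slinear_tens_op[OF capelli_tensor_tensors[of d b]]
      show "slinear (\<lambda>q. euler (?T q))" by (rule slinear_compose[OF slinear_euler T])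
      show "slinear (\<lambda>q. ?T (euler q))" by (rule slinear_compose[OF T slinear_euler])
    qed
    ultimately show "gl_act Y (?T q) = ?T (gl_act Y q)" for q
      unfolding Y gl_act_combination
      by (simp add: slinear_simps[OF slinear_tens_op[OF capelli_tensor_tensors]])
  qed simp
  then show ?thesis
    unfolding PD_inv_def PD_def using capelli_tensor_tensors by auto
qed

text \<open>Uniqueness in two stages: the defining property fixes \<open>tens_hom\<close> because
  the modules span, and \<open>tens_hom\<close> fixes \<open>tens_op\<close>.\<close>

lemma capelli_eq:
  assumes "l2 \<le> l1" and "k_regular k (l1, l2)"
  shows "capelli \<omega> k (l1, l2) = tens_op (capelli_tensor (l1 + l2) l2)"
  unfolding capelli_def
proof (rule the_equality)
  show "tens_op (capelli_tensor (l1 + l2) l2) \<in> PD_inv \<omega> \<and>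
    (\<exists>ts\<in>tensors. tens_op (capelli_tensor (l1 + l2) l2) = tens_op ts \<and>
      (\<forall>\<mu>\<in>nonsingular2 k. \<forall>q\<in>Vmod \<omega> k \<mu>. tens_hom ts q = (if \<mu> = (l1, l2) then q else 0)))"
    by (intro conjI bexI[OF _ capelli_tensor_tensors[of "l1 + l2" l2]] capelli_tensor_invariant refl ballI
        capelli_tensor_projection[OF assms])
next
  fix D
  assume "D \<in> PD_inv \<omega> \<and> (\<exists>ts\<in>tensors. D = tens_op ts \<and>
      (\<forall>\<mu>\<in>nonsingular2 k. \<forall>q\<in>Vmod \<omega> k \<mu>. tens_hom ts q = (if \<mu> = (l1, l2) then q else 0)))"
  then obtain ts where ts: "ts \<in> tensors" "D = tens_op ts"
    "\<And>\<mu> q. \<mu> \<in> nonsingular2 k \<Longrightarrow> q \<in> Vmod \<omega> k \<mu> \<Longrightarrow> tens_hom ts q = (if \<mu> = (l1, l2) then q else 0)"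
    by blast
  have "tens_hom ts = tens_hom (capelli_tensor (l1 + l2) l2)"
    by (rule tens_hom_determined[OF ts(1) capelli_tensor_tensors])
      (subst ts(3), simp_all only: capelli_tensor_projection[OF assms])
  then show "D = tens_op (capelli_tensor (l1 + l2) l2)"
    unfolding ts(2) by (rule tens_op_determined[OF ts(1) capelli_tensor_tensors])
qed

end

section \<open>Eigenvectors\<close>

text \<open>Evaluation at an even point \<open>z\<close>, with values in the constant superpolynomials instead of the
  complex numbers, so that it is an operator to which \<open>slinear_ext\<close> applies.\<close>

definition body_eval :: "('i::finite + 'j \<Rightarrow> complex) \<Rightarrow> ('i, 'j::{finite,linorder}) sop" where
  "body_eval z p = (\<Sum>a\<in>Poly_Mapping.keys p. spscale (Poly_Mapping.lookup p a)
     (if snd a = {} then spscale (\<Prod>i\<in>UNIV. z (Inl i) ^ fst a i) spone else 0))"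

lemma slinear_body_eval [simp]: "slinear (body_eval z)"
  unfolding body_eval_def[abs_def] by (rule slinear_extension)

lemma body_eval_single: "body_eval z (Poly_Mapping.single (\<alpha>, S) 1) =
    (if S = {} then spscale (\<Prod>i\<in>UNIV. z (Inl i) ^ \<alpha> i) spone else 0)"
  by (simp add: body_eval_def)

lemma body_eval_xop:
  fixes p :: "('i::finite, 'j::{finite,linorder}) spoly"
  assumes "\<And>v. is_odd v \<Longrightarrow> z v = 0"
  shows "body_eval z (xop v p) = spscale (z v) (body_eval z p)"
proof (rule slinear_ext[of "\<lambda>p. body_eval z (xop v p)" "\<lambda>p. spscale (z v) (body_eval z p)"])
  show "slinear (\<lambda>p. body_eval z (xop v p))" by (rule slinear_compose) simp_all
  show "slinear (\<lambda>p. spscale (z v) (body_eval z p))" by simp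
  fix a :: "('i, 'j) smonom"
  obtain \<alpha> S where a: "a = (\<alpha>, S)" by (cases a)
  show "body_eval z (xop v (Poly_Mapping.single a 1)) = spscale (z v) (body_eval z (Poly_Mapping.single a 1))"
  proof (cases v)
    case (Inl i)
    have "(\<Prod>k\<in>UNIV. z (Inl k) ^ (\<alpha>(i := Suc (\<alpha> i))) k) = z (Inl i) * (\<Prod>k\<in>UNIV. z (Inl k) ^ \<alpha> k)"
      by (simp add: prod.remove[of UNIV i])
    then show ?thesis by (simp add: a Inl body_eval_single del: fun_upd_apply)
  next
    case (Inr j)
    have "body_eval z (Poly_Mapping.single (\<alpha>, insert j S) c) = 0" for c
      by (subst single_eq_spscale) (simp add: slinear_scale[OF slinear_body_eval] body_eval_single del: spscale_single)
    then show ?thesis using assms[of v] by (simp add: a Inr slinear_zero[OF slinear_body_eval])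
  qed
qed

context superform begin

text \<open>The index order is that of \<open>rsq\<close>, so that \<open>bform z z\<close> is the
  value of R at an even point \<open>z\<close>.\<close>

definition bform :: "('i + 'j \<Rightarrow> complex) \<Rightarrow> ('i + 'j \<Rightarrow> complex) \<Rightarrow> complex" where
  "bform x y = (\<Sum>u\<in>UNIV. \<Sum>v\<in>UNIV. \<omega> v u * x u * y v)"

lemma bform_left: "bform (\<lambda>v. x v + t * y v) z = bform x z + t * bform y z"
  by (simp add: bform_def algebra_simps sum.distrib sum_distrib_left)

lemma bform_right: "bform z (\<lambda>v. x v + t * y v) = bform z x + t * bform z y"
  by (simp add: bform_def algebra_simps sum.distrib sum_distrib_left)

lemma bform_commute:
  assumes "\<And>v. is_odd v \<Longrightarrow> x v = 0"
  shows "bform x y = bform y x"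
proof -
  have "bform x y = (\<Sum>v\<in>UNIV. \<Sum>u\<in>UNIV. \<omega> v u * x u * y v)"
    unfolding bform_def by (rule sum.swap)
  also have "\<dots> = bform y x"
    unfolding bform_def
  proof (intro sum.cong refl)
    fix u v
    show "\<omega> v u * x u * y v = \<omega> u v * y v * x u"
      using form_sym[of v u] assms[of u] by (cases "is_odd u") (auto simp: ssign_def)
  qed
  finally show ?thesis .
qed

definition covector :: "('i + 'j \<Rightarrow> complex) \<Rightarrow> 'i + 'j \<Rightarrow> complex" where
  "covector w v = (\<Sum>u\<in>UNIV. \<omega> v u * w u)"

lemma sum_covector: "(\<Sum>v\<in>UNIV. covector w v * z v) = bform w z"
proof -
  have "(\<Sum>v\<in>UNIV. covector w v * z v) = (\<Sum>v\<in>UNIV. \<Sum>u\<in>UNIV. \<omega> v u * w u * z v)"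
    by (simp add: covector_def sum_distrib_right)
  also have "\<dots> = bform w z" unfolding bform_def by (rule sum.swap)
  finally show ?thesis .
qed

lemma inverse_covector: "(\<Sum>v\<in>UNIV. h p v * covector w v) = w p"
proof -
  have "(\<Sum>v\<in>UNIV. h p v * covector w v) = (\<Sum>v\<in>UNIV. \<Sum>u\<in>UNIV. (h p v * \<omega> v u) * w u)"
    by (simp add: covector_def sum_distrib_left mult.assoc)
  also have "\<dots> = (\<Sum>u\<in>UNIV. (\<Sum>v\<in>UNIV. h p v * \<omega> v u) * w u)"
    by (subst sum.swap) (simp add: sum_distrib_right)
  also have "\<dots> = w p"
    by (simp add: inverse_form if_distrib[of "\<lambda>c. c * _"] cong: if_cong)
  finally show ?thesis .
qed

text \<open>Isotropy of \<open>w\<close> makes the powers of its linear form harmonic. At the point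
  \<open>z\<close> neither that linear form nor R vanishes, which will show the eigenvector to be
  non-zero.\<close>

lemma isotropic_exists:
  assumes "CARD('i) \<ge> 2"
  obtains w z where "\<And>v. is_odd v \<Longrightarrow> w v = 0" and "\<And>v. is_odd v \<Longrightarrow> z v = 0"
    and "bform w w = 0" and "bform w z \<noteq> 0" and "bform z z \<noteq> 0"
proof -
  obtain i j :: 'i where ij: "i \<noteq> j"
    using assms card_le_Suc0_iff_eq[of "UNIV :: 'i set"] by auto
  define e :: "'i \<Rightarrow> 'i + 'j \<Rightarrow> complex" where "e = (\<lambda>i v. if v = Inl i then 1 else 0)"
  have e_odd: "e i v = 0" if "is_odd v" for i v using that by (auto simp: e_def)
  obtain w where w: "\<And>v. is_odd v \<Longrightarrow> w v = 0" "bform w w = 0" "w \<noteq> (\<lambda>_. 0)"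
  proof (cases "bform (e j) (e j) = 0")
    case True
    have "e j (Inl j) \<noteq> 0" by (simp add: e_def)
    then have "e j \<noteq> (\<lambda>_. 0)" by auto
    then show ?thesis by (intro that[of "e j"] e_odd True)
  next
    case False
    define B where "B = bform (e i) (e j)"
    \<comment> \<open>A root of the quadratic polynomial bform (e_i + t e_j) (e_i + t e_j) in
      t.\<close>
    define t where "t = (- B + csqrt (B\<^sup>2 - bform (e i) (e i) * bform (e j) (e j))) / bform (e j) (e j)"
    define w where "w = (\<lambda>v. e i v + t * e j v)"
    have B': "bform (e j) (e i) = B" unfolding B_def by (rule bform_commute[OF e_odd])
    have "bform w w = bform (e i) (e i) + 2 * t * B + t\<^sup>2 * bform (e j) (e j)"
      unfolding w_def bform_left bform_right B' B_def[symmetric] by (simp add: algebra_simps power2_eq_square)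
    also have "\<dots> = 0"
    proof -
      have tB: "t * bform (e j) (e j) + B = csqrt (B\<^sup>2 - bform (e i) (e i) * bform (e j) (e j))"
        using False by (simp add: t_def)
      have "(bform (e i) (e i) + 2 * t * B + t\<^sup>2 * bform (e j) (e j)) * bform (e j) (e j) =
          (t * bform (e j) (e j) + B)\<^sup>2 - (B\<^sup>2 - bform (e i) (e i) * bform (e j) (e j))"
        by (simp add: power2_eq_square algebra_simps)
      also have "\<dots> = 0" unfolding tB by simp
      finally show ?thesis using False by simp
    qed
    finally have "bform w w = 0" .
    moreover have "w \<noteq> (\<lambda>_. 0)"
    proof
      assume "w = (\<lambda>_. 0)"
      then have "w (Inl i) = 0" by (rule arg_cong)
      moreover have "w (Inl i) = 1" using ij by (simp add: w_def e_def)
      ultimately show False by simp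
    qed
    moreover have "w v = 0" if "is_odd v" for v using e_odd[OF that] by (simp add: w_def)
    ultimately show ?thesis by (intro that[of w])
  qed
  have "\<exists>v. covector w v \<noteq> 0"
  proof (rule ccontr)
    assume "\<not> ?thesis"
    then have "w p = 0" for p using inverse_covector[of p w] by simp
    then show False using w(3) by (simp add: fun_eq_iff)
  qed
  then obtain v where v: "covector w v \<noteq> 0" by blast
  have "\<not> is_odd v"
  proof
    assume "is_odd v"
    then have *: "\<omega> v u * w u = 0" for u using form_parity[of v u] w(1)[of u] by (cases "is_odd u") auto
    show False using v unfolding covector_def * by simp
  qed
  then obtain m where m: "v = Inl m" by (cases v) auto
  have wz: "bform w (e m) \<noteq> 0"
    using v unfolding sum_covector[symmetric] by (simp add: e_def m if_distrib[of "\<lambda>c. _ * c"] cong: if_cong)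
  show thesis
  proof (cases "bform (e m) (e m) = 0")
    case False
    show ?thesis by (rule that[of w "e m"]) (simp_all add: w e_odd wz False)
  next
    case True
    \<comment> \<open>Here \<open>e m\<close> is isotropic too. Adding \<open>w\<close> keeps the
      pairing with \<open>w\<close> and produces the norm 2 bform w (e m).\<close>
    define z where "z = (\<lambda>v. e m v + 1 * w v)"
    have "bform w z = bform w (e m)" unfolding z_def bform_right using w(2) by simp
    moreover have "bform z z = 2 * bform w (e m)"
      unfolding z_def bform_left bform_right using w(2) True bform_commute[OF w(1), where y = "e m"] by simp
    moreover have "z v = 0" if "is_odd v" for v using e_odd[OF that] w(1)[OF that] by (simp add: z_def)
    ultimately show ?thesis by (intro that[of w z]) (simp_all add: w wz)
  qed
qed

definition linform :: "('i + 'j \<Rightarrow> complex) \<Rightarrow> ('i, 'j) sop" where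
  "linform w p = (\<Sum>v\<in>UNIV. spscale (covector w v) (xop v p))"

definition dirder :: "('i + 'j \<Rightarrow> complex) \<Rightarrow> ('i, 'j) sop" where
  "dirder w p = (\<Sum>u\<in>UNIV. spscale (w u) (spartial u p))"

lemma slinear_linform [simp]: "slinear (linform w)" and slinear_dirder [simp]: "slinear (dirder w)"
  unfolding linform_def[abs_def] dirder_def[abs_def] by simp_all

lemma lap_linform: "lap (linform w p) = spscale 2 (dirder w p) + linform w (lap p)"
proof -
  have "(\<Sum>v\<in>UNIV. spscale (covector w v) (grad v p)) = (\<Sum>v\<in>UNIV. \<Sum>u\<in>UNIV. spscale (h u v * covector w v) (spartial u p))"
    by (simp add: grad_def sp.scale_sum_right mult.commute)
  also have "\<dots> = (\<Sum>u\<in>UNIV. spscale (\<Sum>v\<in>UNIV. h u v * covector w v) (spartial u p))"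
    by (subst sum.swap) (simp add: sp.scale_sum_left)
  finally have *: "(\<Sum>v\<in>UNIV. spscale (covector w v) (grad v p)) = dirder w p"
    by (simp add: inverse_covector dirder_def)
  have "lap (linform w p) = (\<Sum>v\<in>UNIV. spscale 2 (spscale (covector w v) (grad v p)) + spscale (covector w v) (xop v (lap p)))"
    unfolding linform_def slinear_sum[OF slinear_lap] slinear_scale[OF slinear_lap] lap_xop
    by (simp add: sp.scale_right_distrib mult.commute)
  then show ?thesis
    unfolding sum.distrib sp.scale_sum_right[symmetric] * linform_def .
qed

text \<open>Evenness of \<open>w\<close> removes all signs. For isotropic \<open>w\<close> the two
  operators commute, which keeps the powers of the linear form harmonic.\<close>

lemma dirder_linform:
  assumes "\<And>v. is_odd v \<Longrightarrow> w v = 0"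
  shows "dirder w (linform w p) = spscale (bform w w) p + linform w (dirder w p)"
proof -
  have *: "spscale (w u) (spscale (covector w v) (spartial u (xop v p))) =
      (if u = v then spscale (covector w v * w v) p else 0) +
      spscale (covector w v) (spscale (w u) (xop v (spartial u p)))" for u v
    using assms[of u] by (cases "is_odd u") (auto simp: spartial_xop sp.scale_right_distrib ssign_def mult.commute)
  have "dirder w (linform w p) = (\<Sum>u\<in>UNIV. \<Sum>v\<in>UNIV. spscale (w u) (spscale (covector w v) (spartial u (xop v p))))"
    unfolding linform_def dirder_def spartial_simps sp.scale_sum_right ..
  also have "\<dots> = (\<Sum>v\<in>UNIV. spscale (covector w v * w v) p) +
     (\<Sum>u\<in>UNIV. \<Sum>v\<in>UNIV. spscale (covector w v) (spscale (w u) (xop v (spartial u p))))"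
    unfolding * by (simp add: sum.distrib)
  also have "(\<Sum>v\<in>UNIV. spscale (covector w v * w v) p) = spscale (bform w w) p"
    by (simp only: sum_covector[symmetric] sp.scale_sum_left)
  also have "(\<Sum>u\<in>UNIV. \<Sum>v\<in>UNIV. spscale (covector w v) (spscale (w u) (xop v (spartial u p)))) = linform w (dirder w p)"
    by (subst sum.swap) (simp only: linform_def dirder_def spmult_simps sp.scale_sum_right)
  finally show ?thesis .
qed

lemma linform_homog: "p \<in> homog d \<Longrightarrow> linform w p \<in> homog (Suc d)"
  unfolding linform_def by (intro homog_sum homog_spscale xop_homog)

lemma spartial_spone: "spartial v spone = 0"
  by (cases v) simp_all

text \<open>The vector is R^b times the a-th power of the linear form of an isotropic
  \<open>w\<close>. It is non-zero because its value at \<open>z\<close> is (bform z z)^b (bform w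
  z)^a.\<close>

lemma rlap_eigenvector_exists:
  assumes "CARD('i) \<ge> 2"
  shows "\<exists>u. u \<noteq> 0 \<and> u \<in> homog (a + 2 * b) \<and> rlap u = spscale (tev (a + 2 * b) b) u"
proof -
  obtain w z where w: "\<And>v. is_odd v \<Longrightarrow> w v = 0" and z: "\<And>v. is_odd v \<Longrightarrow> z v = 0"
    and ww: "bform w w = 0" and wz: "bform w z \<noteq> 0" and zz: "bform z z \<noteq> 0"
    using isotropic_exists[OF assms] by blast
  define f where "f = (linform w ^^ a) spone"
  have f: "f \<in> homog a"
    unfolding f_def by (induction a) (auto simp: smonom_deg_def intro: homog_single linform_homog)
  have dir: "dirder w ((linform w ^^ n) spone) = 0" for n
  proof (induction n)
    case 0
    then show ?case by (simp add: dirder_def spartial_spone del: spartial_single)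
  next
    case (Suc n)
    then show ?case by (simp add: dirder_linform[OF w] ww slinear_zero[OF slinear_linform])
  qed
  have "lap ((linform w ^^ n) spone) = 0" for n
  proof (induction n)
    case 0
    then show ?case by (simp add: lap_def spartial_spone spartial_simps del: spartial_single)
  next
    case (Suc n)
    then show ?case by (simp add: lap_linform dir slinear_zero[OF slinear_linform])
  qed
  then have lap: "lap f = 0" by (simp add: f_def)
  have ev_xop: "body_eval z (xop v p) = spscale (z v) (body_eval z p)" for v p
    using z by (rule body_eval_xop)
  have "body_eval z (linform w p) = spscale (bform w z) (body_eval z p)" for p
    unfolding linform_def slinear_sum[OF slinear_body_eval] slinear_scale[OF slinear_body_eval]
      ev_xop sum_covector[symmetric] sp.scale_sum_left sp.scale_scale ..
  then have "body_eval z ((linform w ^^ n) spone) = spscale (bform w z ^ n) spone" for n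
    by (induction n) (simp_all add: body_eval_single)
  then have ev_f: "body_eval z f = spscale (bform w z ^ a) spone" by (simp add: f_def)
  have "body_eval z (rsq p) = spscale (bform z z) (body_eval z p)" for p
    unfolding rsq_def slinear_sum[OF slinear_body_eval] slinear_scale[OF slinear_body_eval]
      ev_xop bform_def sp.scale_sum_left sp.scale_scale mult.assoc ..
  then have "body_eval z ((rsq ^^ n) f) = spscale (bform z z ^ n * bform w z ^ a) spone" for n
    by (induction n) (simp_all add: ev_f mult_ac del: spscale_single)
  moreover have "spone \<noteq> (0 :: ('i, 'j) spoly)" by (metis lookup_single_eq lookup_zero one_neq_zero)
  ultimately have "body_eval z ((rsq ^^ b) f) \<noteq> 0"
    using wz zz by (simp del: spscale_single)
  then have "(rsq ^^ b) f \<noteq> 0"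
    using slinear_zero[OF slinear_body_eval, of z] by auto
  then show ?thesis
    using rsq_funpow_homog[OF f] rlap_rsq_funpow_harmonic[OF f lap] by blast
qed

lemma eigenvalues_on_Vmod:
  assumes "CARD('i) \<ge> 2" and "b \<le> a"
    and D: "\<And>q. q \<in> homog (a + b) \<Longrightarrow> D q = pact rlap P q"
  shows "{c. \<exists>q\<in>Vmod \<omega> k (a, b). q \<noteq> 0 \<and> D q = spscale c q} = {poly P (tev (a + b) b)}"
proof (intro equalityI subsetI)
  fix c assume "c \<in> {c. \<exists>q\<in>Vmod \<omega> k (a, b). q \<noteq> 0 \<and> D q = spscale c q}"
  then obtain q N where q: "q \<in> homog (a + b)" "pact rlap ([:- tev (a + b) b, 1:] ^ N) q = 0"
    "q \<noteq> 0" "D q = spscale c q"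
    by (auto simp: Vmod_eq[OF assms(2)])
  \<comment> \<open>If P - c did not vanish at the generalized eigenvalue, it would act injectively
    and \<open>q\<close> would be zero.\<close>
  have "pact rlap (P - [:c:]) q = 0"
    using q D by (simp add: pact_diff)
  then have "poly (P - [:c:]) (tev (a + b) b) = 0"
    using pact_cancel[OF slinear_rlap _ _ q(2)] q(3) by blast
  then show "c \<in> {poly P (tev (a + b) b)}" by simp
next
  fix c assume "c \<in> {poly P (tev (a + b) b)}"
  then have c: "c = poly P (tev (a + b) b)" by simp
  have ab: "a - b + 2 * b = a + b" using assms(2) by simp
  obtain u where u: "u \<noteq> 0" "u \<in> homog (a + b)" "rlap u = spscale (tev (a + b) b) u"
    using rlap_eigenvector_exists[OF assms(1), of "a - b" b] unfolding ab by blast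
  have "pact rlap ([:- tev (a + b) b, 1:] ^ 1) u = 0" using u(3) by simp
  then have "u \<in> Vmod \<omega> k (a, b)" using u(2) unfolding Vmod_eq[OF assms(2)] by blast
  moreover have "D u = spscale c u"
    using D[OF u(2)] pact_eigen[OF slinear_rlap u(3)] c by simp
  ultimately show "c \<in> {c. \<exists>q\<in>Vmod \<omega> k (a, b). q \<noteq> 0 \<and> D q = spscale c q}"
    using u(1) by blast
qed

end

section \<open>Falling factorials and Knop--Sahi polynomials\<close>

lemma falling_0 [simp]: "falling x 0 = 1"
  by (simp add: falling_def)

lemma falling_Suc: "falling x (Suc n) = falling x n * (x - of_nat n)"
  by (simp add: falling_def)

lemma falling_add: "falling x (m + n) = falling x m * falling (x - of_nat m) n"
  by (induction n) (simp_all add: falling_Suc mult.assoc diff_diff_eq)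

lemma falling_Vandermonde:
  fixes x y :: "'a::comm_ring_1"
  shows "falling (x + y) n = (\<Sum>k\<le>n. of_nat (n choose k) * falling x k * falling y (n - k))"
proof (induction n)
  case (Suc n)
  have "falling (x + y) (Suc n) = (\<Sum>k\<le>n. of_nat (n choose k) * falling x k * falling y (n - k) * (x + y - of_nat n))"
    by (simp add: falling_Suc Suc sum_distrib_right)
  also have "\<dots> = (\<Sum>k\<le>n. of_nat (n choose k) * falling x (Suc k) * falling y (n - k) +
      of_nat (n choose k) * falling x k * falling y (Suc n - k))"
  proof (intro sum.cong refl)
    fix k assume "k \<in> {..n}"
    then have k: "k \<le> n" by simp
    then have "x + y - of_nat n = (x - of_nat k) + (y - of_nat (n - k))" by (simp add: of_nat_diff)
    then show "of_nat (n choose k) * falling x k * falling y (n - k) * (x + y - of_nat n) =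
        of_nat (n choose k) * falling x (Suc k) * falling y (n - k) +
        of_nat (n choose k) * falling x k * falling y (Suc n - k)"
      using k by (simp add: falling_Suc Suc_diff_le algebra_simps)
  qed
  also have "\<dots> = (\<Sum>k\<le>n. of_nat (n choose k) * falling x (Suc k) * falling y (Suc n - Suc k)) +
      (\<Sum>k\<le>Suc n. of_nat (n choose k) * falling x k * falling y (Suc n - k))"
    by (simp add: sum.distrib binomial_eq_0)
  also have "\<dots> = falling y (Suc n) + (\<Sum>k\<le>n. of_nat (n choose k) * falling x (Suc k) * falling y (Suc n - Suc k)) +
      (\<Sum>k\<le>n. of_nat (n choose Suc k) * falling x (Suc k) * falling y (Suc n - Suc k))"
    by (subst sum.atMost_Suc_shift) simp
  also have "\<dots> = (\<Sum>k\<le>Suc n. of_nat (Suc n choose k) * falling x k * falling y (Suc n - k))"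
    by (subst sum.atMost_Suc_shift) (simp add: sum.distrib algebra_simps)
  finally show ?case .
qed simp

lemma falling_of_nat:
  assumes "s \<le> q"
  shows "falling (of_nat q :: 'a::{field,semiring_char_0}) s * fact (q - s) = fact q"
  using assms
proof (induction s)
  case (Suc s)
  then have "fact (q - s) = (of_nat (q - s) :: 'a) * fact (q - Suc s)"
    by (metis Suc_diff_Suc Suc_le_lessD fact_Suc)
  then show ?case using Suc by (simp add: falling_Suc of_nat_diff mult_ac)
qed simp

lemma falling_of_nat_eq_0: "q < s \<Longrightarrow> falling (of_nat q :: 'a::comm_ring_1) s = 0"
  unfolding falling_def by (intro prod_zero) auto

text \<open>Multiplying the coefficient of the Knop--Sahi polynomial out with Vandermonde's identity
  cancels the denominator \<open>falling N a\<close>, which may vanish at \<open>N = k + 1\<close>.\<close>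

definition ks_coeff :: "nat \<Rightarrow> 'a::{field,semiring_char_0} \<Rightarrow> nat \<Rightarrow> nat \<Rightarrow> 'a" where
  "ks_coeff a N p q = fact a / (fact p * fact q * fact (a - p - q)) * falling N (a - p - q) *
     (\<Sum>s\<le>min p q. of_nat (p choose s) * falling (of_nat q) s / falling (N - of_nat a + of_nat s) s)"

text \<open>Over the common denominator \<open>falling (M + of_nat p) p\<close> this is
  Vandermonde's identity for the arguments q and M + p.\<close>

lemma ks_coeff_sum:
  fixes M :: "'a::{field,semiring_char_0}"
  assumes "\<And>i. i \<le> p \<Longrightarrow> falling (M + of_nat i) i \<noteq> 0"
  shows "(\<Sum>s\<le>min p q. of_nat (p choose s) * falling (of_nat q) s / falling (M + of_nat s) s) =
    falling (M + of_nat p + of_nat q) p / falling (M + of_nat p) p"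
proof -
  have "(\<Sum>s\<le>min p q. of_nat (p choose s) * falling (of_nat q) s / falling (M + of_nat s) s) =
     (\<Sum>s\<le>p. of_nat (p choose s) * falling (of_nat q) s / falling (M + of_nat s) s)"
    by (intro sum.mono_neutral_left) (auto simp: falling_of_nat_eq_0)
  also have "\<dots> = (\<Sum>s\<le>p. of_nat (p choose s) * falling (of_nat q) s * falling (M + of_nat p) (p - s) / falling (M + of_nat p) p)"
  proof (intro sum.cong refl)
    fix s assume "s \<in> {..p}"
    then have s: "s \<le> p" by simp
    then have "falling (M + of_nat p) p = falling (M + of_nat p) (p - s) * falling (M + of_nat s) s"
      using falling_add[of "M + of_nat p" "p - s" s] by (simp add: of_nat_diff algebra_simps)
    then show "of_nat (p choose s) * falling (of_nat q) s / falling (M + of_nat s) s =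
        of_nat (p choose s) * falling (of_nat q) s * falling (M + of_nat p) (p - s) / falling (M + of_nat p) p"
      using assms[of p] assms[OF s] by (simp add: field_simps)
  qed
  also have "\<dots> = falling (of_nat q + (M + of_nat p)) p / falling (M + of_nat p) p"
    by (simp add: falling_Vandermonde sum_divide_distrib)
  finally show ?thesis by (simp add: add_ac)
qed

text \<open>The hypothesis on \<open>N\<close> holds for the indeterminate N = kappa + 1. The
  right-hand side remains meaningful at kappa = k for regular partitions, where the left-hand side
  may not.\<close>

lemma ks_coeff_eq:
  fixes N :: "'a::{field,semiring_char_0}"
  assumes pq: "p + q \<le> a" and N: "falling N a \<noteq> 0"
  shows "fact a * falling N (a - p) * falling N (a - q) / (fact p * fact q * fact (a - p - q) * falling N a) =
    ks_coeff a N p q"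
proof -
  have nz: "falling (N - of_nat a + of_nat i) i \<noteq> 0" if "i \<le> p" for i
  proof -
    have "i \<le> a" using that pq by simp
    then have "falling N a = falling N (a - i) * falling (N - of_nat a + of_nat i) i"
      using falling_add[of N "a - i" i] by (simp add: of_nat_diff algebra_simps)
    then show ?thesis using N by auto
  qed
  have 1: "falling N a = falling N (a - p) * falling (N - of_nat a + of_nat p) p"
    using falling_add[of N "a - p" p] pq by (simp add: of_nat_diff algebra_simps)
  have 2: "falling N (a - q) = falling N (a - p - q) * falling (N - of_nat a + of_nat p + of_nat q) p"
  proof -
    have "a - q = (a - p - q) + p" using pq by simp
    moreover have "N - of_nat (a - p - q) = N - of_nat a + of_nat p + of_nat q"
      using pq by (simp add: of_nat_diff algebra_simps)
    ultimately show ?thesis using falling_add[of N "a - p - q" p] by metis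
  qed
  have 3: "falling N (a - p) \<noteq> 0" using N 1 by auto
  have "(\<Sum>s\<le>min p q. of_nat (p choose s) * falling (of_nat q) s / falling (N - of_nat a + of_nat s) s) =
      falling (N - of_nat a + of_nat p + of_nat q) p / falling (N - of_nat a + of_nat p) p"
    by (rule ks_coeff_sum) (rule nz)
  then show ?thesis
    unfolding ks_coeff_def 1 2 using 3 nz[of p] by (simp add: mult_ac)
qed

text \<open>Vandermonde's identity twice, in the normalization by factorials that makes all
  coefficients 1.\<close>

lemma falling_trinomial:
  fixes x y z :: "'a::{field,semiring_char_0}"
  shows "falling (x + y + z) r / fact r = (\<Sum>(p, q) | p + q \<le> r.
    falling x p / fact p * (falling y q / fact q) * (falling z (r - p - q) / fact (r - p - q)))"
proof -
  have V: "falling (u + v) n / fact n = (\<Sum>k\<le>n. falling u k / fact k * (falling v (n - k) / fact (n - k)))"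
    for u v :: 'a and n
  proof -
    have "of_nat (n choose k) * falling u k * falling v (n - k) / fact n =
        falling u k / fact k * (falling v (n - k) / fact (n - k))" if "k \<le> n" for k
    proof -
      have "(of_nat (fact k * fact (n - k) * (n choose k)) :: 'a) = of_nat (fact n)"
        using binomial_fact_lemma[OF that] by simp
      then have "fact k * fact (n - k) * of_nat (n choose k) = (fact n :: 'a)" by simp
      then have "(of_nat (n choose k) :: 'a) / fact n = 1 / (fact k * fact (n - k))"
        by (metis (no_types, lifting) divide_eq_eq fact_nonzero mult.commute nonzero_divide_mult_cancel_right
            mult_eq_0_iff times_divide_eq_left mult_1)
      then show ?thesis by (simp add: field_simps)
    qed
    then show ?thesis by (simp add: falling_Vandermonde sum_divide_distrib)
  qed
  have "falling (x + y + z) r / fact r = (\<Sum>p\<le>r. \<Sum>q\<le>r - p.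
      falling x p / fact p * (falling y q / fact q) * (falling z (r - p - q) / fact (r - p - q)))"
    unfolding add.assoc V[of x] V[of y] by (simp add: sum_distrib_left mult.assoc)
  also have "\<dots> = (\<Sum>(p, q)\<in>(SIGMA p:{..r}. {..r - p}).
      falling x p / fact p * (falling y q / fact q) * (falling z (r - p - q) / fact (r - p - q)))"
    by (rule sum.Sigma) auto
  also have "(SIGMA p:{..r}. {..r - p}) = {(p, q). p + q \<le> r}" by auto
  finally show ?thesis .
qed

lemma finite_le_pairs [simp]: "finite {(p, q). p + q \<le> (r :: nat)}"
  by (rule finite_subset[of _ "{..r} \<times> {..r}"]) auto

text \<open>Summing over p and q first turns the double Knop-Sahi sum into a single sum over s,
  whose terms will match those of R^i Delta^i for i = l2 + s.\<close>

lemma ks_coeff_expansion: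
  fixes N X Y :: "'a::{field,semiring_char_0}"
  shows "(\<Sum>(p, q) | p + q \<le> a. ks_coeff a N p q * (falling X p * falling Y q)) =
    fact a * (\<Sum>s\<le>a div 2. falling (X + Y + N - 2 * of_nat s) (a - 2 * s) * (falling X s * falling Y s) /
      (fact (a - 2 * s) * fact s * falling (N - of_nat a + of_nat s) s))"
proof -
  \<comment> \<open>The s-th term after absorbing the binomial and the falling factorial of q into
    the factorials of p and q.\<close>
  define F where "F s p q = fact a * (falling X p * falling Y q) * (falling N (a - p - q) / fact (a - p - q)) /
     (fact (p - s) * fact (q - s) * fact s * falling (N - of_nat a + of_nat s) s)" for s p q
  have "ks_coeff a N p q * (falling X p * falling Y q) = (\<Sum>s\<le>min p q. F s p q)" for p q
  proof -
    have "fact a / (fact p * fact q * fact (a - p - q)) * falling N (a - p - q) *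
        (of_nat (p choose s) * falling (of_nat q) s / falling (N - of_nat a + of_nat s) s) *
        (falling X p * falling Y q) = F s p q" if "s \<le> min p q" for s
    proof -
      have sp: "s \<le> p" and sq: "s \<le> q" using that by simp_all
      have "(of_nat (fact s * fact (p - s) * (p choose s)) :: 'a) = of_nat (fact p)"
        using binomial_fact_lemma[OF sp] by simp
      then have p: "(fact p :: 'a) = fact s * fact (p - s) * of_nat (p choose s)" by simp
      have pc: "of_nat (p choose s) \<noteq> (0 :: 'a)" using sp by simp
      have qf: "(fact q :: 'a) = falling (of_nat q) s * fact (q - s)" by (rule falling_of_nat[OF sq, symmetric])
      have qn: "falling (of_nat q :: 'a) s \<noteq> 0"
        using falling_of_nat[OF sq, where 'a = 'a] fact_nonzero[of q, where 'a = 'a] by auto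
      show ?thesis unfolding F_def p qf using pc qn by (simp add: mult_ac)
    qed
    then show ?thesis
      unfolding ks_coeff_def sum_distrib_left sum_distrib_right by (intro sum.cong) auto
  qed
  then have "(\<Sum>(p, q) | p + q \<le> a. ks_coeff a N p q * (falling X p * falling Y q)) =
     (\<Sum>x\<in>{(p, q). p + q \<le> a}. \<Sum>s\<le>min (fst x) (snd x). F s (fst x) (snd x))"
    by (intro sum.cong) auto
  also have "\<dots> = (\<Sum>(x, s)\<in>(SIGMA x:{(p, q). p + q \<le> a}. {..min (fst x) (snd x)}). F s (fst x) (snd x))"
    by (rule sum.Sigma) auto
  \<comment> \<open>Shifting both indices by s turns p + q <= a into p + q <= a - 2s, the range of
    \<open>falling_trinomial\<close>.\<close>
  also have "\<dots> = (\<Sum>(s, x)\<in>(SIGMA s:{..a div 2}. {(p, q). p + q \<le> a - 2 * s}). F s (fst x + s) (snd x + s))"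
    by (rule sum.reindex_bij_witness[of _ "\<lambda>(s, x). ((fst x + s, snd x + s), s)"
          "\<lambda>(x, s). (s, (fst x - s, snd x - s))"]) auto
  also have "\<dots> = (\<Sum>s\<le>a div 2. \<Sum>x\<in>{(p, q). p + q \<le> a - 2 * s}. F s (fst x + s) (snd x + s))"
    by (rule sum.Sigma[symmetric]) auto
  also have "\<dots> = (\<Sum>s\<le>a div 2. fact a * (falling (X + Y + N - 2 * of_nat s) (a - 2 * s) * (falling X s * falling Y s) /
      (fact (a - 2 * s) * fact s * falling (N - of_nat a + of_nat s) s)))"
  proof (intro sum.cong refl)
    fix s assume "s \<in> {..a div 2}"
    let ?c = "fact a * (falling X s * falling Y s) / (fact s * falling (N - of_nat a + of_nat s) s)"
    have "(\<Sum>x\<in>{(p, q). p + q \<le> a - 2 * s}. F s (fst x + s) (snd x + s)) =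
      (\<Sum>x\<in>{(p, q). p + q \<le> a - 2 * s}. ?c * (case x of (p, q) \<Rightarrow> falling (X - of_nat s) p / fact p *
        (falling (Y - of_nat s) q / fact q) * (falling N (a - 2 * s - p - q) / fact (a - 2 * s - p - q))))"
    proof (intro sum.cong refl)
      fix x :: "nat \<times> nat"
      obtain p q where x: "x = (p, q)" by (cases x)
      have "falling X (p + s) = falling X s * falling (X - of_nat s) p"
        "falling Y (q + s) = falling Y s * falling (Y - of_nat s) q"
        using falling_add[of X s p] falling_add[of Y s q] by (simp_all add: add.commute)
      moreover have "a - (p + s) - (q + s) = a - 2 * s - p - q" by simp
      ultimately show "F s (fst x + s) (snd x + s) = ?c * (case x of (p, q) \<Rightarrow> falling (X - of_nat s) p / fact p *
        (falling (Y - of_nat s) q / fact q) * (falling N (a - 2 * s - p - q) / fact (a - 2 * s - p - q)))"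
        unfolding F_def x by (simp add: mult_ac)
    qed
    also have "\<dots> = ?c * (falling ((X - of_nat s) + (Y - of_nat s) + N) (a - 2 * s) / fact (a - 2 * s))"
      unfolding falling_trinomial by (simp only: sum_distrib_left)
    also have "(X - of_nat s) + (Y - of_nat s) + N = X + Y + N - 2 * of_nat s" by simp
    finally show "(\<Sum>x\<in>{(p, q). p + q \<le> a - 2 * s}. F s (fst x + s) (snd x + s)) =
       fact a * (falling (X + Y + N - 2 * of_nat s) (a - 2 * s) * (falling X s * falling Y s) /
      (fact (a - 2 * s) * fact s * falling (N - of_nat a + of_nat s) s))"
      by (simp add: mult_ac)
  qed
  finally show ?thesis by (simp only: sum_distrib_left)
qed

section \<open>Specialization of rational functions at kappa = k\<close>

definition place_value :: "rat \<Rightarrow> rat poly fract \<Rightarrow> rat \<Rightarrow> bool" where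
  "place_value t r c \<longleftrightarrow> (\<exists>A B. poly B t \<noteq> 0 \<and> r = Fract A B \<and> c = poly A t / poly B t)"

lemma place_valueI: "poly B t \<noteq> 0 \<Longrightarrow> place_value t (Fract A B) (poly A t / poly B t)"
  by (auto simp: place_value_def)

lemma place_value_unique:
  assumes "place_value t r c" and "place_value t r c'"
  shows "c = c'"
proof -
  obtain A B A' B' where r: "poly B t \<noteq> 0" "r = Fract A B" "c = poly A t / poly B t"
    "poly B' t \<noteq> 0" "r = Fract A' B'" "c' = poly A' t / poly B' t"
    using assms unfolding place_value_def by (elim exE conjE)
  moreover from r have "B \<noteq> 0" "B' \<noteq> 0" by auto
  ultimately have "A * B' = A' * B" using eq_fract(1)[of B B' A A'] by simp
  then have "poly A t * poly B' t = poly A' t * poly B t" by (metis poly_mult)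
  then show ?thesis using r by (simp add: frac_eq_eq)
qed

lemma fract_eval_eq: "place_value t r c \<Longrightarrow> fract_eval t r = c"
  unfolding fract_eval_def place_value_def[symmetric]
  by (rule the_equality) (auto intro: place_value_unique)

lemma place_value_of_nat: "place_value t (of_nat n) (of_nat n)"
  using place_valueI[of 1 t "of_nat n"] by (simp add: of_nat_fract)

lemma place_value_add:
  assumes "place_value t r c" and "place_value t s d"
  shows "place_value t (r + s) (c + d)"
proof -
  obtain A B A' B' where r: "poly B t \<noteq> 0" "r = Fract A B" "c = poly A t / poly B t"
    "poly B' t \<noteq> 0" "s = Fract A' B'" "d = poly A' t / poly B' t"
    using assms by (auto simp: place_value_def)
  moreover from r have "B \<noteq> 0" "B' \<noteq> 0" by auto
  ultimately have "r + s = Fract (A * B' + A' * B) (B * B')" by simp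
  then show ?thesis using r place_valueI[of "B * B'" t "A * B' + A' * B"] by (simp add: add_frac_eq)
qed

lemma place_value_mult:
  assumes "place_value t r c" and "place_value t s d"
  shows "place_value t (r * s) (c * d)"
proof -
  obtain A B A' B' where r: "poly B t \<noteq> 0" "r = Fract A B" "c = poly A t / poly B t"
    "poly B' t \<noteq> 0" "s = Fract A' B'" "d = poly A' t / poly B' t"
    using assms by (auto simp: place_value_def)
  then show ?thesis using place_valueI[of "B * B'" t "A * A'"] by simp
qed

lemma place_value_minus:
  assumes "place_value t r c"
  shows "place_value t (- r) (- c)"
proof -
  obtain A B where r: "poly B t \<noteq> 0" "r = Fract A B" "c = poly A t / poly B t"
    using assms by (auto simp: place_value_def)
  then show ?thesis using place_valueI[of B t "- A"] by simp
qed

lemma place_value_diff: "place_value t r c \<Longrightarrow> place_value t s d \<Longrightarrow> place_value t (r - s) (c - d)"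
  using place_value_add[of t r c "- s" "- d"] place_value_minus[of t s d] by simp

text \<open>The only operation that could create a pole; regularity of the partition will supply the
  last hypothesis.\<close>

lemma place_value_divide:
  assumes "place_value t r c" and "place_value t s d" and "d \<noteq> 0"
  shows "place_value t (r / s) (c / d)"
proof -
  obtain A B where s: "poly B t \<noteq> 0" "s = Fract A B" "d = poly A t / poly B t"
    using assms(2) by (auto simp: place_value_def)
  have "place_value t (inverse s) (inverse d)"
    using place_valueI[of A t B] s assms(3) by auto
  from place_value_mult[OF assms(1) this] show ?thesis by (simp add: divide_inverse)
qed

lemma place_value_sum:
  "(\<And>x. x \<in> A \<Longrightarrow> place_value t (f x) (g x)) \<Longrightarrow> place_value t (\<Sum>x\<in>A. f x) (\<Sum>x\<in>A. g x)"
  using place_value_of_nat[of t 0]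
  by (induction A rule: infinite_finite_induct) (auto intro: place_value_add)

lemma place_value_falling: "place_value t x c \<Longrightarrow> place_value t (falling x n) (falling c n)"
proof (induction n)
  case 0
  then show ?case using place_value_of_nat[of t 1] by simp
next
  case (Suc n)
  then show ?case
    unfolding falling_Suc by (intro place_value_mult place_value_diff place_value_of_nat)
qed

lemma place_value_fact: "place_value t (fact n) (fact n)"
  using place_value_of_nat[of t "fact n"] by simp

lemma place_value_kappa: "place_value t (kappa + 1) (t + 1)"
  using place_value_add[OF place_valueI[of 1 t "[:0, 1:]"] place_value_of_nat[of t 1]]
  by (simp add: kappa_def)

text \<open>No factor is zero, because kappa + 1 - i takes the value 1 at kappa = i.\<close>

lemma falling_kappa_nonzero: "falling (kappa + 1) n \<noteq> 0"
proof -
  have "kappa + 1 - of_nat i \<noteq> 0" for i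
  proof
    assume 0: "kappa + 1 - of_nat i = 0"
    have "place_value (of_nat i) (kappa + 1 - of_nat i) (of_nat i + 1 - of_nat i)"
      by (intro place_value_diff place_value_kappa place_value_of_nat)
    then have "place_value (of_nat i) 0 1" unfolding 0 by simp
    moreover have "place_value (of_nat i) 0 0" using place_value_of_nat[of _ 0] by simp
    ultimately show False using place_value_unique by fastforce
  qed
  then show ?thesis unfolding falling_def by auto
qed

text \<open>A zero factor means a = k + 1 + (s - j) with a = l1 - l2 and 0 < s - j <= a/2. This
  forces k + 2 <= a <= 2k + 2, the singular range.\<close>

lemma regular_falling_nonzero:
  assumes "k_regular k (l1, l2)" and "l2 \<le> l1" and "2 * s \<le> l1 - l2"
  shows "falling (of_nat k + 1 - of_nat (l1 - l2) + of_nat s :: 'a::field_char_0) s \<noteq> 0"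
proof -
  have "of_nat k + 1 - of_nat (l1 - l2) + of_nat s - of_nat j \<noteq> (0 :: 'a)" if "j < s" for j
  proof
    assume "of_nat k + 1 - of_nat (l1 - l2) + of_nat s - of_nat j = (0 :: 'a)"
    then have "(of_nat (k + 1 + s) :: 'a) = of_nat (l1 - l2 + j)"
      by (simp add: algebra_simps)
    then have "k + 1 + s = l1 - l2 + j" by (simp only: of_nat_eq_iff)
    then show False using assms that by (auto simp: k_regular_def)
  qed
  then show ?thesis unfolding falling_def by auto
qed

lemma place_value_ks_coeff:
  assumes "k_regular k (l1, l2)" and "l2 \<le> l1" and pq: "p + q \<le> l1 - l2"
  shows "place_value (of_nat k) (ks_coeff (l1 - l2) (kappa + 1) p q) (ks_coeff (l1 - l2) (of_nat k + 1) p q)"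
  unfolding ks_coeff_def
proof (intro place_value_mult place_value_divide place_value_sum place_value_fact place_value_falling
    place_value_kappa place_value_of_nat place_value_add place_value_diff)
  fix s assume "s \<in> {..min p q}"
  then have "2 * s \<le> l1 - l2" using pq by simp
  then show "falling (of_nat k + 1 - of_nat (l1 - l2) + of_nat s :: rat) s \<noteq> 0"
    by (rule regular_falling_nonzero[OF assms(1,2)])
qed simp

lemma of_rat_falling: "of_rat (falling x n) = (falling (of_rat x) n :: 'a::field_char_0)"
  by (induction n) (simp_all add: falling_Suc of_rat_mult of_rat_diff)

lemma of_rat_fact: "of_rat (fact n) = (fact n :: 'a::field_char_0)"
  using of_rat_of_nat_eq[of "fact n", where 'a = 'a] by simp

lemma of_rat_ks_coeff: "of_rat (ks_coeff a N p q) = (ks_coeff a (of_rat N) p q :: 'a::field_char_0)"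
  by (simp add: ks_coeff_def of_rat_mult of_rat_divide of_rat_sum of_rat_falling of_rat_fact of_rat_add of_rat_diff)

text \<open>The product formula shows the symmetry over the field of rational functions in kappa,
  and specialization carries it to kappa = k.\<close>

lemma ks_coeff_symmetric:
  assumes "k_regular k (l1, l2)" and "l2 \<le> l1" and pq: "p + q \<le> l1 - l2"
  shows "ks_coeff (l1 - l2) (of_nat k + 1 :: complex) p q = ks_coeff (l1 - l2) (of_nat k + 1) q p"
proof -
  have "ks_coeff (l1 - l2) (kappa + 1) p q = ks_coeff (l1 - l2) (kappa + 1) q p"
  proof -
    have qp: "q + p \<le> l1 - l2" and sub: "l1 - l2 - q - p = l1 - l2 - p - q" using pq by simp_all
    show ?thesis
      unfolding ks_coeff_eq[OF pq falling_kappa_nonzero, symmetric] ks_coeff_eq[OF qp falling_kappa_nonzero, symmetric] sub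
      by (simp only: mult_ac)
  qed
  then have "ks_coeff (l1 - l2) (of_nat k + 1 :: rat) p q = ks_coeff (l1 - l2) (of_nat k + 1) q p"
    using place_value_ks_coeff[OF assms] place_value_ks_coeff[OF assms(1,2), of q p] pq place_value_unique
    by (metis add.commute)
  then have "(of_rat (ks_coeff (l1 - l2) (of_nat k + 1) p q) :: complex) = of_rat (ks_coeff (l1 - l2) (of_nat k + 1) q p)"
    by (rule arg_cong)
  then show ?thesis by (simp add: of_rat_ks_coeff of_rat_add)
qed

lemma coeff_falling_Suc:
  "coeff (falling [:0, 1 :: 'a::comm_ring_1:] (Suc n)) i =
    (case i of 0 \<Rightarrow> 0 | Suc i \<Rightarrow> coeff (falling [:0, 1:] n) i) - of_nat n * coeff (falling [:0, 1:] n) i"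
proof -
  have "falling [:0, 1 :: 'a:] (Suc n) = pCons 0 (falling [:0, 1:] n) - smult (of_nat n) (falling [:0, 1:] n)"
    by (simp add: falling_Suc right_diff_distrib of_nat_poly mult.commute[of "falling _ _"])
  then show ?thesis by (simp add: coeff_pCons)
qed

lemma coeff_falling_0: "coeff (falling [:0, 1 :: 'a::comm_ring_1:] 0) i = (if i = 0 then 1 else 0)"
  by simp

text \<open>The coefficients are integers, the signed Stirling numbers of the first kind, so
  specialization does not change them.\<close>

lemma place_value_coeff_falling:
  "place_value t (coeff (falling [:0, 1:] n) i) (coeff (falling [:0, 1:] n) i)"
proof (induction n arbitrary: i)
  case 0
  show ?case unfolding coeff_falling_0 using place_value_of_nat[of t 0] place_value_of_nat[of t 1] by simp
next
  case (Suc n)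
  have "place_value t (case i of 0 \<Rightarrow> 0 | Suc i \<Rightarrow> coeff (falling [:0, 1:] n) i)
      (case i of 0 \<Rightarrow> 0 | Suc i \<Rightarrow> coeff (falling [:0, 1:] n) i)"
    using Suc place_value_of_nat[of t 0] by (cases i) simp_all
  then show ?case
    unfolding coeff_falling_Suc by (intro place_value_diff place_value_mult place_value_of_nat Suc)
qed

lemma of_rat_coeff_falling:
  "of_rat (coeff (falling [:0, 1:] n) i) = (coeff (falling [:0, 1:] n) i :: 'a::field_char_0)"
proof (induction n arbitrary: i)
  case (Suc n)
  show ?case
    unfolding coeff_falling_Suc by (cases i) (simp_all add: Suc of_rat_diff of_rat_mult of_rat_minus)
qed simp

lemma coeff_falling_const:
  "coeff (falling [:0, 1 :: 'a::comm_ring_1 poly:] n) j = [:coeff (falling [:0, 1:] n) j:]"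
proof (induction n arbitrary: j)
  case (Suc n)
  show ?case
    unfolding coeff_falling_Suc Suc by (cases j) (simp_all add: Suc of_nat_poly)
qed simp

lemma falling_const_poly: "falling [:x :: 'a::comm_ring_1 poly:] n = [:falling x n:]"
  by (induction n) (simp_all add: falling_Suc of_nat_poly)

lemma coeff_falling_monomial:
  "coeff (coeff ([:[:c :: 'a::comm_ring_1:]:] * falling [:[:0, 1:]:] m * falling [:0, 1:] n) j) i =
    c * coeff (falling [:0, 1:] m) i * coeff (falling [:0, 1:] n) j"
  by (simp add: falling_const_poly coeff_falling_const mult_ac)

definition ks_poly :: "nat \<Rightarrow> nat \<Rightarrow> nat \<Rightarrow> complex poly poly" where
  "ks_poly k b a = (\<Sum>(p, q) | p + q \<le> a. [:[:ks_coeff a (of_nat k + 1) p q:]:] *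
     falling [:[:0, 1:]:] (b + p) * falling [:0, 1:] (b + q))"

lemma coeff_ks_poly: "coeff (coeff (ks_poly k b a) j) i =
    (\<Sum>(p, q) | p + q \<le> a. ks_coeff a (of_nat k + 1) p q * coeff (falling [:0, 1:] (b + p)) i * coeff (falling [:0, 1:] (b + q)) j)"
  unfolding ks_poly_def coeff_sum
  by (intro sum.cong refl) (simp only: split_beta coeff_falling_monomial)

text \<open>After \<open>ks_coeff_eq\<close> every summand of a coefficient is free of a pole at k,
  so the coefficient may be specialized term by term.\<close>

lemma knop_sahi_at_eq:
  assumes "k_regular k (l1, l2)" and "l2 \<le> l1"
  shows "knop_sahi_at k (l1, l2) = ks_poly k l2 (l1 - l2)"
proof (rule poly_eqI, rule poly_eqI)
  fix j i
  let ?a = "l1 - l2"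
  define R where "R = (\<Sum>(p, q) | p + q \<le> ?a. ks_coeff ?a (of_nat k + 1 :: rat) p q *
      coeff (falling [:0, 1:] (l2 + p)) i * coeff (falling [:0, 1:] (l2 + q)) j)"
  have ks: "coeff (coeff (knop_sahi (l1, l2)) j) i = (\<Sum>(p, q) | p + q \<le> ?a. ks_coeff ?a (kappa + 1) p q *
      coeff (falling [:0, 1:] (l2 + p)) i * coeff (falling [:0, 1:] (l2 + q)) j)"
    unfolding knop_sahi_def prod.case coeff_sum
  proof (intro sum.cong refl)
    fix x assume "x \<in> {(p, q). p + q \<le> ?a}"
    then obtain p q where x: "x = (p, q)" and pq: "p + q \<le> ?a" by auto
    show "coeff (coeff (case x of (i, j) \<Rightarrow> [:[: fact (l1 - l2) * falling (kappa + 1) (l1 - l2 - i) * falling (kappa + 1) (l1 - l2 - j)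
          / (fact i * fact j * fact (l1 - l2 - i - j) * falling (kappa + 1) (l1 - l2)) :]:]
     * falling [:[:0, 1:]:] (l2 + i) * falling [:0, 1:] (l2 + j)) j) i =
      (case x of (p, q) \<Rightarrow> ks_coeff ?a (kappa + 1) p q *
      coeff (falling [:0, 1:] (l2 + p)) i * coeff (falling [:0, 1:] (l2 + q)) j)"
      unfolding x prod.case coeff_falling_monomial ks_coeff_eq[OF pq falling_kappa_nonzero] ..
  qed
  have "place_value (of_nat k) (coeff (coeff (knop_sahi (l1, l2)) j) i) R"
    unfolding ks R_def
  proof (intro place_value_sum)
    fix x assume "x \<in> {(p, q). p + q \<le> ?a}"
    then obtain p q where x: "x = (p, q)" and pq: "p + q \<le> ?a" by auto
    show "place_value (of_nat k) (case x of (p, q) \<Rightarrow> ks_coeff ?a (kappa + 1) p q *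
        coeff (falling [:0, 1:] (l2 + p)) i * coeff (falling [:0, 1:] (l2 + q)) j)
      (case x of (p, q) \<Rightarrow> ks_coeff ?a (of_nat k + 1) p q *
        coeff (falling [:0, 1:] (l2 + p)) i * coeff (falling [:0, 1:] (l2 + q)) j)"
      unfolding x prod.case
      by (intro place_value_mult place_value_ks_coeff[OF assms pq] place_value_coeff_falling)
  qed
  then have R: "fract_eval (of_nat k) (coeff (coeff (knop_sahi (l1, l2)) j) i) = R"
    by (rule fract_eval_eq)
  have 0: "fract_eval (of_nat k) 0 = 0"
    using fract_eval_eq[OF place_value_of_nat[of "of_nat k" 0]] by simp
  have "coeff (coeff (knop_sahi_at k (l1, l2)) j) i = of_rat R"
    unfolding knop_sahi_at_def by (simp add: coeff_map_poly 0 R)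
  also have "\<dots> = coeff (coeff (ks_poly k l2 ?a) j) i"
    unfolding coeff_ks_poly R_def of_rat_sum
    by (intro sum.cong refl) (auto simp: of_rat_mult of_rat_ks_coeff of_rat_coeff_falling of_rat_add)
  finally show "coeff (coeff (knop_sahi_at k (l1, l2)) j) i = coeff (coeff (ks_poly k l2 ?a) j) i" .
qed

lemma ks_poly_symmetric:
  assumes "k_regular k (l1, l2)" and "l2 \<le> l1"
  shows "symmetric2 (ks_poly k l2 (l1 - l2))"
  unfolding symmetric2_def coeff_ks_poly
proof (intro allI)
  fix i j
  show "(\<Sum>(p, q) | p + q \<le> l1 - l2. ks_coeff (l1 - l2) (of_nat k + 1) p q * coeff (falling [:0, 1:] (l2 + p)) i * coeff (falling [:0, 1:] (l2 + q)) j) =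
     (\<Sum>(p, q) | p + q \<le> l1 - l2. ks_coeff (l1 - l2) (of_nat k + 1 :: complex) p q * coeff (falling [:0, 1:] (l2 + p)) j * coeff (falling [:0, 1:] (l2 + q)) i)"
    by (rule sum.reindex_bij_witness[of _ prod.swap prod.swap])
      (auto simp: ks_coeff_symmetric[OF assms])
qed

lemma poly_falling: "poly (falling f n) x = falling (poly f x) n"
  by (induction n) (simp_all add: falling_Suc)

lemma poly_eval2_ks_poly: "poly_eval2 (ks_poly k b a) x y =
    (\<Sum>(p, q) | p + q \<le> a. ks_coeff a (of_nat k + 1) p q * (falling x (b + p) * falling y (b + q)))"
  unfolding poly_eval2_def ks_poly_def poly_sum
  by (intro sum.cong refl) (auto simp: poly_falling)

lemma poly_eval2_smult: "poly_eval2 (smult [:c:] f) x y = c * poly_eval2 f x y"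
  by (simp add: poly_eval2_def)

lemma symmetric2_smult: "symmetric2 f \<Longrightarrow> symmetric2 (smult [:c:] f)"
  by (simp add: symmetric2_def)

text \<open>The partitions with \<open>l1 - l2 \<ge> 2k + 3\<close> already give a Zariski dense set of points.\<close>

lemma poly_eval2_determined:
  assumes "\<And>\<mu>. \<mu> \<in> nonsingular2 k \<Longrightarrow>
     poly_eval2 f (of_nat (fst \<mu>) - of_nat k - 1) (of_nat (snd \<mu>)) =
     poly_eval2 g (of_nat (fst \<mu>) - of_nat k - 1) (of_nat (snd \<mu>))"
  shows "f = (g :: complex poly poly)"
proof -
  define F where "F = f - g"
  have zero: "poly F [:of_nat n:] = 0" for n
  proof (rule ccontr)
    assume "poly F [:of_nat n:] \<noteq> 0"
    then have "finite {x. poly (poly F [:of_nat n:]) x = 0}" by (rule poly_roots_finite)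
    moreover have "(\<lambda>m. of_nat (n + 2 * k + 3 + m) - of_nat k - 1) ` UNIV \<subseteq> {x. poly (poly F [:of_nat n:]) x = 0}"
    proof (intro subsetI, elim imageE)
      fix x m assume x: "x = of_nat (n + 2 * k + 3 + m) - of_nat k - (1 :: complex)"
      have "(n + 2 * k + 3 + m, n) \<in> nonsingular2 k"
        by (auto simp: nonsingular2_def partitions2_def k_regular_def)
      from assms[OF this] show "x \<in> {x. poly (poly F [:of_nat n:]) x = 0}"
        by (simp add: x F_def poly_eval2_def)
    qed
    ultimately have "finite (range (\<lambda>m. of_nat (n + 2 * k + 3 + m) - of_nat k - (1 :: complex)))"
      by (rule finite_subset[rotated])
    moreover have "inj (\<lambda>m. of_nat (n + 2 * k + 3 + m) - of_nat k - (1 :: complex))"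
      by (auto simp: inj_def)
    ultimately show False using finite_imageD infinite_UNIV_nat by blast
  qed
  have "F = 0"
  proof (rule ccontr)
    assume "F \<noteq> 0"
    then have "finite {x. poly F x = 0}" by (rule poly_roots_finite)
    moreover have "range (\<lambda>n. [:of_nat n :: complex:]) \<subseteq> {x. poly F x = 0}" using zero by auto
    ultimately have "finite (range (\<lambda>n. [:of_nat n :: complex:]))" by (rule finite_subset[rotated])
    moreover have "inj (\<lambda>n. [:of_nat n :: complex:])" by (auto simp: inj_def)
    ultimately show False using finite_imageD infinite_UNIV_nat by blast
  qed
  then show ?thesis by (simp add: F_def)
qed

section \<open>The eigenvalue polynomial\<close>

lemma prod_remove_atMost:
  fixes f :: "nat \<Rightarrow> 'a::comm_monoid_mult"
  shows "(\<Prod>j\<in>{..b + s} - {b}. f j) = (\<Prod>j<b. f j) * (\<Prod>r<s. f (b + Suc r))"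
proof (induction s)
  case 0
  have "{..b} - {b} = {..<b}" by auto
  then show ?case by simp
next
  case (Suc s)
  have "{..b + Suc s} - {b} = insert (b + Suc s) ({..b + s} - {b})" by auto
  then show ?case using Suc by (simp add: mult_ac)
qed

text \<open>The factors with j < l2 make up \<open>knop_sahi_H\<close> without (l1 - l2)!; those
  with j > l2 make up the denominators left in \<open>ks_coeff_expansion\<close>.\<close>

lemma capelli_denominator:
  fixes k l1 l2 s :: nat
  assumes "l2 \<le> l1"
  shows "(\<Prod>j\<in>{..l2 + s} - {l2}. (of_nat l2 - of_nat j) * (of_nat l1 - of_nat k - 1 - of_nat j)) =
    fact l2 * falling (of_nat l1 - 1 - of_nat k) l2 *
    (fact s * falling (of_nat k + 1 - of_nat (l1 - l2) + of_nat s) s :: complex)"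
proof -
  have f: "(\<Prod>j<l2. of_nat l2 - of_nat j) = (fact l2 :: complex)"
    using falling_of_nat[of l2 l2, where 'a = complex] by (simp add: falling_def)
  have "(\<Prod>j<l2. (of_nat l2 - of_nat j) * (of_nat l1 - of_nat k - 1 - of_nat j)) =
      fact l2 * falling (of_nat l1 - 1 - of_nat k :: complex) l2"
    unfolding prod.distrib f falling_def by (simp add: algebra_simps)
  moreover have "(\<Prod>r<s. (of_nat l2 - of_nat (l2 + Suc r)) * (of_nat l1 - of_nat k - 1 - of_nat (l2 + Suc r))) =
      (fact s * falling (of_nat k + 1 - of_nat (l1 - l2) + of_nat s) s :: complex)"
  proof -
    \<comment> \<open>For j > l2 the signs of both factors are reversed, and the two reversals
      cancel.\<close>
    have "(\<Prod>r<s. (of_nat l2 - of_nat (l2 + Suc r)) * (of_nat l1 - of_nat k - 1 - of_nat (l2 + Suc r)) :: complex) =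
        (\<Prod>r<s. of_nat (Suc r)) * (\<Prod>r<s. of_nat k + 1 - of_nat (l1 - l2) + of_nat (Suc r))"
      unfolding prod.distrib[symmetric] using assms
      by (intro prod.cong refl) (simp add: of_nat_diff algebra_simps)
    also have "(\<Prod>r<s. of_nat (Suc r)) = (fact s :: complex)"
      by (simp add: fact_prod_Suc lessThan_atLeast0)
    also have "(\<Prod>r<s. of_nat k + 1 - of_nat (l1 - l2) + of_nat (Suc r)) =
        falling (of_nat k + 1 - of_nat (l1 - l2) + of_nat s :: complex) s"
      unfolding falling_def
      by (rule prod.reindex_bij_witness[of _ "\<lambda>r. s - Suc r" "\<lambda>r. s - Suc r"])
        (auto simp: of_nat_diff algebra_simps Suc_diff_Suc)
    finally show ?thesis .
  qed
  ultimately show ?thesis unfolding prod_remove_atMost by simp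
qed

text \<open>Common factors \<open>falling x l2\<close> and \<open>falling y l2\<close> are taken
  out, which shifts x and y by l2; then \<open>ks_coeff_expansion\<close> applies with s = i -
  l2.\<close>

lemma ks_poly_expansion:
  fixes x y :: complex
  assumes reg: "k_regular k (l1, l2)" and l: "l2 \<le> l1"
  shows "poly_eval2 (smult [:1 / knop_sahi_H (l1, l2) (of_nat k):] (ks_poly k l2 (l1 - l2))) x y =
    (\<Sum>i=l2..(l1 + l2) div 2. falling (x + y + of_nat k + 1 - 2 * of_nat i) (l1 + l2 - 2 * i) *
      (falling x i * falling y i) / (fact (l1 + l2 - 2 * i) *
      (\<Prod>j\<in>{..i} - {l2}. (of_nat l2 - of_nat j) * (of_nat l1 - of_nat k - 1 - of_nat j))))"
proof -
  let ?a = "l1 - l2" and ?N = "of_nat k + 1 :: complex"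
  let ?X = "x - of_nat l2" and ?Y = "y - of_nat l2"
  let ?c = "falling x l2 * falling y l2 / (fact l2 * falling (of_nat l1 - 1 - of_nat k :: complex) l2)"
  let ?t = "\<lambda>s. falling (?X + ?Y + ?N - 2 * of_nat s) (?a - 2 * s) * (falling ?X s * falling ?Y s) /
      (fact (?a - 2 * s) * fact s * falling (?N - of_nat ?a + of_nat s) s)"
  have "poly_eval2 (smult [:1 / knop_sahi_H (l1, l2) (of_nat k):] (ks_poly k l2 ?a)) x y =
      1 / knop_sahi_H (l1, l2) (of_nat k) * (falling x l2 * falling y l2 *
       (\<Sum>(p, q) | p + q \<le> ?a. ks_coeff ?a ?N p q * (falling ?X p * falling ?Y q)))"
    unfolding poly_eval2_smult poly_eval2_ks_poly sum_distrib_left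
    by (intro sum.cong refl) (auto simp: falling_add mult_ac)
  also have "\<dots> = ?c * (\<Sum>s\<le>?a div 2. ?t s)"
    unfolding ks_coeff_expansion by (simp add: knop_sahi_H_def)
  also have "\<dots> = (\<Sum>s\<le>?a div 2. ?c * ?t s)"
    by (rule sum_distrib_left)
  also have "\<dots> = (\<Sum>i=l2..(l1 + l2) div 2. falling (x + y + of_nat k + 1 - 2 * of_nat i) (l1 + l2 - 2 * i) *
      (falling x i * falling y i) / (fact (l1 + l2 - 2 * i) *
      (\<Prod>j\<in>{..i} - {l2}. (of_nat l2 - of_nat j) * (of_nat l1 - of_nat k - 1 - of_nat j))))"
  proof (rule sum.reindex_bij_witness[of _ "\<lambda>i. i - l2" "\<lambda>s. l2 + s"])
    fix s assume "s \<in> {..?a div 2}"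
    have 1: "l1 + l2 - 2 * (l2 + s) = ?a - 2 * s" using l by simp
    have 2: "x + y + of_nat k + 1 - 2 * of_nat (l2 + s) = ?X + ?Y + ?N - 2 * of_nat s"
      by (simp add: algebra_simps)
    show "falling (x + y + of_nat k + 1 - 2 * of_nat (l2 + s)) (l1 + l2 - 2 * (l2 + s)) *
      (falling x (l2 + s) * falling y (l2 + s)) / (fact (l1 + l2 - 2 * (l2 + s)) *
      (\<Prod>j\<in>{..l2 + s} - {l2}. (of_nat l2 - of_nat j) * (of_nat l1 - of_nat k - 1 - of_nat j))) = ?c * ?t s"
      unfolding 1 2 capelli_denominator[OF l] falling_add[of x] falling_add[of y] by (simp add: mult_ac)
  qed (use l in auto)
  finally show ?thesis .
qed

context superform begin

text \<open>By \<open>tev_diff\<close> each factor of \<open>rpoly\<close> splits at an eigenvalue.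
  This is the origin of the variables x = a - k - 1 and y = b of the eigenvalue polynomial.\<close>

lemma poly_rpoly_tev:
  assumes "b \<le> a"
  shows "poly (rpoly (a + b) i) (tev (a + b) b) =
    4 ^ i * (falling (of_nat a - of_nat k - 1) i * falling (of_nat b) i)"
proof (induction i)
  case (Suc i)
  have "tev (a + b) b - tev (a + b) i = 4 * ((of_nat a - of_nat k - 1 - of_nat i) * (of_nat b - of_nat i))"
    unfolding tev_diff by simp
  then have "poly [:- tev (a + b) i, 1:] (tev (a + b) b) =
      4 * ((of_nat a - of_nat k - 1 - of_nat i) * (of_nat b - of_nat i))"
    by simp
  then show ?case
    unfolding rpoly_Suc poly_mult Suc falling_Suc by (simp only: power_Suc mult_ac)
qed (simp add: rpoly_def)

lemma capelli_eigenvalues: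
  assumes "CARD('i) \<ge> 2" and l: "l2 \<le> l1" "k_regular k (l1, l2)" and \<mu>: "\<mu> \<in> nonsingular2 k"
  shows "{c. \<exists>q\<in>Vmod \<omega> k \<mu>. q \<noteq> 0 \<and> capelli \<omega> k (l1, l2) q = spscale c q} =
    {poly_eval2 (smult [:1 / knop_sahi_H (l1, l2) (of_nat k):] (ks_poly k l2 (l1 - l2)))
       (of_nat (fst \<mu>) - of_nat k - 1) (of_nat (snd \<mu>))}"
proof -
  obtain a b where ab: "\<mu> = (a, b)" by (cases \<mu>)
  have ba: "b \<le> a" using \<mu> by (auto simp: ab nonsingular2_def partitions2_def)
  let ?d = "l1 + l2"
  define P where "P = (\<Sum>i=l2..?d div 2. smult (capelli_coeff ?d l2 i / fact (?d - 2 * i) *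
      falling (of_nat (a + b) - 2 * of_nat i) (?d - 2 * i)) (rpoly (a + b) i))"
  have "capelli \<omega> k (l1, l2) q = pact rlap P q" if "q \<in> homog (a + b)" for q
    unfolding capelli_eq[OF l] P_def by (rule capelli_tensor_op_poly[OF that])
  from eigenvalues_on_Vmod[OF assms(1) ba this]
  have "{c. \<exists>q\<in>Vmod \<omega> k \<mu>. q \<noteq> 0 \<and> capelli \<omega> k (l1, l2) q = spscale c q} = {poly P (tev (a + b) b)}"
    by (simp only: ab)
  also have "poly P (tev (a + b) b) =
     poly_eval2 (smult [:1 / knop_sahi_H (l1, l2) (of_nat k):] (ks_poly k l2 (l1 - l2)))
       (of_nat a - of_nat k - 1) (of_nat b)"
    unfolding ks_poly_expansion[OF l(2,1)] P_def poly_sum poly_smult poly_rpoly_tev[OF ba]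
  proof (intro sum.cong refl)
    fix i
    have "(\<Prod>j\<in>{..i} - {l2}. tev ?d l2 - tev ?d j) =
        4 ^ card ({..i} - {l2}) * (\<Prod>j\<in>{..i} - {l2}. (of_nat l2 - of_nat j) * (of_nat l1 - of_nat k - 1 - of_nat j))"
      unfolding tev_diff prod.distrib by simp
    moreover assume "i \<in> {l2..?d div 2}"
    \<comment> \<open>One of i + 1 indices is removed, so the powers of 4 in the Newton coefficient
      and in \<open>poly_rpoly_tev\<close> cancel.\<close>
    then have "card ({..i} - {l2}) = i" by simp
    moreover have "(of_nat a - of_nat k - 1) + of_nat b + of_nat k + 1 - 2 * of_nat i = of_nat (a + b) - (2 * of_nat i :: complex)"
      by simp
    ultimately show "capelli_coeff ?d l2 i / fact (?d - 2 * i) * falling (of_nat (a + b) - 2 * of_nat i) (?d - 2 * i) *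
        (4 ^ i * (falling (of_nat a - of_nat k - 1) i * falling (of_nat b) i)) =
      falling ((of_nat a - of_nat k - 1) + of_nat b + of_nat k + 1 - 2 * of_nat i) (?d - 2 * i) *
      (falling (of_nat a - of_nat k - 1) i * falling (of_nat b) i) / (fact (?d - 2 * i) *
      (\<Prod>j\<in>{..i} - {l2}. (of_nat l2 - of_nat j) * (of_nat l1 - of_nat k - 1 - of_nat j)))"
      unfolding capelli_coeff_def by (simp add: mult_ac)
  qed
  finally show ?thesis by (simp add: ab)
qed

lemma eigenvalue_poly_capelli:
  assumes "CARD('i) \<ge> 2" and l: "l2 \<le> l1" "k_regular k (l1, l2)"
  shows "eigenvalue_poly \<omega> k (capelli \<omega> k (l1, l2)) =
    smult [:1 / knop_sahi_H (l1, l2) (of_nat k):] (knop_sahi_at k (l1, l2))"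
  unfolding eigenvalue_poly_def knop_sahi_at_eq[OF l(2,1)]
proof (rule the_equality)
  let ?f = "smult [:1 / knop_sahi_H (l1, l2) (of_nat k):] (ks_poly k l2 (l1 - l2))"
  show "symmetric2 ?f \<and> (\<forall>\<mu>\<in>nonsingular2 k.
        {c. \<exists>q\<in>Vmod \<omega> k \<mu>. q \<noteq> 0 \<and> capelli \<omega> k (l1, l2) q = spscale c q} =
        {poly_eval2 ?f (of_nat (fst \<mu>) - of_nat k - 1) (of_nat (snd \<mu>))})"
    by (intro conjI symmetric2_smult ks_poly_symmetric[OF l(2,1)] ballI capelli_eigenvalues[OF assms])
  fix f
  assume "symmetric2 f \<and> (\<forall>\<mu>\<in>nonsingular2 k.
        {c. \<exists>q\<in>Vmod \<omega> k \<mu>. q \<noteq> 0 \<and> capelli \<omega> k (l1, l2) q = spscale c q} =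
        {poly_eval2 f (of_nat (fst \<mu>) - of_nat k - 1) (of_nat (snd \<mu>))})"
  then show "f = ?f"
    using capelli_eigenvalues[OF assms] by (intro poly_eval2_determined[of k]) auto
qed

end

section \<open>The inverse of the Gram matrix\<close>

lemma form_inverse_exists:
  fixes \<omega> :: "('i::finite, 'j::{finite,linorder}) smat"
  assumes "even_supersym_nondeg \<omega>"
  obtains h where "\<And>p u. (\<Sum>v\<in>UNIV. h p v * \<omega> v u) = (if p = u then 1 else 0)"
    and "\<And>p u. (\<Sum>v\<in>UNIV. \<omega> p v * h v u) = (if p = u then 1 else 0)"
proof -
  \<comment> \<open>The transpose of the Gram matrix, because nondegeneracy is stated for vectors
    multiplied from the left.\<close>
  define M :: "complex ^ ('i + 'j) ^ ('i + 'j)" where "M = (\<chi> v u. \<omega> u v)"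
  have "\<forall>x. M *v x = 0 \<longrightarrow> x = 0"
  proof (intro allI impI)
    fix x assume "M *v x = 0"
    then have "(\<Sum>u\<in>UNIV. x $ u * \<omega> u v) = 0" for v
      by (simp add: matrix_vector_mult_def M_def vec_eq_iff mult.commute)
    then have "x $ u = 0" for u
      using assms unfolding even_supersym_nondeg_def by blast
    then show "x = 0" by (simp add: vec_eq_iff)
  qed
  then obtain B where B: "B ** M = mat 1" using matrix_left_invertible_ker by blast
  then have B': "M ** B = mat 1" by (simp add: matrix_left_right_inverse)
  have "(\<Sum>v\<in>UNIV. B $ v $ p * \<omega> v u) = (if p = u then 1 else 0)" for p u
  proof -
    have "(M ** B) $ u $ p = (if p = u then 1 else 0)" by (simp add: B' mat_def)
    then show ?thesis by (simp add: matrix_matrix_mult_def M_def mult.commute)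
  qed
  moreover have "(\<Sum>v\<in>UNIV. \<omega> p v * B $ u $ v) = (if p = u then 1 else 0)" for p u
  proof -
    have "(B ** M) $ u $ p = (if p = u then 1 else 0)" by (simp add: B mat_def)
    then show ?thesis by (simp add: matrix_matrix_mult_def M_def mult.commute)
  qed
  ultimately show thesis using that[of "\<lambda>p v. B $ v $ p"] by blast
qed

text \<open>Uniqueness of the inverse transfers evenness and supersymmetry from the form to
  \<open>h\<close>.\<close>

lemma superform_exists:
  fixes \<omega> :: "('i::finite, 'j::{finite,linorder}) smat"
  assumes nondeg: "even_supersym_nondeg \<omega>"
    and "m \<le> n" and "k = n - m" and "CARD('i) = 2 * m" and "CARD('j) = 2 * n"
  shows "\<exists>h. superform \<omega> h k"
proof -
  obtain h where h1: "\<And>p u. (\<Sum>v\<in>UNIV. h p v * \<omega> v u) = (if p = u then 1 else 0)"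
    and h2: "\<And>p u. (\<Sum>v\<in>UNIV. \<omega> p v * h v u) = (if p = u then 1 else 0)"
    using form_inverse_exists[OF nondeg] by blast
  have par: "\<omega> u v = 0" if "is_odd u \<noteq> is_odd v" for u v
    using nondeg that unfolding even_supersym_nondeg_def by blast
  have sym: "\<omega> u v = ssign u v * \<omega> v u" for u v
    using nondeg unfolding even_supersym_nondeg_def ssign_def by blast
  have unique: "h' = h" if "\<And>p u. (\<Sum>v\<in>UNIV. h' p v * \<omega> v u) = (if p = u then 1 else 0)" for h'
  proof (intro ext)
    fix p r
    have "h' p r = (\<Sum>v\<in>UNIV. h' p v * (\<Sum>u\<in>UNIV. \<omega> v u * h u r))"
      by (simp add: h2 if_distrib[of "\<lambda>c. _ * c"] cong: if_cong)
    also have "\<dots> = (\<Sum>u\<in>UNIV. (\<Sum>v\<in>UNIV. h' p v * \<omega> v u) * h u r)"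
      unfolding sum_distrib_left sum_distrib_right by (subst sum.swap) (simp only: mult.assoc)
    also have "\<dots> = h p r"
      by (simp add: that if_distrib[of "\<lambda>c. c * _"] cong: if_cong)
    finally show "h' p r = h p r" .
  qed
  \<comment> \<open>Conjugation by parity yields another left inverse because the form is
    even.\<close>
  have eq1: "(\<lambda>p v. ssign p p * ssign v v * h p v) = h"
  proof (rule unique)
    fix p u
    have *: "ssign p p * ssign v v * h p v * \<omega> v u = ssign p p * ssign u u * (h p v * \<omega> v u)" for v
      using par[of v u] by (cases "is_odd v = is_odd u") (auto simp: ssign_def)
    show "(\<Sum>v\<in>UNIV. ssign p p * ssign v v * h p v * \<omega> v u) = (if p = u then 1 else 0)"
      unfolding * sum_distrib_left[symmetric] h1 by simp
  qed
  have hpar: "h p v = ssign p p * ssign v v * h p v" for p v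
    by (rule arg_cong[OF eq1, of "\<lambda>f. f p v", symmetric])
  have hp0: "h p v = 0" if "is_odd p \<noteq> is_odd v" for p v
    using hpar[of p v] that by (auto simp: ssign_def split: if_splits)
  \<comment> \<open>The super transpose is a left inverse as well because the form is
    supersymmetric.\<close>
  have eq2: "(\<lambda>p v. ssign p v * h v p) = h"
  proof (rule unique)
    fix p u
    have "ssign p v * h v p * \<omega> v u = ssign p u * ssign u u * (\<omega> u v * h v p)" for v
      using par[of v u] sym[of v u] hp0[of v p]
      by (cases "is_odd v = is_odd u"; cases "is_odd v = is_odd p") (auto simp: ssign_def)
    then have "(\<Sum>v\<in>UNIV. ssign p v * h v p * \<omega> v u) = ssign p u * ssign u u * (if u = p then 1 else 0)"
      by (simp only: h2 sum_distrib_left[symmetric])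
    then show "(\<Sum>v\<in>UNIV. ssign p v * h v p * \<omega> v u) = (if p = u then 1 else 0)"
      by (auto simp: ssign_def)
  qed
  have hsym: "h p v = ssign p v * h v p" for p v
    by (rule arg_cong[OF eq2, of "\<lambda>f. f p v", symmetric])
  have "(\<Sum>u\<in>UNIV. ssign u (u :: 'i + 'j)) = of_nat (CARD('i)) - of_nat (CARD('j))"
    unfolding sum_UNIV_Plus by (simp add: ssign_def)
  also have "\<dots> = - 2 * of_nat k" using assms by (simp add: of_nat_diff)
  finally have "superform \<omega> h k"
    using par sym hp0 hsym h1 h2 by unfold_locales
  then show ?thesis by blast
qed

theorem theoremA:
  fixes \<omega> :: "('i::finite, 'j::{finite,linorder}) smat"
    and m n k :: nat and l :: "nat \<times> nat"
  assumes "m > 0" and "n > 0" and "m \<le> n" and "k = n - m"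
    and "CARD('i) = 2 * m" and "CARD('j) = 2 * n"
    and "even_supersym_nondeg \<omega>"
    and "l \<in> partitions2" and "k_regular k l"
  shows "eigenvalue_poly \<omega> k (capelli \<omega> k l) =
    smult [:1 / knop_sahi_H l (of_nat k):] (knop_sahi_at k l)"
proof -
  obtain h where "superform \<omega> h k"
    using superform_exists assms by blast
  then interpret superform \<omega> h k .
  obtain l1 l2 where l: "l = (l1, l2)" by (cases l)
  show ?thesis
    unfolding l using assms by (intro eigenvalue_poly_capelli) (auto simp: l partitions2_def)
qed

end
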